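(* Assume that (A1) $\bar A_k$ is invertible for every $k\in[\![0,N-1]\!]$, and (A2) there exists $k_{\mathrm r}\in[\![1,N]\!]$ such that $\mathcal R(k,0)$ is invertible for every $k\in[\![k_{\mathrm r},N]\!]$ and $\mathcal R(N,k)$ is invertible for every $k\in[\![0,k_{\mathrm r}]\!]$. Then the unique optimal policy of the MaxEnt density control problem described in the context is given by $$\pi_k^*(u|x_k)=\mathcal N\bigl(u\,\big|\,-(R_k+B_k^\top\Pi_{k+1}^{(\varepsilon)}B_k)^{-1}(B_k^\top\Pi_{k+1}^{(\varepsilon)}A_k+S_k^\top)x_k,\ \varepsilon(R_k+B_k^\top\Pi_{k+1}^{(\varepsilon)}B_k)^{-1}\bigr)$$ for $k\in[\![0,N-1]\!]$, $u\in\mathbb R^m$, $x_k\in\mathbb R^n$, where $\{\Pi_k^{(\varepsilon)}\}$ is the solution to $$\Pi_k=\bar A_k^\top\Pi_{k+1}\bar A_k-\bar A_k^\top\Pi_{k+1}B_k(R_k+B_k^\top\Pi_{k+1}B_k)^{-1}B_k^\top\Pi_{k+1}\bar A_k+\bar Q_k,\quad k\in[\![0,N-1]\!],$$ with terminal value $$\Pi_N=-\varphi_{R,12}^{-1}\varphi_{R,11}+\tfrac{\varepsilon}{2}\bar\Sigma_N^{-1}+\bar\Sigma_N^{-1/2}\Bigl(\tfrac{\varepsilon^2}{4}I+\bar\Sigma_N^{1/2}\varphi_{R,12}^{-1}\bar\Sigma_0\varphi_{R,12}^{-\top}\bar\Sigma_N^{1/2}\Bigr)^{1/2}\bar\Si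gma_N^{-1/2}.$$
   Context: Notation: $n,m,N$ are positive integers; $[\![k,l]\!]=\{k,k+1,\dots,l\}$; $\mathcal S^n$ is the set of real symmetric $n\times n$ matrices; $\succ,\succeq$ denote the positive (semi)definite order; $X^{1/2}$ is the positive semidefinite square root of $X\succeq0$; $X^{-\top}$ is the transpose of the inverse; $\mathcal N(\cdot|\mu,\Sigma)$ is the Gaussian density with mean $\mu$ and covariance $\Sigma\succ0$. Data: $\varepsilon>0$; for $k\in[\![0,N-1]\!]$, $A_k\in\mathbb R^{n\times n}$, $B_k\in\mathbb R^{n\times m}$, $S_k\in\mathbb R^{n\times m}$, $Q_k\in\mathcal S^n$, $R_k\in\mathcal S^m$ with $R_k\succ0$; $\bar A_k:=A_k-B_kR_k^{-1}S_k^\top$, $\bar Q_k:=Q_k-S_kR_k^{-1}S_k^\top$, with $\bar Q_k\succeq0$; $\bar\Sigma_0,\bar\Sigma_N\in\mathcal S^n$ are positive definite. MaxEnt density control problem: find a policy $\pi=\{\pi_k\}_{k=0}^{N-1}$ minimizing $$\mathbb E\Bigl[\sum_{k=0}^{N-1}\Bigl(\tfrac12\begin{bmatrix}x_k\\ u_k\end{bmatrix}^\top\begin{bmatrix}Q_k&S_k\\ S_k^\top&R_k\end{bmatrix}\begin{bmatrix}x_k\\ u_k\end{bmatrix}-\varepsilon\mathcal H(\pi_k(\cdot|h_k))\Bigr)\Bigr]$$ subject to $x_{k+1}=A_kx_k+B_ku_k$, $u_k\sim\pi_k(\cdot|h_k)$ given the history $h_k=\{x_0,u_0,\dots,x_{k-1},u_{k-1},x_k\}$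 ($k=0,\dots,N-1$), and $x_0\sim\mathcal N(0,\bar\Sigma_0)$, $x_N\sim\mathcal N(0,\bar\Sigma_N)$. Here $\pi_k(\cdot|h_k)$ is the conditional density of $u_k$ given $h_k$ (as such determined only up to null sets), and $\mathcal H(\pi_k(\cdot|h_k))=-\int_{\mathbb R^m}\pi_k(u|h_k)\log\pi_k(u|h_k)\,du$. Writing $\pi_k(\cdot|x_k)$ means that $\pi_k(\cdot|h_k)$ depends on $h_k$ only through $x_k$. Transition matrices: for invertible $\bar A_k$, $$M_k(R_k):=\begin{bmatrix}\bar A_k+B_kR_k^{-1}B_k^\top\bar A_k^{-\top}\bar Q_k&-B_kR_k^{-1}B_k^\top\bar A_k^{-\top}\\ -\bar A_k^{-\top}\bar Q_k&\bar A_k^{-\top}\end{bmatrix},$$ which is invertible; $\Phi_{M(R)}(k,l):=M_{k-1}(R_{k-1})\cdots M_l(R_l)$ if $k>l$, $I$ if $k=l$, and $M_k(R_k)^{-1}M_{k+1}(R_{k+1})^{-1}\cdots M_{l-1}(R_{l-1})^{-1}$ if $k<l$. $\Phi_{R,ij}(k,l)$ are its $n\times n$ blocks and $\varphi_{R,ij}:=\Phi_{R,ij}(0,N)$. $\Phi_{\bar A}(k,l)$ is defined in the same way from $\{\bar A_k\}$. Reachability Gramian: $\mathcal R(k_1,k_0):=\sum_{k=k_0}^{k_1-1}\Phi_{\bar A}(k_1,k+1)B_kB_k^\top\Phi_{\bar A}(k_1,k+1)^\top$ (empty sum $=0$ if $k_1=k_0$). Under (A1) and (A2), $\varphi_{R,12}$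 is invertible and the solution $\{\Pi_k^{(\varepsilon)}\}$ exists on $[\![0,N]\!]$. *)

theory Defs
  imports "HOL-Probability.Probability"
begin

section \<open>Matrices\<close>

text \<open>Symmetry is part of (semi)definiteness.\<close>

definition psd :: "real^'n^'n \<Rightarrow> bool" where
  "psd X \<longleftrightarrow> transpose X = X \<and> (\<forall>v. 0 \<le> v \<bullet> (X *v v))"

definition pd :: "real^'n^'n \<Rightarrow> bool" where
  "pd X \<longleftrightarrow> transpose X = X \<and> (\<forall>v. v \<noteq> 0 \<longrightarrow> 0 < v \<bullet> (X *v v))"

definition psd_sqrt :: "real^'n^'n \<Rightarrow> real^'n^'n" where
  "psd_sqrt X = (THE Y. psd Y \<and> Y ** Y = X)"

definition block_matrix ::
    "real^'c^'r \<Rightarrow> real^'d^'r \<Rightarrow> real^'c^'s \<Rightarrow> real^'d^'s \<Rightarrow> real^('c + 'd)^('r + 's)" where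
  "block_matrix X11 X12 X21 X22 = (\<chi> i j.
     case i of
       Inl a \<Rightarrow> (case j of Inl c \<Rightarrow> X11 $ a $ c | Inr d \<Rightarrow> X12 $ a $ d)
     | Inr b \<Rightarrow> (case j of Inl c \<Rightarrow> X21 $ b $ c | Inr d \<Rightarrow> X22 $ b $ d))"

definition block_vector :: "real^'c \<Rightarrow> real^'d \<Rightarrow> real^('c + 'd)" where
  "block_vector x u = (\<chi> i. case i of Inl a \<Rightarrow> x $ a | Inr b \<Rightarrow> u $ b)"

definition block11 :: "real^('c::finite + 'd::finite)^('r::finite + 's::finite) \<Rightarrow> real^'c^'r" where
  "block11 X = (\<chi> i j. X $ Inl i $ Inl j)"

definition block12 :: "real^('c::finite + 'd::finite)^('r::finite + 's::finite) \<Rightarrow> real^'d^'r" where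
  "block12 X = (\<chi> i j. X $ Inl i $ Inr j)"

text \<open>
  \<open>forward_prod M l d\<close> is \<open>M (l+d-1) ** \<dots> ** M l\<close>, and \<open>backward_prod M k d\<close> is
  \<open>matrix_inv (M k) ** \<dots> ** matrix_inv (M (k+d-1))\<close>.
\<close>

primrec forward_prod :: "(nat \<Rightarrow> real^'a^'a) \<Rightarrow> nat \<Rightarrow> nat \<Rightarrow> real^'a^'a" where
  "forward_prod M l 0 = mat 1"
| "forward_prod M l (Suc d) = M (l + d) ** forward_prod M l d"

primrec backward_prod :: "(nat \<Rightarrow> real^'a^'a) \<Rightarrow> nat \<Rightarrow> nat \<Rightarrow> real^'a^'a" where
  "backward_prod M k 0 = mat 1"
| "backward_prod M k (Suc d) = backward_prod M k d ** matrix_inv (M (k + d))"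

definition transition :: "(nat \<Rightarrow> real^'a^'a) \<Rightarrow> nat \<Rightarrow> nat \<Rightarrow> real^'a^'a" where
  "transition M k l =
     (if l \<le> k then forward_prod M l (k - l) else backward_prod M k (l - k))"


section \<open>The linear-quadratic data\<close>

definition Abar ::
    "(nat \<Rightarrow> real^'n^'n) \<Rightarrow> (nat \<Rightarrow> real^'m^'n) \<Rightarrow> (nat \<Rightarrow> real^'m^'n) \<Rightarrow> (nat \<Rightarrow> real^'m^'m)
     \<Rightarrow> nat \<Rightarrow> real^'n^'n" where
  "Abar A B S R k = A k - B k ** matrix_inv (R k) ** transpose (S k)"

definition Qbar ::
    "(nat \<Rightarrow> real^'n^'n) \<Rightarrow> (nat \<Rightarrow> real^'m^'n) \<Rightarrow> (nat \<Rightarrow> real^'m^'m) \<Rightarrow> nat \<Rightarrow> real^'n^'n" where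
  "Qbar Q S R k = Q k - S k ** matrix_inv (R k) ** transpose (S k)"

text \<open>In the next three definitions \<open>A\<close> and \<open>Q\<close> stand for the transformed matrices
  \<open>Abar\<close> and \<open>Qbar\<close>.\<close>

definition hamiltonian_matrix ::
    "(nat \<Rightarrow> real^'n^'n) \<Rightarrow> (nat \<Rightarrow> real^'m^'n) \<Rightarrow> (nat \<Rightarrow> real^'n^'n) \<Rightarrow> (nat \<Rightarrow> real^'m^'m)
     \<Rightarrow> nat \<Rightarrow> real^('n + 'n)^('n + 'n)" where
  "hamiltonian_matrix A B Q R k =
     (let G = B k ** matrix_inv (R k) ** transpose (B k);
          T = transpose (matrix_inv (A k))
      in block_matrix (A k + G ** T ** Q k) (- (G ** T)) (- (T ** Q k)) T)"

definition gramian ::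
    "(nat \<Rightarrow> real^'n^'n) \<Rightarrow> (nat \<Rightarrow> real^'m^'n) \<Rightarrow> nat \<Rightarrow> nat \<Rightarrow> real^'n^'n" where
  "gramian A B k1 k0 =
     (\<Sum>k\<in>{k0..<k1}. transition A k1 (k + 1) ** B k ** transpose (B k)
                       ** transpose (transition A k1 (k + 1)))"

text \<open>Invertibility is demanded wherever an inverse occurs, because \<open>matrix_inv\<close> is an
  arbitrary matrix on singular arguments.\<close>

definition riccati_solution ::
    "real \<Rightarrow> nat \<Rightarrow> (nat \<Rightarrow> real^'n^'n) \<Rightarrow> (nat \<Rightarrow> real^'m^'n) \<Rightarrow> (nat \<Rightarrow> real^'n^'n)
     \<Rightarrow> (nat \<Rightarrow> real^'m^'m) \<Rightarrow> real^'n^'n \<Rightarrow> real^'n^'n \<Rightarrow> (nat \<Rightarrow> real^'n^'n) \<Rightarrow> bool" where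
  "riccati_solution \<epsilon> N A B Q R \<Sigma>0 \<Sigma>N P \<longleftrightarrow>
     (let \<Phi> = transition (hamiltonian_matrix A B Q R) 0 N;
          \<phi>11 = block11 \<Phi>;
          \<phi>12 = block12 \<Phi>;
          H = psd_sqrt \<Sigma>N
      in invertible \<phi>12 \<and>
         P N = - (matrix_inv \<phi>12 ** \<phi>11) + (\<epsilon> / 2) *\<^sub>R matrix_inv \<Sigma>N
               + matrix_inv H
                 ** psd_sqrt ((\<epsilon>\<^sup>2 / 4) *\<^sub>R mat 1
                      + H ** matrix_inv \<phi>12 ** \<Sigma>0 ** transpose (matrix_inv \<phi>12) ** H)
                 ** matrix_inv H) \<and>
     (\<forall>k<N. invertible (R k + transpose (B k) ** P (Suc k) ** B k) \<and>
        P k = transpose (A k) ** P (Suc k) ** A k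
              - transpose (A k) ** P (Suc k) ** B k
                ** matrix_inv (R k + transpose (B k) ** P (Suc k) ** B k)
                ** transpose (B k) ** P (Suc k) ** A k
              + Q k)"


section \<open>Maximum entropy density control\<close>

definition gaussian_density :: "real^'n \<Rightarrow> real^'n^'n \<Rightarrow> real^'n \<Rightarrow> real" where
  "gaussian_density \<mu> \<Sigma> x =
     exp (- ((x - \<mu>) \<bullet> (matrix_inv \<Sigma> *v (x - \<mu>))) / 2) / sqrt ((2 * pi) ^ CARD('n) * det \<Sigma>)"

definition gaussian :: "real^'n \<Rightarrow> real^'n^'n \<Rightarrow> (real^'n) measure" where
  "gaussian \<mu> \<Sigma> = density lborel (\<lambda>x. ennreal (gaussian_density \<mu> \<Sigma> x))"

text \<open>
  The history \<open>x\<^sub>0, u\<^sub>0, \<dots>, x\<^sub>k\<^sub>-\<^sub>1, u\<^sub>k\<^sub>-\<^sub>1, x\<^sub>k\<close> is the pair of families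
  \<open>(x\<^sub>i)\<close>, \<open>i \<le> k\<close>, and \<open>(u\<^sub>i)\<close>, \<open>i < k\<close>.
\<close>

type_synonym ('n, 'm) history = "(nat \<Rightarrow> real^'n) \<times> (nat \<Rightarrow> real^'m)"

type_synonym ('n, 'm) policy = "nat \<Rightarrow> ('n, 'm) history \<Rightarrow> real^'m \<Rightarrow> real"

definition history_space :: "nat \<Rightarrow> ('n::finite, 'm::finite) history measure" where
  "history_space k = PiM {..k} (\<lambda>_. borel) \<Otimes>\<^sub>M PiM {..<k} (\<lambda>_. borel)"

definition history_upto :: "nat \<Rightarrow> ('n::finite, 'm::finite) history \<Rightarrow> ('n, 'm) history" where
  "history_upto k = (\<lambda>(x, u). (restrict x {..k}, restrict u {..<k}))"

definition is_policy :: "nat \<Rightarrow> ('n::finite, 'm::finite) policy \<Rightarrow> bool" where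
  "is_policy N \<pi> \<longleftrightarrow>
     (\<forall>k<N. (\<lambda>(h, u). \<pi> k h u) \<in> borel_measurable (history_space k \<Otimes>\<^sub>M borel) \<and>
        (\<forall>h\<in>space (history_space k).
           (\<forall>u. 0 \<le> \<pi> k h u) \<and> (\<integral>\<^sup>+u. ennreal (\<pi> k h u) \<partial>lborel) = 1))"

text \<open>
  \<open>history_law A B \<Sigma>0 \<pi> k\<close> is the law of the history up to time \<open>k\<close> when
  \<open>x\<^sub>0\<close> is centred Gaussian with covariance \<open>\<Sigma>0\<close>. In the recursion, \<open>\<pi> k h v\<close> as
  a density with respect to (law of \<open>h\<^sub>k\<close>) times Lebesgue measure makes \<open>\<pi> k h\<close> the
  conditional density of \<open>u\<^sub>k\<close> given \<open>h\<^sub>k = h\<close>.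
\<close>

primrec history_law ::
    "(nat \<Rightarrow> real^'n^'n) \<Rightarrow> (nat \<Rightarrow> real^'m^'n) \<Rightarrow> real^'n^'n \<Rightarrow> ('n::finite, 'm::finite) policy
     \<Rightarrow> nat \<Rightarrow> ('n, 'm) history measure" where
  "history_law A B \<Sigma>0 \<pi> 0 =
     distr (gaussian 0 \<Sigma>0) (history_space 0) (\<lambda>x0. (\<lambda>i\<in>{..0}. x0, \<lambda>i\<in>{..<0}. 0))"
| "history_law A B \<Sigma>0 \<pi> (Suc k) =
     distr (density (history_law A B \<Sigma>0 \<pi> k \<Otimes>\<^sub>M lborel) (\<lambda>(h, v). ennreal (\<pi> k h v)))
       (history_space (Suc k))
       (\<lambda>((x, u), v). (x(Suc k := A k *v x k + B k *v v), u(k := v)))"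

definition feasible ::
    "nat \<Rightarrow> (nat \<Rightarrow> real^'n^'n) \<Rightarrow> (nat \<Rightarrow> real^'m^'n) \<Rightarrow> real^'n^'n \<Rightarrow> real^'n^'n
     \<Rightarrow> ('n::finite, 'm::finite) policy \<Rightarrow> bool" where
  "feasible N A B \<Sigma>0 \<Sigma>N \<pi> \<longleftrightarrow>
     is_policy N \<pi> \<and> distr (history_law A B \<Sigma>0 \<pi> N) borel (\<lambda>(x, u). x N) = gaussian 0 \<Sigma>N"

definition diff_entropy :: "(real^'m \<Rightarrow> real) \<Rightarrow> real" where
  "diff_entropy p = - (\<integral>u. p u * ln (p u) \<partial>lborel)"

definition running_cost ::
    "real \<Rightarrow> nat \<Rightarrow> (nat \<Rightarrow> real^'n^'n) \<Rightarrow> (nat \<Rightarrow> real^'m^'n) \<Rightarrow> (nat \<Rightarrow> real^'m^'m)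
     \<Rightarrow> ('n::finite, 'm::finite) policy \<Rightarrow> ('n, 'm) history \<Rightarrow> real" where
  "running_cost \<epsilon> N Q S R \<pi> = (\<lambda>(x, u). \<Sum>k<N.
     1 / 2 * (block_vector (x k) (u k)
              \<bullet> (block_matrix (Q k) (S k) (transpose (S k)) (R k) *v block_vector (x k) (u k)))
     - \<epsilon> * diff_entropy (\<pi> k (history_upto k (x, u))))"

text \<open>
  The expected running cost as an extended real. The expectation is the integral of the
  positive part minus that of the negative part, where \<open>\<infinity> - \<infinity> = \<infinity>\<close> in \<open>ereal\<close>.
  The cost is \<open>\<infinity>\<close> also if the entropy fails to be a finite integral with positive
  probability: an entropy \<open>-\<infinity>\<close> contributes \<open>\<infinity>\<close>, and an entropy that is \<open>\<infinity>\<close> or undefined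
  forces the conditional second moment of the input, hence the expected quadratic cost
  (when \<open>pd (R k)\<close> and \<open>psd (Qbar Q S R k)\<close>), to be infinite, so that the expected cost is
  of the form \<open>\<infinity> - \<infinity>\<close>.
\<close>

definition maxent_cost ::
    "real \<Rightarrow> nat \<Rightarrow> (nat \<Rightarrow> real^'n^'n) \<Rightarrow> (nat \<Rightarrow> real^'m^'n) \<Rightarrow> (nat \<Rightarrow> real^'n^'n)
     \<Rightarrow> (nat \<Rightarrow> real^'m^'n) \<Rightarrow> (nat \<Rightarrow> real^'m^'m) \<Rightarrow> real^'n^'n
     \<Rightarrow> ('n::finite, 'm::finite) policy \<Rightarrow> ereal" where
  "maxent_cost \<epsilon> N A B Q S R \<Sigma>0 \<pi> =
     (if \<forall>k<N. AE h in history_law A B \<Sigma>0 \<pi> k. integrable lborel (\<lambda>u. \<pi> k h u * ln (\<pi> k h u))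
      then enn2ereal (\<integral>\<^sup>+\<omega>. ennreal (running_cost \<epsilon> N Q S R \<pi> \<omega>) \<partial>history_law A B \<Sigma>0 \<pi> N)
         - enn2ereal (\<integral>\<^sup>+\<omega>. ennreal (- running_cost \<epsilon> N Q S R \<pi> \<omega>) \<partial>history_law A B \<Sigma>0 \<pi> N)
      else \<infinity>)"

definition is_optimal ::
    "real \<Rightarrow> nat \<Rightarrow> (nat \<Rightarrow> real^'n^'n) \<Rightarrow> (nat \<Rightarrow> real^'m^'n) \<Rightarrow> (nat \<Rightarrow> real^'n^'n)
     \<Rightarrow> (nat \<Rightarrow> real^'m^'n) \<Rightarrow> (nat \<Rightarrow> real^'m^'m) \<Rightarrow> real^'n^'n \<Rightarrow> real^'n^'n
     \<Rightarrow> ('n::finite, 'm::finite) policy \<Rightarrow> bool" where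
  "is_optimal \<epsilon> N A B Q S R \<Sigma>0 \<Sigma>N \<pi> \<longleftrightarrow>
     feasible N A B \<Sigma>0 \<Sigma>N \<pi> \<and>
     \<bar>maxent_cost \<epsilon> N A B Q S R \<Sigma>0 \<pi>\<bar> \<noteq> \<infinity> \<and>
     (\<forall>\<pi>'. feasible N A B \<Sigma>0 \<Sigma>N \<pi>' \<longrightarrow>
        maxent_cost \<epsilon> N A B Q S R \<Sigma>0 \<pi> \<le> maxent_cost \<epsilon> N A B Q S R \<Sigma>0 \<pi>')"

text \<open>Conditional densities matter only up to null sets, hence so does uniqueness.\<close>

definition is_unique_optimal ::
    "real \<Rightarrow> nat \<Rightarrow> (nat \<Rightarrow> real^'n^'n) \<Rightarrow> (nat \<Rightarrow> real^'m^'n) \<Rightarrow> (nat \<Rightarrow> real^'n^'n)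
     \<Rightarrow> (nat \<Rightarrow> real^'m^'n) \<Rightarrow> (nat \<Rightarrow> real^'m^'m) \<Rightarrow> real^'n^'n \<Rightarrow> real^'n^'n
     \<Rightarrow> ('n::finite, 'm::finite) policy \<Rightarrow> bool" where
  "is_unique_optimal \<epsilon> N A B Q S R \<Sigma>0 \<Sigma>N \<pi> \<longleftrightarrow>
     is_optimal \<epsilon> N A B Q S R \<Sigma>0 \<Sigma>N \<pi> \<and>
     (\<forall>\<pi>'. is_optimal \<epsilon> N A B Q S R \<Sigma>0 \<Sigma>N \<pi>' \<longrightarrow>
        (\<forall>k<N. AE h in history_law A B \<Sigma>0 \<pi>' k. AE u in lborel. \<pi>' k h u = \<pi> k h u))"

end

theory Submission
  imports Defs
begin

text \<open>
  The theorem rests on one identity. Suppose that \<open>P\<close> solves the Riccati recursion and put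
  \<open>Rh k = R k + B\<^sub>k\<^sup>T P\<^sub>k\<^sub>+\<^sub>1 B\<^sub>k\<close>. Completing the square turns the quadratic stage cost into
  \<open>1/2 x\<^sub>k\<^sup>T P\<^sub>k x\<^sub>k - 1/2 x\<^sub>k\<^sub>+\<^sub>1\<^sup>T P\<^sub>k\<^sub>+\<^sub>1 x\<^sub>k\<^sub>+\<^sub>1\<close> plus half the square, weighted with
  \<open>Rh k\<close>, of the deviation of \<open>u\<^sub>k\<close> from linear feedback. If \<open>Rh k\<close> is positive definite, that term is, up to a
  constant, \<open>- \<epsilon> ln\<close> of the Gaussian density claimed to be optimal; together with the entropy
  it averages to \<open>\<epsilon>\<close> times a relative entropy. The terms in \<open>P\<close> telescope, and every
  feasible policy has the same laws of \<open>x\<^sub>0\<close> and \<open>x\<^sub>N\<close>. So the cost of a feasible policy is a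
  common constant plus \<open>\<epsilon>\<close> times a sum of expected relative entropies with respect to the
  Gaussian policy. Gibbs' inequality gives optimality and uniqueness, once two facts about \<open>P\<close>
  are known: \<open>Rh k\<close> is positive definite, and the Gaussian policy reaches the prescribed terminal
  covariance.

  Positivity (\<open>riccati_positive\<close>). The terminal value is \<open>P N = \<Lambda> + Z\<close>, where
  \<open>\<Lambda> = - \<phi>12\<^sup>-\<^sup>1 \<phi>11\<close> and \<open>Z\<close> is positive definite. Among all controlled trajectories from the origin
  to a given \<open>y\<close>, the least quadratic cost is \<open>- y\<^sup>T \<Lambda> y\<close> (\<open>cost_from_origin_ge\<close>), so the cost with
  terminal penalty \<open>P N\<close> is positive on every nonzero control sequence started at the origin.
  Resting at the origin until time \<open>k\<close>, applying \<open>w\<close>, and then following the optimal feedback has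
  total cost \<open>w\<^sup>T Rh\<^sub>k w\<close>; hence that number is positive.

  Terminal covariance (\<open>terminal_covariance\<close>). Trajectories of the closed loop are trajectories of
  the Hamiltonian system, so the closed-loop transition matrix \<open>E\<close> satisfies \<open>\<phi>12 Z E = 1\<close>. A second
  Hamiltonian trajectory, ending in state \<open>0\<close>, carries the noise and yields
  \<open>\<Sigma>\<^sub>N = E (\<Sigma>\<^sub>0 E\<^sup>T + \<epsilon> \<phi>12)\<close>. The square root in the terminal value is what solves the resulting
  quadratic equation for \<open>Z\<close> (\<open>terminal_equation\<close>).

  The expectations need care because the cost of an arbitrary policy may be of the form
  \<open>\<infinity> - \<infinity>\<close>. Let \<open>val k\<close> be the cost accumulated before time \<open>k\<close>, less the
  constants mentioned above, plus \<open>1/2 x\<^sub>k\<^sup>T P\<^sub>k x\<^sub>k\<close>. Conditionally on the history it grows in the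
  mean by \<open>\<epsilon>\<close> times a relative entropy, so finiteness of the
  expected positive part passes from time \<open>N\<close> backwards to time \<open>0\<close>, and from there
  integrability and the expectation pass forwards to time \<open>N\<close> (\<open>controlled_step\<close>).
\<close>

section \<open>Matrices\<close>

text \<open>Transposes are kept, since the arguments below move them across inner products.\<close>

declare transpose_matrix_vector [simp del] vector_transpose_matrix [simp del]

lemma inner_matrix_vector_right:
  fixes A :: "real^'c^'r"
  shows "x \<bullet> (A *v y) = (transpose A *v x) \<bullet> y"
  by (metis dot_lmul_matrix transpose_matrix_vector)

lemma inner_symmetric_matrix:
  fixes A :: "real^'n^'n"
  assumes "transpose A = A"
  shows "x \<bullet> (A *v y) = y \<bullet> (A *v x)"
  by (metis assms inner_commute inner_matrix_vector_right)

lemma symmetric_by_inner: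
  fixes X :: "real^'k^'k"
  assumes "\<And>a b. a \<bullet> (X *v b) = b \<bullet> (X *v a)"
  shows "transpose X = X"
proof -
  have "a \<bullet> (transpose X *v b) = a \<bullet> (X *v b)" for a b
    using assms[of a b] inner_matrix_vector_right[of b X a] by (simp add: inner_commute)
  then show ?thesis unfolding matrix_eq by (metis vector_eq_ldot)
qed

lemma transpose_add: "transpose (A + B) = transpose A + transpose (B :: real^'c^'r)"
  by (simp add: transpose_def vec_eq_iff)

lemma transpose_diff: "transpose (A - B) = transpose A - transpose (B :: real^'c^'r)"
  by (simp add: transpose_def vec_eq_iff)

lemma matrix_vector_mult_minus_left: "(- A) *v x = - (A *v (x::real^'c))"
  by (metis diff_0 matrix_vector_mult_0 matrix_vector_mult_diff_rdistrib)

lemma matrix_vector_mult_minus_right: "A *v (- x) = - ((A::real^'c^'r) *v x)"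
  by (metis diff_0 matrix_vector_mult_0_right matrix_vector_mult_diff_distrib)

lemma scaleR_matrix_vector: "(c *\<^sub>R A) *v x = c *\<^sub>R ((A::real^'c^'r) *v x)"
  by (simp add: scaleR_matrix_vector_assoc)

lemma scaleR_matrix_mult: "(c *\<^sub>R A) ** B = c *\<^sub>R ((A::real^'c^'r) ** (B::real^'d^'c))"
  by (simp add: matrix_eq scaleR_matrix_vector flip: matrix_vector_mul_assoc)

lemma matrix_mult_scaleR: "A ** (c *\<^sub>R B) = c *\<^sub>R ((A::real^'c^'r) ** (B::real^'d^'c))"
  by (simp add: matrix_eq scaleR_matrix_vector matrix_vector_mult_scaleR flip: matrix_vector_mul_assoc)

lemma matrix_inv_both:
  fixes A :: "real^'n^'n"
  assumes "invertible A"
  shows "A ** matrix_inv A = mat 1 \<and> matrix_inv A ** A = mat 1"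
  using assms unfolding invertible_def matrix_inv_def by (rule someI_ex)

lemma
  fixes A :: "real^'n^'n"
  assumes "invertible A"
  shows matrix_inv_right: "A ** matrix_inv A = mat 1"
    and matrix_inv_left: "matrix_inv A ** A = mat 1"
  using matrix_inv_both[OF assms] by auto

lemma matrix_inv_vector_right: "invertible A \<Longrightarrow> A *v (matrix_inv A *v x) = x"
  for A :: "real^'n^'n"
  by (simp add: matrix_vector_mul_assoc matrix_inv_right)

lemma matrix_inv_vector_left: "invertible A \<Longrightarrow> matrix_inv A *v (A *v x) = x"
  for A :: "real^'n^'n"
  by (simp add: matrix_vector_mul_assoc matrix_inv_left)

lemma matrix_inv_unique:
  fixes A B :: "real^'n^'n"
  assumes "A ** B = mat 1"
  shows "matrix_inv A = B"
proof -
  have "invertible A" using assms invertible_right_inverse by blast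
  then show ?thesis by (metis assms matrix_inv_left matrix_mul_assoc matrix_mul_lid matrix_mul_rid)
qed

lemma invertible_matrix_inv: "invertible A \<Longrightarrow> invertible (matrix_inv A)" for A :: "real^'n^'n"
  using invertible_def matrix_inv_both by blast

lemma matrix_inv_matrix_inv: "invertible A \<Longrightarrow> matrix_inv (matrix_inv A) = A" for A :: "real^'n^'n"
  by (simp add: matrix_inv_left matrix_inv_unique)

lemma transpose_matrix_inv:
  "invertible A \<Longrightarrow> transpose (matrix_inv A) = matrix_inv (transpose A)" for A :: "real^'n^'n"
  by (metis matrix_inv_left matrix_inv_unique matrix_transpose_mul transpose_mat)

lemma invertible_by_kernel:
  fixes A :: "real^'n^'n"
  assumes "\<And>x. A *v x = 0 \<Longrightarrow> x = 0"
  shows "invertible A"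
  using assms by (simp add: invertible_left_inverse matrix_left_invertible_ker)

lemma pdD: "pd X \<Longrightarrow> v \<noteq> 0 \<Longrightarrow> 0 < v \<bullet> (X *v v)"
  by (simp add: pd_def)

lemma pd_symmetric: "pd X \<Longrightarrow> transpose X = X"
  by (simp add: pd_def)

lemma pd_nonneg: "pd X \<Longrightarrow> 0 \<le> v \<bullet> (X *v v)"
  by (cases "v = 0") (auto dest: pdD[of X v])

lemma pd_imp_psd: "pd X \<Longrightarrow> psd X"
  by (simp add: psd_def pd_nonneg pd_symmetric)

lemma pd_invertible: "pd X \<Longrightarrow> invertible X"
  by (rule invertible_by_kernel) (metis inner_zero_right less_irrefl pdD)

lemma pd_matrix_inv:
  assumes "pd X" shows "pd (matrix_inv X)"
  unfolding pd_def
proof (intro conjI allI impI)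
  note inv = pd_invertible[OF assms]
  show "transpose (matrix_inv X) = matrix_inv X"
    by (simp add: transpose_matrix_inv inv pd_symmetric assms)
  fix v :: "real^'a" assume "v \<noteq> 0"
  define w where "w = matrix_inv X *v v"
  have v: "v = X *v w" by (simp add: w_def matrix_inv_vector_right inv)
  with \<open>v \<noteq> 0\<close> have "w \<noteq> 0" by auto
  then have "0 < w \<bullet> (X *v w)" by (rule pdD[OF assms])
  then show "0 < v \<bullet> (matrix_inv X *v v)"
    by (simp add: v inner_commute matrix_inv_vector_left inv)
qed

lemma pd_scaleR: "pd X \<Longrightarrow> 0 < c \<Longrightarrow> pd (c *\<^sub>R X)"
  by (auto simp: pd_def transpose_scalar scaleR_matrix_vector)

lemma matrix_inv_scaleR:
  fixes X :: "real^'n^'n"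
  assumes "invertible X" "c \<noteq> 0"
  shows "matrix_inv (c *\<^sub>R X) = (1 / c) *\<^sub>R matrix_inv X"
  by (rule matrix_inv_unique)
     (simp add: assms matrix_mult_scaleR scaleR_matrix_mult matrix_inv_right)

lemma pd_add_psd: "pd X \<Longrightarrow> psd Y \<Longrightarrow> pd (X + Y)"
  by (auto simp: pd_def psd_def transpose_add matrix_vector_mult_add_rdistrib inner_add_right
      intro!: add_pos_nonneg)

lemma psd_congruence:
  fixes X :: "real^'n^'n" and L :: "real^'n^'m"
  assumes "psd X"
  shows "psd (L ** X ** transpose L)"
proof -
  have "v \<bullet> ((L ** X ** transpose L) *v v) = (transpose L *v v) \<bullet> (X *v (transpose L *v v))" for v
    by (simp add: inner_matrix_vector_right flip: matrix_vector_mul_assoc)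
  with assms show ?thesis
    by (simp add: psd_def matrix_transpose_mul matrix_mul_assoc)
qed

lemma pd_congruence:
  fixes X :: "real^'n^'n" and L :: "real^'n^'n"
  assumes "pd X" "invertible L"
  shows "pd (L ** X ** transpose L)"
proof -
  have "v \<bullet> ((L ** X ** transpose L) *v v) = (transpose L *v v) \<bullet> (X *v (transpose L *v v))" for v
    by (simp add: inner_matrix_vector_right flip: matrix_vector_mul_assoc)
  moreover have "transpose L *v v \<noteq> 0" if "v \<noteq> 0" for v
    using assms(2) that
    by (metis inner_matrix_vector_right inner_zero_left inner_eq_zero_iff matrix_inv_vector_right)
  ultimately show ?thesis using assms(1)
    by (simp add: pd_def matrix_transpose_mul matrix_mul_assoc)
qed

section \<open>Square roots of positive semidefinite matrices\<close>

text \<open>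
  The unit vector \<open>v\<close> of \<open>S\<close> maximising \<open>v \<bullet> f v\<close> is an eigenvector. With \<open>\<mu>\<close> the maximum, the form
  \<open>h y = \<mu> |y|\<^sup>2 - y \<bullet> f y\<close> is nonnegative on \<open>S\<close> and vanishes at \<open>v\<close>, so its derivative at \<open>v\<close>
  in the direction \<open>w = \<mu> v - f v\<close> is zero; that derivative is \<open>2 |w|\<^sup>2\<close>.
\<close>

lemma symmetric_eigenvector:
  fixes f :: "'a::euclidean_space \<Rightarrow> 'a"
  assumes lin: "linear f" and sym: "\<And>x y. f x \<bullet> y = x \<bullet> f y"
    and S: "subspace S" and inv: "f ` S \<subseteq> S" and nz: "S \<noteq> {0}"
  obtains v c where "v \<in> S" "norm v = 1" "f v = c *\<^sub>R v"
proof -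
  obtain x where x: "x \<in> S" "x \<noteq> 0" using nz S subspace_0 by blast
  let ?K = "S \<inter> sphere 0 1"
  have "(1 / norm x) *\<^sub>R x \<in> ?K" using x S by (simp add: subspace_scale)
  then have ne: "?K \<noteq> {}" by blast
  have comp: "compact ?K"
    by (simp add: closed_Int_compact closed_subspace S)
  have cont: "continuous_on ?K (\<lambda>x. x \<bullet> f x)"
    by (intro continuous_intros linear_continuous_on_compose[OF _ lin])
  obtain v where v: "v \<in> ?K" and max: "\<And>y. y \<in> ?K \<Longrightarrow> y \<bullet> f y \<le> v \<bullet> f v"
    using continuous_attains_sup[OF comp ne cont] by blast
  define \<mu> where "\<mu> = v \<bullet> f v"
  define h where "h y = \<mu> * (y \<bullet> y) - y \<bullet> f y" for y
  have h: "0 \<le> h y" if "y \<in> S" for y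
  proof (cases "y = 0")
    case False
    let ?u = "(1 / norm y) *\<^sub>R y"
    have "?u \<in> ?K" using that False S by (simp add: subspace_scale)
    then have "?u \<bullet> f ?u \<le> \<mu>" unfolding \<mu>_def by (rule max)
    then have "(y \<bullet> f y) / (norm y)\<^sup>2 \<le> \<mu>"
      by (simp add: linear_cmul[OF lin] power2_eq_square)
    then show ?thesis using False
      by (simp add: h_def divide_le_eq power2_norm_eq_inner mult.commute split: if_splits)
  qed (simp add: h_def linear_0[OF lin])
  define w where "w = \<mu> *\<^sub>R v - f v"
  have wS: "w \<in> S" using v inv S by (auto simp: w_def intro!: subspace_diff subspace_scale)
  have vv: "v \<bullet> v = 1" using v by (simp add: norm_eq_1)
  have hv: "h v = 0" by (simp add: h_def \<mu>_def vv)
  have exp: "h (v + t *\<^sub>R w) = 2 * t * (w \<bullet> w) + t\<^sup>2 * h w" for t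
  proof -
    have "h (v + t *\<^sub>R w) = h v + 2 * t * (\<mu> * (w \<bullet> v) - w \<bullet> f v) + t\<^sup>2 * h w"
      by (simp add: h_def linear_add[OF lin] linear_cmul[OF lin] inner_add_left inner_add_right
          algebra_simps power2_eq_square inner_commute[of v w] sym[of v w, symmetric] inner_commute[of "f v" w])
    moreover have "\<mu> * (w \<bullet> v) - w \<bullet> f v = w \<bullet> w"
      by (subst (3) w_def) (simp add: inner_diff_right)
    ultimately show ?thesis by (simp add: hv)
  qed
  have pos: "0 \<le> 2 * t * (w \<bullet> w) + t\<^sup>2 * h w" for t
    unfolding exp[symmetric] using v wS S by (intro h subspace_add subspace_scale) auto
  have "w \<bullet> w = 0"
  proof (cases "h w = 0")
    case True with pos[of "-1"] show ?thesis
      using inner_ge_zero[of w] by simp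
  next
    case False
    then have hw: "0 < h w" using h[OF wS] by simp
    have "0 \<le> 2 * (- (w \<bullet> w) / h w) * (w \<bullet> w) + (- (w \<bullet> w) / h w)\<^sup>2 * h w" by (rule pos)
    also have "\<dots> = - ((w \<bullet> w)\<^sup>2 / h w)" using hw by (simp add: field_simps power2_eq_square)
    finally have "(w \<bullet> w)\<^sup>2 \<le> 0" using hw by (simp add: divide_le_0_iff)
    then show ?thesis by simp
  qed
  then have "f v = \<mu> *\<^sub>R v" by (simp add: w_def)
  then show ?thesis using that v by auto
qed

text \<open>
  The spectral theorem, by induction on the dimension: the orthogonal complement in \<open>S\<close> of an
  eigenvector is again invariant because \<open>f\<close> is symmetric.
\<close>

lemma symmetric_eigenbasis_subspace:
  fixes f :: "'a::euclidean_space \<Rightarrow> 'a"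
  assumes lin: "linear f" and sym: "\<And>x y. f x \<bullet> y = x \<bullet> f y"
  shows "subspace S \<Longrightarrow> f ` S \<subseteq> S \<Longrightarrow>
    \<exists>E. finite E \<and> E \<subseteq> S \<and> (\<forall>b\<in>E. \<forall>b'\<in>E. b \<bullet> b' = (if b = b' then 1 else 0)) \<and>
      (\<forall>x\<in>S. x = (\<Sum>b\<in>E. (b \<bullet> x) *\<^sub>R b)) \<and> (\<forall>b\<in>E. \<exists>c. f b = c *\<^sub>R b)"
proof (induction "dim S" arbitrary: S rule: less_induct)
  case less
  show ?case
  proof (cases "S = {0}")
    case True then show ?thesis by (intro exI[of _ "{}"]) auto
  next
    case False
    obtain v c where v: "v \<in> S" "norm v = 1" "f v = c *\<^sub>R v"
      using symmetric_eigenvector[OF lin sym less.prems False] by blast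
    have vv: "v \<bullet> v = 1" using v by (simp add: norm_eq_1)
    define S' where "S' = S \<inter> {x. v \<bullet> x = 0}"
    have sub: "subspace S'" unfolding S'_def
      by (intro subspace_inter less.prems subspace_hyperplane)
    have inv: "f ` S' \<subseteq> S'"
      using less.prems(2) v(3) by (auto simp: S'_def sym[symmetric])
    have "S' \<subset> S" proof
      show "S' \<subseteq> S" by (simp add: S'_def)
      have "v \<notin> S'" using vv by (simp add: S'_def)
      with v show "S' \<noteq> S" by blast
    qed
    then have "dim S' < dim S"
      using sub less.prems(1) by (intro dim_psubset) (simp add: span_eq_iff[THEN iffD2])
    from less.hyps[OF this sub inv] obtain E where E: "finite E" "E \<subseteq> S'"
      "\<And>b b'. b\<in>E \<Longrightarrow> b'\<in>E \<Longrightarrow> b \<bullet> b' = (if b = b' then 1 else 0)"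
      "\<And>x. x\<in>S' \<Longrightarrow> x = (\<Sum>b\<in>E. (b \<bullet> x) *\<^sub>R b)" "\<And>b. b\<in>E \<Longrightarrow> \<exists>c. f b = c *\<^sub>R b"
      by metis
    have vE: "v \<bullet> b = 0" if "b \<in> E" for b using that E(2) by (auto simp: S'_def)
    then have vn: "v \<notin> E" using vv by force
    have Ev: "b \<bullet> v = 0" if "b \<in> E" for b using vE[OF that] by (simp add: inner_commute)
    have exp: "x = (\<Sum>b\<in>insert v E. (b \<bullet> x) *\<^sub>R b)" if "x \<in> S" for x
    proof -
      let ?y = "x - (v \<bullet> x) *\<^sub>R v"
      have "?y \<in> S'" using that v less.prems(1)
        by (auto simp: S'_def inner_diff_right vv intro!: subspace_diff subspace_scale)
      then have "?y = (\<Sum>b\<in>E. (b \<bullet> ?y) *\<^sub>R b)" by (rule E(4))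
      also have "\<dots> = (\<Sum>b\<in>E. (b \<bullet> x) *\<^sub>R b)"
        by (intro sum.cong refl) (simp add: inner_diff_right Ev)
      finally show ?thesis using E(1) vn by (simp add: algebra_simps)
    qed
    have "insert v E \<subseteq> S" using E(2) v(1) by (auto simp: S'_def)
    moreover have "\<forall>b\<in>insert v E. \<forall>b'\<in>insert v E. b \<bullet> b' = (if b = b' then 1 else 0)"
      using vv vE Ev E(3) vn by auto
    moreover have "\<forall>b\<in>insert v E. \<exists>c. f b = c *\<^sub>R b" using v(3) E(5) by blast
    ultimately show ?thesis using E(1) exp by (intro exI[of _ "insert v E"]) blast
  qed
qed

lemma symmetric_matrix_eigenbasis:
  fixes X :: "real^'n^'n"
  assumes "transpose X = X"
  obtains E c where "finite E" "\<And>b b'. b \<in> E \<Longrightarrow> b' \<in> E \<Longrightarrow> b \<bullet> b' = (if b = b' then 1 else 0)"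
    "\<And>x. x = (\<Sum>b\<in>E. (b \<bullet> x) *\<^sub>R b)" "\<And>b. b \<in> E \<Longrightarrow> X *v b = c b *\<^sub>R b"
proof -
  have sym: "(X *v x) \<bullet> y = x \<bullet> (X *v y)" for x y
    by (metis assms inner_matrix_vector_right)
  obtain E where E: "finite E" "E \<subseteq> UNIV" "\<forall>b\<in>E. \<forall>b'\<in>E. b \<bullet> b' = (if b = b' then 1 else 0)"
     "\<forall>x\<in>UNIV. x = (\<Sum>b\<in>E. (b \<bullet> x) *\<^sub>R b)" "\<forall>b\<in>E. \<exists>c. X *v b = c *\<^sub>R b"
    using symmetric_eigenbasis_subspace[of "(*v) X" UNIV, OF _ sym] by auto
  from E(5) obtain c where "\<forall>b\<in>E. X *v b = c b *\<^sub>R b" by metis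
  with E show ?thesis by (intro that[of E c]) auto
qed

lemma matrix_vector_mult_sum_right:
  fixes X :: "real^'n^'m"
  shows "X *v (\<Sum>b\<in>E. g b *\<^sub>R b) = (\<Sum>b\<in>E. g b *\<^sub>R (X *v b))"
proof -
  have "linear ((*v) X)" by simp
  then show ?thesis by (simp add: linear_sum linear_cmul)
qed

lemma psd_sqrt_exists:
  assumes "psd X"
  shows "\<exists>Y. psd Y \<and> Y ** Y = X"
proof -
  obtain E c where E: "finite E" and on: "\<And>b b'. b \<in> E \<Longrightarrow> b' \<in> E \<Longrightarrow> b \<bullet> b' = (if b = b' then 1 else 0)"
    and ex: "\<And>x. x = (\<Sum>b\<in>E. (b \<bullet> x) *\<^sub>R b)" and eig: "\<And>b. b \<in> E \<Longrightarrow> X *v b = c b *\<^sub>R b"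
    by (rule symmetric_matrix_eigenbasis[of X]) (use assms in \<open>auto simp: psd_def\<close>)
  have c0: "0 \<le> c b" if "b \<in> E" for b
  proof -
    have "0 \<le> b \<bullet> (X *v b)" using assms by (simp add: psd_def)
    also have "\<dots> = c b" using that by (simp add: eig on)
    finally show ?thesis .
  qed
  define g where "g x = (\<Sum>b\<in>E. (sqrt (c b) * (b \<bullet> x)) *\<^sub>R b)" for x
  have lin: "linear g"
    by (rule linearI) (auto simp: g_def inner_add_right algebra_simps sum.distrib scaleR_sum_right)
  define Y where "Y = matrix g"
  have Y: "Y *v x = g x" for x by (simp add: Y_def lin)
  have gb: "g b = sqrt (c b) *\<^sub>R b" if "b \<in> E" for b
  proof -
    have "g b = (\<Sum>b'\<in>E. if b' = b then sqrt (c b) *\<^sub>R b else 0)"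
      unfolding g_def by (intro sum.cong refl) (use that in \<open>auto simp: on\<close>)
    then show ?thesis using that E by simp
  qed
  have sym: "y \<bullet> g x = (\<Sum>b\<in>E. sqrt (c b) * (b \<bullet> x) * (b \<bullet> y))" for x y
    by (simp add: g_def inner_sum_right inner_commute)
  have "x \<bullet> (transpose Y *v y) = x \<bullet> (Y *v y)" for x y
    using sym[of x y] sym[of y x]
    by (subst inner_matrix_vector_right) (simp add: Y mult.commute mult.left_commute inner_commute)
  then have "transpose Y = Y" unfolding matrix_eq by (metis vector_eq_ldot)
  moreover have "0 \<le> v \<bullet> (Y *v v)" for v
    unfolding Y sym using c0 by (intro sum_nonneg) (simp add: mult.assoc)
  ultimately have "psd Y" by (simp add: psd_def)
  moreover have "Y ** Y = X"
    unfolding matrix_eq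
  proof
    fix x
    have "(Y ** Y) *v x = (\<Sum>b\<in>E. (b \<bullet> x) *\<^sub>R ((Y ** Y) *v b))"
      by (subst ex[of x]) (rule matrix_vector_mult_sum_right)
    also have "\<dots> = (\<Sum>b\<in>E. (b \<bullet> x) *\<^sub>R (X *v b))"
      by (intro sum.cong refl)
         (simp add: eig Y gb linear_cmul[OF lin] c0 flip: matrix_vector_mul_assoc)
    also have "\<dots> = X *v x"
      by (subst (2) ex[of x]) (rule matrix_vector_mult_sum_right[symmetric])
    finally show "(Y ** Y) *v x = X *v x" .
  qed
  ultimately show ?thesis by blast
qed

text \<open>
  If \<open>Y b = c b\<close>, then \<open>w = Z b - c b\<close> satisfies \<open>Z w = - c w\<close>, which for \<open>c > 0\<close> contradicts
  \<open>Z \<succeq> 0\<close> unless \<open>w = 0\<close>; for \<open>c = 0\<close> one has \<open>|Z b|\<^sup>2 = b \<bullet> Z (Z b) = 0\<close>. So the roots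
  agree on an eigenbasis of \<open>Y\<close>.
\<close>

lemma psd_sqrt_unique:
  assumes Y: "psd Y" and Z: "psd Z" and eq: "Y ** Y = Z ** Z"
  shows "Y = Z"
proof -
  obtain E c where E: "finite E" and on: "\<And>b b'. b \<in> E \<Longrightarrow> b' \<in> E \<Longrightarrow> b \<bullet> b' = (if b = b' then 1 else 0)"
    and ex: "\<And>x. x = (\<Sum>b\<in>E. (b \<bullet> x) *\<^sub>R b)" and eig: "\<And>b. b \<in> E \<Longrightarrow> Y *v b = c b *\<^sub>R b"
    by (rule symmetric_matrix_eigenbasis[of Y]) (use Y in \<open>auto simp: psd_def\<close>)
  have Zb: "Z *v b = Y *v b" if b: "b \<in> E" for b
  proof -
    have c0: "0 \<le> c b"
    proof -
      have "0 \<le> b \<bullet> (Y *v b)" using Y by (simp add: psd_def)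
      also have "\<dots> = c b" using b by (simp add: eig on)
      finally show ?thesis .
    qed
    define w where "w = Z *v b - c b *\<^sub>R b"
    have ZZ: "Z *v (Z *v b) = (c b * c b) *\<^sub>R b"
      using eq b by (simp add: matrix_vector_mul_assoc flip: eq)
        (simp add: eig matrix_vector_mult_scaleR flip: matrix_vector_mul_assoc)
    have Zw: "Z *v w = - c b *\<^sub>R w"
      by (simp add: w_def matrix_vector_mult_diff_distrib ZZ matrix_vector_mult_scaleR algebra_simps)
    have "0 \<le> w \<bullet> (Z *v w)" using Z by (simp add: psd_def)
    then have le: "c b * (w \<bullet> w) \<le> 0" by (simp add: Zw)
    have "w = 0"
    proof (cases "c b = 0")
      case True
      have "(Z *v b) \<bullet> (Z *v b) = b \<bullet> (Z *v (Z *v b))"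
        using Z by (simp add: psd_def inner_matrix_vector_right)
      also have "\<dots> = 0" by (simp add: ZZ True)
      finally show ?thesis by (simp add: w_def True)
    next
      case False
      with c0 le have "w \<bullet> w \<le> 0" by (simp add: mult_le_0_iff)
      then show ?thesis using inner_ge_zero[of w] inner_eq_zero_iff[of w] by linarith
    qed
    then show ?thesis using b by (simp add: w_def eig)
  qed
  show ?thesis unfolding matrix_eq
  proof
    fix x
    have "Y *v x = (\<Sum>b\<in>E. (b \<bullet> x) *\<^sub>R (Y *v b))"
      by (subst ex[of x]) (rule matrix_vector_mult_sum_right)
    also have "\<dots> = (\<Sum>b\<in>E. (b \<bullet> x) *\<^sub>R (Z *v b))" by (simp add: Zb)
    also have "\<dots> = Z *v x"
      by (subst (2) ex[of x]) (rule matrix_vector_mult_sum_right[symmetric])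
    finally show "Y *v x = Z *v x" .
  qed
qed

lemma psd_sqrt_eqI: "psd Y \<Longrightarrow> Y ** Y = X \<Longrightarrow> psd_sqrt X = Y"
  unfolding psd_sqrt_def by (rule the_equality) (auto intro: psd_sqrt_unique)

lemma
  assumes "psd X"
  shows psd_psd_sqrt: "psd (psd_sqrt X)" and psd_sqrt_square: "psd_sqrt X ** psd_sqrt X = X"
proof -
  obtain Y where "psd Y" "Y ** Y = X" using psd_sqrt_exists[OF assms] by blast
  moreover from this have "psd_sqrt X = Y" by (rule psd_sqrt_eqI)
  ultimately show "psd (psd_sqrt X)" "psd_sqrt X ** psd_sqrt X = X" by auto
qed

lemma pd_psd_sqrt:
  assumes "pd X" shows "pd (psd_sqrt X)"
proof -
  note psd = psd_psd_sqrt[OF pd_imp_psd[OF assms]] 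
  note sq = psd_sqrt_square[OF pd_imp_psd[OF assms]]
  let ?H = "psd_sqrt X"
  have "invertible ?H"
    by (rule invertible_by_kernel)
       (metis assms sq matrix_inv_vector_left matrix_vector_mul_assoc matrix_vector_mult_0_right pd_invertible)
  \<comment> \<open>A root of the root exhibits \<open>v \<bullet> H v\<close> as the square of a norm.\<close>
  define L where "L = psd_sqrt ?H"
  have L: "psd L" "L ** L = ?H" unfolding L_def by (rule psd_psd_sqrt[OF psd], rule psd_sqrt_square[OF psd])
  have "0 < v \<bullet> (?H *v v)" if "v \<noteq> 0" for v
  proof -
    have "v \<bullet> (?H *v v) = (L *v v) \<bullet> (L *v v)"
      using L by (simp add: psd_def inner_matrix_vector_right flip: L(2) matrix_vector_mul_assoc)
    moreover have "L *v v \<noteq> 0"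
      using that \<open>invertible ?H\<close> L(2)
      by (metis matrix_inv_vector_left matrix_vector_mul_assoc matrix_vector_mult_0_right)
    ultimately show ?thesis by simp
  qed
  with psd show ?thesis by (simp add: pd_def psd_def)
qed

section \<open>Linear changes of variables\<close>

lemma borel_measurable_matrix_vector [measurable (raw)]:
  fixes A :: "real^'c^'r"
  assumes "f \<in> borel_measurable M"
  shows "(\<lambda>x. A *v f x) \<in> borel_measurable M"
proof -
  have "(*v) A \<in> borel_measurable borel"
    by (intro borel_measurable_continuous_onI linear_continuous_on) simp
  from measurable_compose[OF assms this] show ?thesis .
qed

lemma nn_integral_translation:
  fixes f :: "'a::euclidean_space \<Rightarrow> ennreal"
  assumes [measurable]: "f \<in> borel_measurable borel"
  shows "(\<integral>\<^sup>+x. f (a + x) \<partial>lborel) = (\<integral>\<^sup>+x. f x \<partial>lborel)"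
  by (subst (2) lborel_distr_plus[of a, symmetric]) (simp add: nn_integral_distr)

lemma nn_integral_reflection:
  fixes f :: "'a::euclidean_space \<Rightarrow> ennreal"
  assumes [measurable]: "f \<in> borel_measurable borel"
  shows "(\<integral>\<^sup>+x. f (a - x) \<partial>lborel) = (\<integral>\<^sup>+x. f x \<partial>lborel)"
  by (subst (2) lborel_affine[of "-1" a]) (simp_all add: nn_integral_distr nn_integral_density)

text \<open>
  Uniqueness of translation invariant measures, reduced to Fubini's theorem. Test against the
  indicator \<open>g\<close> of a cube of volume 1: in the double integral of \<open>f (H x) g y\<close> first shift \<open>y\<close> by
  \<open>H x\<close>, then shift \<open>x\<close> by \<open>- H\<^sup>-\<^sup>1 y\<close>, then reflect \<open>y\<close>; this moves \<open>H\<close> from \<open>f\<close> to \<open>g\<close>. The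
  value of the constant is found afterwards by a normalisation.
\<close>

lemma nn_integral_linear_image:
  fixes H :: "real^'n^'n"
  assumes H: "invertible H"
  obtains c where "\<And>f. f \<in> borel_measurable borel \<Longrightarrow>
    (\<integral>\<^sup>+x. f (H *v x) \<partial>lborel) = c * (\<integral>\<^sup>+x. f x \<partial>lborel)"
proof
  let ?g = "indicator (cbox 0 One) :: real^'n \<Rightarrow> ennreal"
  let ?L = "lborel :: (real^'n) measure"
  have P: "pair_sigma_finite ?L ?L"
    by (simp add: pair_sigma_finite_def sigma_finite_lborel)
  fix f :: "real^'n \<Rightarrow> ennreal" assume [measurable]: "f \<in> borel_measurable borel"
  have [measurable]: "?g \<in> borel_measurable borel" by simp
  have g: "(\<integral>\<^sup>+y. ?g y \<partial>?L) = 1" by simp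
  have "(\<integral>\<^sup>+x. f (H *v x) \<partial>?L) = (\<integral>\<^sup>+x. \<integral>\<^sup>+y. f (H *v x) * ?g y \<partial>?L \<partial>?L)"
    by (simp add: nn_integral_cmult g del: nn_integral_indicator)
  also have "\<dots> = (\<integral>\<^sup>+x. \<integral>\<^sup>+y. f (H *v x) * ?g (H *v x + y) \<partial>?L \<partial>?L)"
  proof (rule nn_integral_cong)
    fix x :: "real^'n"
    show "(\<integral>\<^sup>+y. f (H *v x) * ?g y \<partial>?L) = (\<integral>\<^sup>+y. f (H *v x) * ?g (H *v x + y) \<partial>?L)"
      by (rule nn_integral_translation[symmetric]) measurable
  qed
  also have "\<dots> = (\<integral>\<^sup>+y. \<integral>\<^sup>+x. f (H *v x) * ?g (H *v x + y) \<partial>?L \<partial>?L)"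
    by (rule pair_sigma_finite.Fubini'[OF P, symmetric]) measurable
  also have "\<dots> = (\<integral>\<^sup>+y. \<integral>\<^sup>+x. f (H *v x - y) * ?g (H *v x) \<partial>?L \<partial>?L)"
  proof (rule nn_integral_cong)
    fix y :: "real^'n"
    have "(\<integral>\<^sup>+x. f (H *v x) * ?g (H *v x + y) \<partial>?L)
        = (\<integral>\<^sup>+x. f (H *v (- (matrix_inv H *v y) + x)) * ?g (H *v (- (matrix_inv H *v y) + x) + y) \<partial>?L)"
      by (rule nn_integral_translation[symmetric]) measurable
    also have "\<dots> = (\<integral>\<^sup>+x. f (H *v x - y) * ?g (H *v x) \<partial>?L)"
      by (simp add: matrix_vector_mult_diff_distrib matrix_inv_vector_right H)
    finally show "(\<integral>\<^sup>+x. f (H *v x) * ?g (H *v x + y) \<partial>?L) = (\<integral>\<^sup>+x. f (H *v x - y) * ?g (H *v x) \<partial>?L)" .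
  qed
  also have "\<dots> = (\<integral>\<^sup>+x. \<integral>\<^sup>+y. f (H *v x - y) * ?g (H *v x) \<partial>?L \<partial>?L)"
    by (rule pair_sigma_finite.Fubini'[OF P]) measurable
  also have "\<dots> = (\<integral>\<^sup>+x. (\<integral>\<^sup>+y. f y \<partial>?L) * ?g (H *v x) \<partial>?L)"
    by (intro nn_integral_cong) (simp add: nn_integral_multc nn_integral_reflection)
  also have "\<dots> = (\<integral>\<^sup>+x. ?g (H *v x) \<partial>?L) * (\<integral>\<^sup>+x. f x \<partial>?L)"
    by (subst nn_integral_cmult) (auto simp: mult.commute)
  finally show "(\<integral>\<^sup>+x. f (H *v x) \<partial>?L) = (\<integral>\<^sup>+x. ?g (H *v x) \<partial>?L) * (\<integral>\<^sup>+x. f x \<partial>?L)" .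
qed

lemma nn_integral_affine_image:
  fixes H :: "real^'n^'n"
  assumes H: "invertible H"
  obtains c where "\<And>f b. f \<in> borel_measurable borel \<Longrightarrow>
    (\<integral>\<^sup>+x. f (H *v x + b) \<partial>lborel) = c * (\<integral>\<^sup>+x. f x \<partial>lborel)"
proof -
  obtain c where c: "\<And>f. f \<in> borel_measurable borel \<Longrightarrow>
    (\<integral>\<^sup>+x. f (H *v x) \<partial>lborel) = c * (\<integral>\<^sup>+x. f x \<partial>lborel)"
    using nn_integral_linear_image[OF H] by blast
  show thesis
  proof (rule that)
    fix f :: "real^'n \<Rightarrow> ennreal" and b assume [measurable]: "f \<in> borel_measurable borel"
    show "(\<integral>\<^sup>+x. f (H *v x + b) \<partial>lborel) = c * (\<integral>\<^sup>+x. f x \<partial>lborel)"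
      using c[of "\<lambda>x. f (b + x)"] nn_integral_translation[of f b] by (simp add: add.commute)
  qed
qed

text \<open>
  The constant is 1 because the unit ball, which has finite positive volume, is preserved.
\<close>

lemma nn_integral_orthogonal_image:
  fixes U :: "real^'n^'n"
  assumes U: "orthogonal_matrix U" and [measurable]: "f \<in> borel_measurable borel"
  shows "(\<integral>\<^sup>+x. f (U *v x) \<partial>lborel) = (\<integral>\<^sup>+x. f x \<partial>lborel)"
proof -
  have "invertible U" using U by (auto simp: orthogonal_matrix_def invertible_def)
  then obtain c where c: "\<And>f. f \<in> borel_measurable borel \<Longrightarrow>
    (\<integral>\<^sup>+x. f (U *v x) \<partial>lborel) = c * (\<integral>\<^sup>+x. f x \<partial>lborel)"
    using nn_integral_linear_image by blast
  let ?f = "indicator (ball 0 1) :: real^'n \<Rightarrow> ennreal"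
  have norm: "norm (U *v x) = norm x" for x
  proof -
    have "(U *v x) \<bullet> (U *v x) = x \<bullet> x"
      using U by (simp add: inner_matrix_vector_right[of _ U] matrix_vector_mul_assoc orthogonal_matrix_def)
    then show ?thesis by (simp add: norm_eq_sqrt_inner)
  qed
  have inv: "?f (U *v x) = ?f x" for x by (simp add: indicator_def norm)
  have "emeasure lborel (ball 0 1 :: (real^'n) set) = c * emeasure lborel (ball 0 1 :: (real^'n) set)"
    using c[OF borel_measurable_indicator, of "ball 0 1"] by (simp add: inv)
  moreover have "emeasure lborel (ball 0 1 :: (real^'n) set) \<noteq> 0"
    using content_ball_pos[of 1 "0 :: real^'n"] by (auto simp: measure_def)
  moreover have "emeasure lborel (ball 0 1 :: (real^'n) set) \<noteq> \<infinity>"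
    using emeasure_lborel_ball_finite[of "0 :: real^'n" 1] by auto
  ultimately have "c = 1"
    using mult_divide_eq_ennreal[of "emeasure lborel (ball 0 1 :: (real^'n) set)" c]
      ennreal_divide_self[of "emeasure lborel (ball 0 1 :: (real^'n) set)"]
    by (simp add: top.not_eq_extremum)
  with c[of f] show ?thesis by simp
qed

lemma symmetric_matrix_diagonalization:
  fixes X :: "real^'n^'n"
  assumes "transpose X = X"
  obtains U :: "real^'n^'n" and d :: "'n \<Rightarrow> real" where "orthogonal_matrix U"
    "X = transpose U ** (\<chi> i j. if i = j then d i else 0) ** U"
proof -
  obtain E c where E: "finite E" and on: "\<And>b b'. b \<in> E \<Longrightarrow> b' \<in> E \<Longrightarrow> b \<bullet> b' = (if b = b' then 1 else 0)"
    and ex: "\<And>x. x = (\<Sum>b\<in>E. (b \<bullet> x) *\<^sub>R b)" and eig: "\<And>b. b \<in> E \<Longrightarrow> X *v b = c b *\<^sub>R b"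
    by (rule symmetric_matrix_eigenbasis[of X]) (use assms in auto)
  have "0 \<notin> E" using on[of 0 0] by auto
  have "span E = UNIV"
  proof -
    have "x \<in> span E" for x
      by (subst ex) (intro span_sum span_scale span_base)
    then show ?thesis by blast
  qed
  moreover have "independent E"
    by (intro pairwise_orthogonal_independent \<open>0 \<notin> E\<close>) (auto simp: pairwise_def orthogonal_def on)
  ultimately have "card E = DIM(real^'n)"
    by (metis dim_UNIV dim_eq_card_independent dim_span)
  then have "card E = card (UNIV :: 'n set)" by simp
  then obtain e :: "'n \<Rightarrow> real^'n" where e: "bij_betw e UNIV E"
    using E by (metis finite_same_card_bij finite_code)
  have eE: "e i \<in> E" for i using e by (auto simp: bij_betw_def)
  have inner_e: "e i \<bullet> e j = (if i = j then 1 else 0)" for i j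
    using on[OF eE eE, of i j] e by (auto simp: bij_betw_def inj_on_def)
  define U :: "real^'n^'n" where "U = (\<chi> i. e i)"
  define D :: "real^'n^'n" where "D = (\<chi> i j. if i = j then c (e i) else 0)"
  have U: "(U *v x) $ i = e i \<bullet> x" for x i by (simp add: U_def matrix_vector_mul_component)
  have D: "(D *v x) $ i = c (e i) * x $ i" for x i
    by (simp add: D_def matrix_vector_mult_def if_distrib[of "\<lambda>a. a * _"] cong: if_cong)
  have "(U ** transpose U) $ i $ j = (mat 1 :: real^'n^'n) $ i $ j" for i j
    using inner_e[of i j]
    by (simp add: matrix_matrix_mult_def transpose_def U_def inner_vec_def mat_def)
  then have UU: "U ** transpose U = mat 1" by (simp add: vec_eq_iff)
  then have orth: "orthogonal_matrix U"
    by (simp add: orthogonal_matrix matrix_left_right_inverse)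
  have "U *v (X *v x) = D *v (U *v x)" for x
  proof -
    have "e i \<bullet> (X *v x) = c (e i) * (e i \<bullet> x)" for i
      using inner_symmetric_matrix[OF assms, of "e i" x] by (simp add: eig eE inner_commute)
    then show ?thesis by (simp add: vec_eq_iff U D)
  qed
  then have "U ** X = D ** U" by (simp add: matrix_eq flip: matrix_vector_mul_assoc)
  then have "X = transpose U ** D ** U"
    using orth by (metis matrix_mul_assoc matrix_mul_lid orthogonal_matrix)
  then show ?thesis using that[OF orth, of "\<lambda>i. c (e i)"] by (simp add: D_def)
qed

section \<open>Gaussian measures\<close>

definition gaussian_const :: "real^'n^'n \<Rightarrow> real" where
  "gaussian_const \<Sigma> = 1 / sqrt ((2 * pi) ^ CARD('n) * det \<Sigma>)"

lemma gaussian_density_eq: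
  "gaussian_density \<mu> \<Sigma> x
     = gaussian_const \<Sigma> * exp (- ((x - \<mu>) \<bullet> (matrix_inv \<Sigma> *v (x - \<mu>))) / 2)"
  by (simp add: gaussian_density_def gaussian_const_def)

text \<open>
  In the coordinates of an orthonormal eigenbasis the quadratic form of the inverse is diagonal.
\<close>

lemma pd_diagonalization:
  fixes X :: "real^'n^'n"
  assumes "pd X"
  shows "\<exists>(U :: real^'n^'n) d. orthogonal_matrix U \<and>
    (\<forall>x. (transpose U *v x) \<bullet> (matrix_inv X *v (transpose U *v x)) = (\<Sum>i\<in>UNIV. (x $ i)\<^sup>2 / d i)) \<and>
    (\<forall>i. 0 < d i) \<and> det X = (\<Prod>i\<in>UNIV. d i)"
proof -
  obtain U :: "real^'n^'n" and d :: "'n \<Rightarrow> real" where U: "orthogonal_matrix U"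
    and X: "X = transpose U ** (\<chi> i j. if i = j then d i else 0) ** U"
    using symmetric_matrix_diagonalization[OF pd_symmetric[OF assms]] by blast
  define D :: "real^'n^'n" where "D = (\<chi> i j. if i = j then d i else 0)"
  have D: "(D *v x) $ i = d i * x $ i" for x i
    by (simp add: D_def matrix_vector_mult_def if_distrib[of "\<lambda>a. a * _"] cong: if_cong)
  have UU: "U *v (transpose U *v x) = x" "transpose U *v (U *v x) = x" for x
    using U by (simp_all add: matrix_vector_mul_assoc orthogonal_matrix_def)
  have Xv: "X *v x = transpose U *v (D *v (U *v x))" for x
    by (simp add: X D_def matrix_vector_mul_assoc matrix_mul_assoc)
  have dpos: "0 < d i" for i
  proof -
    let ?v = "transpose U *v axis i 1"
    have "?v \<noteq> 0" using UU(1)[of "axis i 1"] by (metis axis_eq_0_iff matrix_vector_mult_0_right zero_neq_one)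
    then have "0 < ?v \<bullet> (X *v ?v)" by (rule pdD[OF assms])
    also have "?v \<bullet> (X *v ?v) = axis i 1 \<bullet> (D *v axis i 1)"
      by (simp add: Xv UU inner_matrix_vector_right[of _ "transpose U"])
    also have "\<dots> = d i" by (simp add: inner_axis' D)
    finally show ?thesis .
  qed
  have "(transpose U *v x) \<bullet> (matrix_inv X *v (transpose U *v x)) = (\<Sum>i\<in>UNIV. (x $ i)\<^sup>2 / d i)" for x
  proof -
    define z :: "real^'n" where "z = (\<chi> i. x $ i / d i)"
    have "D *v z = x" using dpos by (simp add: vec_eq_iff D z_def less_imp_neq[symmetric])
    then have "X *v (transpose U *v z) = transpose U *v x" by (simp add: Xv UU)
    then have "matrix_inv X *v (transpose U *v x) = transpose U *v z"
      by (metis assms matrix_inv_vector_left pd_invertible)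
    then have "(transpose U *v x) \<bullet> (matrix_inv X *v (transpose U *v x)) = x \<bullet> z"
      by (simp add: inner_matrix_vector_right[of _ "transpose U"] UU)
    also have "\<dots> = (\<Sum>i\<in>UNIV. (x $ i)\<^sup>2 / d i)"
      by (simp add: inner_vec_def z_def power2_eq_square)
    finally show ?thesis .
  qed
  moreover have "det X = (\<Prod>i\<in>UNIV. d i)"
  proof -
    have "det (transpose U) * det U = 1"
      using U by (metis det_I det_mul orthogonal_matrix_def)
    then have "det X = det D" unfolding X D_def[symmetric] by (simp add: det_mul mult_ac)
    also have "\<dots> = (\<Prod>i\<in>UNIV. d i)" by (subst det_diagonal) (auto simp: D_def)
    finally show ?thesis .
  qed
  ultimately show ?thesis using U dpos by blast
qed

lemma gaussian_const_pos: 
  assumes "pd \<Sigma>" shows "0 < gaussian_const \<Sigma>"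
proof -
  from pd_diagonalization[OF assms] obtain U :: "real^'a^'a" and d :: "'a \<Rightarrow> real" where "\<forall>i. 0 < d i" "det \<Sigma> = (\<Prod>i\<in>UNIV. d i)"
    by (elim exE conjE) (rule that)
  then show ?thesis by (simp add: gaussian_const_def prod_pos)
qed

lemma gaussian_density_pos: "pd \<Sigma> \<Longrightarrow> 0 < gaussian_density \<mu> \<Sigma> x"
  by (simp add: gaussian_density_eq gaussian_const_pos)

lemma borel_measurable_gaussian_density [measurable (raw)]:
  assumes [measurable]: "f \<in> borel_measurable M" "g \<in> borel_measurable M"
  shows "(\<lambda>x. gaussian_density (g x) \<Sigma> (f x)) \<in> borel_measurable M"
  unfolding gaussian_density_eq by measurable

text \<open>
  In the coordinates of an eigenbasis the density is a product of one-dimensional normal densities.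
\<close>

lemma nn_integral_gaussian_density:
  fixes \<Sigma> :: "real^'n^'n"
  assumes "pd \<Sigma>"
  shows "(\<integral>\<^sup>+x. ennreal (gaussian_density \<mu> \<Sigma> x) \<partial>lborel) = 1"
proof -
  from pd_diagonalization[OF assms] obtain U :: "real^'n^'n" and d :: "'n \<Rightarrow> real" where U: "orthogonal_matrix U"
    and quad: "\<forall>x. (transpose U *v x) \<bullet> (matrix_inv \<Sigma> *v (transpose U *v x)) = (\<Sum>i\<in>UNIV. (x $ i)\<^sup>2 / d i)"
    and d: "\<forall>i. 0 < d i" and det: "det \<Sigma> = (\<Prod>i\<in>UNIV. d i)"
    by (elim exE conjE) (rule that)
  define \<sigma> where "\<sigma> b = sqrt (d (THE i. b = axis i 1))" for b :: "real^'n"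
  have \<sigma>: "\<sigma> (axis i 1) = sqrt (d i)" for i
    by (simp add: \<sigma>_def axis_eq_axis)
  have Basis: "(\<Prod>b\<in>Basis. h b) = (\<Prod>i\<in>UNIV. h (axis i 1))" for h :: "real^'n \<Rightarrow> 'x::comm_monoid_mult"
  proof -
    have B: "(Basis :: (real^'n) set) = range (\<lambda>i. axis i 1)" by (auto simp: Basis_vec_def)
    have I: "inj (\<lambda>i::'n. axis i (1::real))" by (auto simp: inj_on_def axis_eq_axis)
    show ?thesis unfolding B by (subst prod.reindex[OF I]) simp
  qed
  have one: "(\<integral>\<^sup>+t. ennreal (normal_density 0 s t) \<partial>lborel) = 1" if "0 < s" for s
    using that by (subst nn_integral_eq_integral) auto
  have "(\<integral>\<^sup>+x. ennreal (gaussian_density \<mu> \<Sigma> x) \<partial>lborel)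
      = (\<integral>\<^sup>+x. ennreal (gaussian_density \<mu> \<Sigma> (\<mu> + x)) \<partial>lborel)"
    by (rule nn_integral_translation[symmetric]) measurable
  also have "\<dots> = (\<integral>\<^sup>+x. ennreal (gaussian_density \<mu> \<Sigma> (\<mu> + transpose U *v x)) \<partial>lborel)"
    using U by (intro nn_integral_orthogonal_image[symmetric]) (auto simp: orthogonal_matrix_transpose)
  also have "\<dots> = (\<integral>\<^sup>+x. (\<Prod>b\<in>Basis. ennreal (normal_density 0 (\<sigma> b) (x \<bullet> b))) \<partial>lborel)"
  proof (rule nn_integral_cong)
    fix x :: "real^'n"
    have "(\<Prod>i\<in>UNIV. normal_density 0 (sqrt (d i)) (x $ i))
        = (\<Prod>i\<in>UNIV. 1 / sqrt (2 * pi * d i)) * (\<Prod>i\<in>UNIV. exp (- ((x $ i)\<^sup>2 / d i) / 2))"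
      using d by (simp add: normal_density_def prod.distrib[symmetric] less_imp_le mult_ac)
    also have "(\<Prod>i\<in>UNIV. exp (- ((x $ i)\<^sup>2 / d i) / 2)) = exp (- (\<Sum>i\<in>UNIV. (x $ i)\<^sup>2 / d i) / 2)"
      by (simp add: exp_sum[symmetric] sum_negf sum_divide_distrib)
    also have "(\<Prod>i\<in>UNIV. 1 / sqrt (2 * pi * d i)) = gaussian_const \<Sigma>"
    proof -
      have "(\<Prod>i\<in>UNIV. sqrt (2 * pi * d i)) = sqrt (\<Prod>i\<in>UNIV. 2 * pi * d i)"
        by (induction rule: infinite_finite_induct) (auto simp: real_sqrt_mult)
      also have "(\<Prod>i\<in>UNIV. 2 * pi * d i) = (2 * pi) ^ CARD('n) * det \<Sigma>"
        by (simp add: det prod.distrib)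
      finally show ?thesis by (simp add: gaussian_const_def prod_dividef)
    qed
    finally have "gaussian_density \<mu> \<Sigma> (\<mu> + transpose U *v x) = (\<Prod>i\<in>UNIV. normal_density 0 (sqrt (d i)) (x $ i))"
      by (simp add: gaussian_density_eq quad)
    then show "ennreal (gaussian_density \<mu> \<Sigma> (\<mu> + transpose U *v x))
        = (\<Prod>b\<in>Basis. ennreal (normal_density 0 (\<sigma> b) (x \<bullet> b)))"
      by (simp add: prod_ennreal Basis \<sigma> inner_axis)
  qed
  also have "\<dots> = (\<Prod>b\<in>(Basis :: (real^'n) set). \<integral>\<^sup>+t. ennreal (normal_density 0 (\<sigma> b) t) \<partial>lborel)"
    by (rule nn_integral_lborel_prod) auto
  also have "\<dots> = 1" by (simp add: Basis \<sigma> one d)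
  finally show ?thesis .
qed

lemma integrable_gaussian_density:
  assumes "pd \<Sigma>"
  shows "integrable lborel (gaussian_density \<mu> \<Sigma>)"
proof (rule integrableI_nonneg)
  show "(\<integral>\<^sup>+x. ennreal (gaussian_density \<mu> \<Sigma> x) \<partial>lborel) < \<infinity>"
    by (simp add: nn_integral_gaussian_density assms)
qed (auto intro: less_imp_le gaussian_density_pos assms borel_measurable_gaussian_density)

lemma integral_gaussian_density:
  "pd \<Sigma> \<Longrightarrow> (\<integral>x. gaussian_density \<mu> \<Sigma> x \<partial>lborel) = 1"
  by (subst integral_eq_nn_integral)
     (auto simp: nn_integral_gaussian_density gaussian_density_pos less_imp_le)

lemma quadratic_form_bounded_by_pd:
  fixes \<Sigma> P :: "real^'n^'n"
  assumes "pd \<Sigma>"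
  obtains K where "K > 0" "\<And>x. \<bar>x \<bullet> (P *v x)\<bar> \<le> K * (x \<bullet> (matrix_inv \<Sigma> *v x))"
proof -
  define H where "H = psd_sqrt \<Sigma>"
  have pdH: "pd H" and HH: "H ** H = \<Sigma>" and inv: "invertible H"
    using assms by (simp_all add: H_def pd_psd_sqrt pd_imp_psd psd_sqrt_square pd_invertible)
  obtain KP where KP: "KP > 0" "\<And>x. norm (P *v x) \<le> norm x * KP"
    using bounded_linear.pos_bounded[of "(*v) P"] by auto
  obtain KH where KH: "KH > 0" "\<And>x. norm (H *v x) \<le> norm x * KH"
    using bounded_linear.pos_bounded[of "(*v) H"] by auto
  show ?thesis
  proof (rule that[of "KP * KH\<^sup>2"])
    show "0 < KP * KH\<^sup>2" using KP KH by simp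
    fix x :: "real^'n"
    define y where "y = matrix_inv H *v x"
    have x: "x = H *v y" by (simp add: y_def matrix_inv_vector_right inv)
    have Hinv: "matrix_inv \<Sigma> = matrix_inv H ** matrix_inv H"
      by (rule matrix_inv_unique)
         (metis HH inv matrix_inv_right matrix_mul_assoc matrix_mul_rid)
    have "x \<bullet> (matrix_inv \<Sigma> *v x) = x \<bullet> (matrix_inv H *v y)"
      by (simp add: Hinv y_def flip: matrix_vector_mul_assoc)
    also have "\<dots> = y \<bullet> (matrix_inv H *v x)"
      by (rule inner_symmetric_matrix) (simp add: pd_symmetric pd_matrix_inv pdH)
    finally have yy: "x \<bullet> (matrix_inv \<Sigma> *v x) = (norm y)\<^sup>2"
      by (simp add: y_def power2_norm_eq_inner)
    have "\<bar>x \<bullet> (P *v x)\<bar> \<le> norm x * norm (P *v x)" by (rule Cauchy_Schwarz_ineq2)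
    also have "\<dots> \<le> norm x * (norm x * KP)" by (intro mult_left_mono KP) simp
    also have "\<dots> = KP * (norm x)\<^sup>2" by (simp add: power2_eq_square)
    also have "\<dots> \<le> KP * (norm y * KH)\<^sup>2"
      using KP(1) KH(2)[of y] by (intro mult_left_mono power_mono) (auto simp: x)
    finally show "\<bar>x \<bullet> (P *v x)\<bar> \<le> KP * KH\<^sup>2 * (x \<bullet> (matrix_inv \<Sigma> *v x))"
      by (simp add: yy power_mult_distrib mult_ac)
  qed
qed

text \<open>
  Since \<open>t exp (- t / 2) \<le> 4 exp (- t / 4)\<close>, the integrand is dominated by a multiple of the
  Gaussian density with twice the covariance.
\<close>

lemma integrable_gaussian_quadratic:
  fixes \<Sigma> P :: "real^'n^'n"
  assumes pd: "pd \<Sigma>"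
  shows "integrable lborel (\<lambda>x. gaussian_density \<mu> \<Sigma> x * ((x - \<mu>) \<bullet> (P *v (x - \<mu>))))"
proof -
  obtain K where K: "K > 0" "\<And>x. \<bar>x \<bullet> (P *v x)\<bar> \<le> K * (x \<bullet> (matrix_inv \<Sigma> *v x))"
    using quadratic_form_bounded_by_pd[OF pd, of P] by blast
  have pd2: "pd (2 *\<^sub>R \<Sigma>)" by (simp add: pd_scaleR pd)
  have inv2: "matrix_inv (2 *\<^sub>R \<Sigma>) = (1/2) *\<^sub>R matrix_inv \<Sigma>"
    by (simp add: matrix_inv_scaleR pd_invertible pd)
  define c where "c = 4 * K * gaussian_const \<Sigma> / gaussian_const (2 *\<^sub>R \<Sigma>)"
  show ?thesis
  proof (rule Bochner_Integration.integrable_bound)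
    show "integrable lborel (\<lambda>x. c * gaussian_density \<mu> (2 *\<^sub>R \<Sigma>) x)"
      by (intro integrable_mult_right integrable_gaussian_density pd2)
    show "AE x in lborel. norm (gaussian_density \<mu> \<Sigma> x * ((x - \<mu>) \<bullet> (P *v (x - \<mu>))))
        \<le> norm (c * gaussian_density \<mu> (2 *\<^sub>R \<Sigma>) x)"
    proof (rule AE_I2)
      fix x :: "real^'n"
      define t where "t = (x - \<mu>) \<bullet> (matrix_inv \<Sigma> *v (x - \<mu>))"
      have "t / 4 \<le> exp (t / 4)" using exp_ge_add_one_self[of "t/4"] by linarith
      then have "exp (- t / 2) * (t / 4) \<le> exp (- t / 2) * exp (t / 4)"
        by (intro mult_left_mono) auto
      then have "exp (- t / 2) * t \<le> 4 * exp (- t / 4)"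
        by (simp add: mult_exp_exp)
      then have 1: "K * gaussian_const \<Sigma> * (exp (- t / 2) * t) \<le> K * gaussian_const \<Sigma> * (4 * exp (- t / 4))"
        using K(1) gaussian_const_pos[OF pd] by (intro mult_left_mono) auto
      have "norm (gaussian_density \<mu> \<Sigma> x * ((x - \<mu>) \<bullet> (P *v (x - \<mu>))))
          \<le> gaussian_density \<mu> \<Sigma> x * (K * t)"
        using K(2)[of "x - \<mu>"] gaussian_density_pos[OF pd, of \<mu> x]
        by (simp add: abs_mult t_def mult_left_mono)
      also have "\<dots> = K * gaussian_const \<Sigma> * (exp (- t / 2) * t)"
        by (simp add: gaussian_density_eq t_def)
      also note 1
      also have "K * gaussian_const \<Sigma> * (4 * exp (- t / 4)) = c * gaussian_density \<mu> (2 *\<^sub>R \<Sigma>) x"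
        using gaussian_const_pos[OF pd2]
        by (simp add: c_def gaussian_density_eq inv2 scaleR_matrix_vector t_def)
      finally show "norm (gaussian_density \<mu> \<Sigma> x * ((x - \<mu>) \<bullet> (P *v (x - \<mu>))))
        \<le> norm (c * gaussian_density \<mu> (2 *\<^sub>R \<Sigma>) x)" by (simp add: abs_if)
    qed
  qed measurable
qed

lemma sets_gaussian [measurable_cong]: "sets (gaussian \<mu> \<Sigma>) = sets borel"
  by (simp add: gaussian_def)

lemma space_gaussian [simp]: "space (gaussian \<mu> \<Sigma>) = UNIV"
  by (simp add: gaussian_def)

lemma prob_space_gaussian: "pd \<Sigma> \<Longrightarrow> prob_space (gaussian \<mu> \<Sigma>)"
  by (intro prob_spaceI) (simp add: gaussian_def emeasure_density nn_integral_gaussian_density)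

lemma nn_integral_gaussian:
  assumes "f \<in> borel_measurable borel"
  shows "(\<integral>\<^sup>+x. f x \<partial>gaussian \<mu> \<Sigma>) = (\<integral>\<^sup>+x. ennreal (gaussian_density \<mu> \<Sigma> x) * f x \<partial>lborel)"
  unfolding gaussian_def by (rule nn_integral_density) (use assms in auto)

lemma integrable_gaussian_quadratic_form:
  assumes "pd \<Sigma>"
  shows "integrable (gaussian 0 \<Sigma>) (\<lambda>x. x \<bullet> (P *v x))"
  unfolding gaussian_def
  using integrable_gaussian_quadratic[OF assms, of 0 P] gaussian_density_pos[OF assms, of 0]
  by (subst integrable_density) (auto simp: less_imp_le)

lemma exp_half_add: "exp (- (a + b) / 2 :: real) = exp (- a / 2) * exp (- b / 2)"
  by (simp add: diff_divide_distrib flip: exp_add)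

text \<open>
  The law of \<open>F x + B w\<close> for independent centred Gaussian \<open>x\<close> and \<open>w\<close>. After the substitution
  \<open>y = F x + B w\<close> in \<open>x\<close>, completing the square in \<open>w\<close> splits the joint density of \<open>y\<close> and \<open>w\<close>
  into the Gaussian density of \<open>y\<close> and a factor whose integral over \<open>w\<close> does not depend on \<open>y\<close>. So
  both sides agree up to a factor \<open>K\<close>, and \<open>f = 1\<close> shows that \<open>K = 1\<close>.
\<close>

lemma nn_integral_gaussian_mixture:
  fixes \<Sigma> F :: "real^'n^'n" and W :: "real^'m^'m" and B :: "real^'m^'n"
  assumes pd\<Sigma>: "pd \<Sigma>" and pdW: "pd W" and F: "invertible F"
    and f[measurable]: "f \<in> borel_measurable borel"
  shows "(\<integral>\<^sup>+x. \<integral>\<^sup>+w. f (F *v x + B *v w) \<partial>gaussian 0 W \<partial>gaussian 0 \<Sigma>)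
    = (\<integral>\<^sup>+y. f y \<partial>gaussian 0 (F ** \<Sigma> ** transpose F + B ** W ** transpose B))"
proof -
  define C where "C = F ** \<Sigma> ** transpose F"
  define \<Sigma>' where "\<Sigma>' = C + B ** W ** transpose B"
  define G where "G = matrix_inv F"
  define M where "M = matrix_inv W + transpose B ** matrix_inv C ** B"
  have pdC: "pd C" unfolding C_def by (intro pd_congruence pd\<Sigma> F)
  have pd\<Sigma>': "pd \<Sigma>'" unfolding \<Sigma>'_def by (intro pd_add_psd pdC psd_congruence pd_imp_psd pdW)
  have pdM: "pd M"
    using psd_congruence[OF pd_imp_psd[OF pd_matrix_inv[OF pdC]], of "transpose B"]
    by (simp add: M_def pd_add_psd pd_matrix_inv pdW)
  have Cinv: "matrix_inv C = transpose G ** matrix_inv \<Sigma> ** G"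
  proof (rule matrix_inv_unique)
    have "transpose F ** transpose G = mat 1"
      by (metis F G_def matrix_inv_left matrix_transpose_mul transpose_mat)
    then have "C ** (transpose G ** matrix_inv \<Sigma> ** G) = F ** (\<Sigma> ** matrix_inv \<Sigma>) ** G"
      by (metis C_def matrix_mul_assoc matrix_mul_rid)
    also have "\<dots> = mat 1"
      by (simp add: G_def matrix_inv_right F pd_invertible pd\<Sigma>)
    finally show "C ** (transpose G ** matrix_inv \<Sigma> ** G) = mat 1" .
  qed
  have Gquad: "(G *v v) \<bullet> (matrix_inv \<Sigma> *v (G *v v)) = v \<bullet> (matrix_inv C *v v)" for v
    unfolding Cinv by (simp add: inner_matrix_vector_right flip: matrix_vector_mul_assoc)
  \<comment> \<open>The conditional mean of \<open>w\<close> given \<open>y\<close>; writing \<open>y = \<Sigma>' z\<close> makes the cross terms cancel.\<close>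
  define wbar where "wbar y = (W ** transpose B ** matrix_inv \<Sigma>') *v y" for y
  have square: "(y - B *v w) \<bullet> (matrix_inv C *v (y - B *v w)) + w \<bullet> (matrix_inv W *v w)
     = y \<bullet> (matrix_inv \<Sigma>' *v y) + (w - wbar y) \<bullet> (M *v (w - wbar y))" for y w
  proof -
    define z where "z = matrix_inv \<Sigma>' *v y"
    define s where "s = w - wbar y"
    define b where "b = transpose B *v z"
    define d where "d = B *v s"
    have y: "y = \<Sigma>' *v z" by (simp add: z_def matrix_inv_vector_right pd_invertible pd\<Sigma>')
    have wb: "wbar y = W *v b"
      by (simp add: wbar_def z_def b_def flip: matrix_vector_mul_assoc)
    then have w: "w = W *v b + s" by (simp add: s_def)
    have yB: "y - B *v w = C *v z - d"
      by (simp add: y \<Sigma>'_def w b_def d_def algebra_simps matrix_vector_mul_assoc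
          matrix_vector_right_distrib matrix_mul_assoc)
    have CC: "matrix_inv C *v (C *v z) = z" and WW: "matrix_inv W *v (W *v b) = b"
      by (simp_all add: matrix_inv_vector_left pd_invertible pdC pdW)
    have dz: "d \<bullet> z = s \<bullet> b"
      using inner_matrix_vector_right[of z B s] by (simp only: d_def b_def inner_commute)
    have sC: "(C *v z) \<bullet> (matrix_inv C *v d) = d \<bullet> z"
      using inner_symmetric_matrix[OF pd_symmetric[OF pd_matrix_inv[OF pdC]], of "C *v z" d]
      by (simp add: CC)
    have sW: "(W *v b) \<bullet> (matrix_inv W *v s) = s \<bullet> b"
      using inner_symmetric_matrix[OF pd_symmetric[OF pd_matrix_inv[OF pdW]], of "W *v b" s]
      by (simp add: WW)
    have "(y - B *v w) \<bullet> (matrix_inv C *v (y - B *v w))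
        = (C *v z) \<bullet> z - 2 * (s \<bullet> b) + d \<bullet> (matrix_inv C *v d)"
      by (simp add: yB matrix_vector_mult_diff_distrib CC inner_diff_left inner_diff_right sC dz)
    moreover have "w \<bullet> (matrix_inv W *v w)
        = (W *v b) \<bullet> b + 2 * (s \<bullet> b) + s \<bullet> (matrix_inv W *v s)"
      by (simp add: w matrix_vector_right_distrib WW inner_add_left inner_add_right sW)
    moreover have "y \<bullet> (matrix_inv \<Sigma>' *v y) = (C *v z) \<bullet> z + (W *v b) \<bullet> b"
    proof -
      have "(B *v (W *v b)) \<bullet> z = (W *v b) \<bullet> b"
        using inner_matrix_vector_right[of z B "W *v b"] by (simp only: b_def inner_commute)
      moreover have "y = C *v z + B *v (W *v b)"
        by (simp add: y \<Sigma>'_def b_def matrix_vector_mult_add_rdistrib flip: matrix_vector_mul_assoc)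
      moreover from this have "y \<bullet> (matrix_inv \<Sigma>' *v y) = (C *v z + B *v (W *v b)) \<bullet> z"
        by (metis z_def)
      ultimately show ?thesis by (simp add: inner_add_left)
    qed
    moreover have "s \<bullet> (M *v s) = s \<bullet> (matrix_inv W *v s) + d \<bullet> (matrix_inv C *v d)"
      by (simp add: M_def d_def matrix_vector_mult_add_rdistrib inner_add_right
          inner_matrix_vector_right[of s "transpose B"] flip: matrix_vector_mul_assoc)
    ultimately show ?thesis by (simp flip: s_def)
  qed
  define \<kappa> where "\<kappa> = gaussian_const \<Sigma> * gaussian_const W / gaussian_const \<Sigma>'"
  have \<kappa>: "0 < \<kappa>" by (simp add: \<kappa>_def gaussian_const_pos pd\<Sigma> pdW pd\<Sigma>')
  have dens: "gaussian_density 0 \<Sigma> (G *v (y - B *v w)) * gaussian_density 0 W w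
      = \<kappa> * gaussian_density 0 \<Sigma>' y * exp (- ((w - wbar y) \<bullet> (M *v (w - wbar y))) / 2)" for y w
  proof -
    have "gaussian_density 0 \<Sigma> (G *v (y - B *v w)) * gaussian_density 0 W w
      = gaussian_const \<Sigma> * gaussian_const W * exp (- ((y - B *v w) \<bullet> (matrix_inv C *v (y - B *v w))
          + w \<bullet> (matrix_inv W *v w)) / 2)"
      by (simp only: gaussian_density_eq diff_0_right Gquad exp_half_add)
         (simp add: mult_ac)
    also have "\<dots> = \<kappa> * gaussian_density 0 \<Sigma>' y * exp (- ((w - wbar y) \<bullet> (M *v (w - wbar y))) / 2)"
      unfolding square using gaussian_const_pos[OF pd\<Sigma>']
      by (simp only: gaussian_density_eq diff_0_right \<kappa>_def exp_half_add) simp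
    finally show ?thesis .
  qed
  define J where "J = (\<integral>\<^sup>+s. ennreal (exp (- (s \<bullet> (M *v s)) / 2)) \<partial>lborel)"
  obtain c where c: "\<And>g b. g \<in> borel_measurable borel \<Longrightarrow>
      (\<integral>\<^sup>+x. g (F *v x + b) \<partial>lborel) = c * (\<integral>\<^sup>+x. g x \<partial>lborel)"
    using nn_integral_affine_image[OF F] by blast
  define K where "K = c * ennreal \<kappa> * J"
  have wbar_meas[measurable]: "wbar \<in> borel_measurable borel" unfolding wbar_def by measurable
  have P: "pair_sigma_finite (lborel :: (real^'n) measure) (lborel :: (real^'m) measure)"
    by (simp add: pair_sigma_finite_def sigma_finite_lborel)
  have main: "(\<integral>\<^sup>+x. \<integral>\<^sup>+w. g (F *v x + B *v w) \<partial>gaussian 0 W \<partial>gaussian 0 \<Sigma>)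
      = K * (\<integral>\<^sup>+y. g y \<partial>gaussian 0 \<Sigma>')"
    if [measurable]: "g \<in> borel_measurable borel" for g
  proof -
    let ?d = "\<lambda>x w. ennreal (gaussian_density 0 \<Sigma> x * gaussian_density 0 W w)"
    have pos: "0 \<le> gaussian_density 0 \<Sigma> x" "0 \<le> gaussian_density 0 W w"
        "0 \<le> gaussian_density 0 \<Sigma>' x" for x w
      by (auto intro: less_imp_le gaussian_density_pos pd\<Sigma> pdW pd\<Sigma>')
    have meas_aff: "(\<lambda>w. g (F *v x + B *v w)) \<in> borel_measurable borel" for x by measurable
    have "(\<integral>\<^sup>+x. \<integral>\<^sup>+w. g (F *v x + B *v w) \<partial>gaussian 0 W \<partial>gaussian 0 \<Sigma>)
       = (\<integral>\<^sup>+x. ennreal (gaussian_density 0 \<Sigma> x) * (\<integral>\<^sup>+w. ennreal (gaussian_density 0 W w) * g (F *v x + B *v w) \<partial>lborel) \<partial>lborel)"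
      unfolding nn_integral_gaussian[OF meas_aff] by (rule nn_integral_gaussian) measurable
    also have "\<dots> = (\<integral>\<^sup>+x. \<integral>\<^sup>+w. ?d x w * g (F *v x + B *v w) \<partial>lborel \<partial>lborel)"
      by (intro nn_integral_cong, subst nn_integral_cmult[symmetric])
         (auto simp: ennreal_mult pos mult.assoc)
    also have "\<dots> = (\<integral>\<^sup>+w. \<integral>\<^sup>+x. ?d x w * g (F *v x + B *v w) \<partial>lborel \<partial>lborel)"
      by (rule pair_sigma_finite.Fubini'[OF P, symmetric]) measurable
    also have "\<dots> = (\<integral>\<^sup>+w. \<integral>\<^sup>+y. c * (?d (G *v (y - B *v w)) w * g y) \<partial>lborel \<partial>lborel)"
    proof (rule nn_integral_cong)
      fix w :: "real^'m"
      have "(\<integral>\<^sup>+x. ?d x w * g (F *v x + B *v w) \<partial>lborel)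
        = (\<integral>\<^sup>+x. ?d (G *v ((F *v x + B *v w) - B *v w)) w * g (F *v x + B *v w) \<partial>lborel)"
        by (simp add: G_def matrix_inv_vector_left F)
      also have "\<dots> = c * (\<integral>\<^sup>+y. ?d (G *v (y - B *v w)) w * g y \<partial>lborel)"
        by (rule c) measurable
      finally show "(\<integral>\<^sup>+x. ?d x w * g (F *v x + B *v w) \<partial>lborel)
        = (\<integral>\<^sup>+y. c * (?d (G *v (y - B *v w)) w * g y) \<partial>lborel)"
        by (simp add: nn_integral_cmult)
    qed
    also have "\<dots> = (\<integral>\<^sup>+y. \<integral>\<^sup>+w. c * (?d (G *v (y - B *v w)) w * g y) \<partial>lborel \<partial>lborel)"
      by (rule pair_sigma_finite.Fubini'[OF P]) measurable
    also have "\<dots> = (\<integral>\<^sup>+y. K * (ennreal (gaussian_density 0 \<Sigma>' y) * g y) \<partial>lborel)"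
    proof (rule nn_integral_cong)
      fix y :: "real^'n"
      have "(\<integral>\<^sup>+w. c * (?d (G *v (y - B *v w)) w * g y) \<partial>lborel)
        = (\<integral>\<^sup>+w. (c * ennreal \<kappa> * ennreal (gaussian_density 0 \<Sigma>' y) * g y)
              * ennreal (exp (- ((- wbar y + w) \<bullet> (M *v (- wbar y + w))) / 2)) \<partial>lborel)"
        by (intro nn_integral_cong, simp only: dens)
           (simp add: ennreal_mult \<kappa> less_imp_le pos mult_ac)
      also have "\<dots> = (c * ennreal \<kappa> * ennreal (gaussian_density 0 \<Sigma>' y) * g y)
          * (\<integral>\<^sup>+w. ennreal (exp (- ((- wbar y + w) \<bullet> (M *v (- wbar y + w))) / 2)) \<partial>lborel)"
        by (rule nn_integral_cmult) measurable
      also have "(\<integral>\<^sup>+w. ennreal (exp (- ((- wbar y + w) \<bullet> (M *v (- wbar y + w))) / 2)) \<partial>lborel) = J"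
        unfolding J_def
        by (rule nn_integral_translation[of "\<lambda>s. ennreal (exp (- (s \<bullet> (M *v s)) / 2))"]) measurable
      finally show "(\<integral>\<^sup>+w. c * (?d (G *v (y - B *v w)) w * g y) \<partial>lborel)
        = K * (ennreal (gaussian_density 0 \<Sigma>' y) * g y)"
        by (simp add: K_def mult_ac)
    qed
    also have "\<dots> = K * (\<integral>\<^sup>+y. g y \<partial>gaussian 0 \<Sigma>')"
      by (simp add: nn_integral_cmult nn_integral_gaussian)
    finally show ?thesis .
  qed
  have one: "(\<integral>\<^sup>+x. 1 \<partial>gaussian 0 W) = 1" "(\<integral>\<^sup>+x. 1 \<partial>gaussian 0 \<Sigma>) = 1"
    "(\<integral>\<^sup>+x. 1 \<partial>gaussian 0 \<Sigma>') = 1"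
    by (simp_all only: nn_integral_gaussian[OF borel_measurable_const] mult_1_right
        nn_integral_gaussian_density pd\<Sigma> pd\<Sigma>' pdW)
  have "1 = K * 1"
    using main[of "\<lambda>_. 1", OF borel_measurable_const] unfolding one .
  then have "K = 1" by simp
  with main[OF f] show ?thesis by (simp add: C_def \<Sigma>'_def)
qed

section \<open>Block matrices\<close>

lemma sum_Plus_UNIV:
  fixes f :: "'a::finite + 'b::finite \<Rightarrow> real"
  shows "(\<Sum>j\<in>UNIV. f j) = (\<Sum>j\<in>UNIV. f (Inl j)) + (\<Sum>j\<in>UNIV. f (Inr j))"
  unfolding UNIV_Plus_UNIV[symmetric] by (subst sum.Plus) auto

lemma block_vector_simps [simp]:
  "block_vector x u $ Inl i = x $ i" "block_vector x u $ Inr j = u $ j"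
  by (simp_all add: block_vector_def)

lemma block_vector_cases:
  obtains x u where "v = block_vector x u"
proof
  show "v = block_vector (\<chi> i. v $ Inl i) (\<chi> j. v $ Inr j)"
    by (simp add: vec_eq_iff block_vector_def split: sum.split)
qed

lemma inner_block_vector: "block_vector x u \<bullet> block_vector y w = x \<bullet> y + u \<bullet> w"
  by (simp add: inner_vec_def sum_Plus_UNIV)

lemma block_matrix_vector_mult:
  "block_matrix X11 X12 X21 X22 *v block_vector x u
     = block_vector (X11 *v x + X12 *v u) (X21 *v x + X22 *v u)"
  by (simp add: vec_eq_iff matrix_vector_mult_def block_vector_def block_matrix_def sum_Plus_UNIV
      split: sum.split)

lemma block_row_vector_mult:
  fixes X :: "real^('c::finite + 'd::finite)^('r::finite + 's::finite)"
  shows "(X *v block_vector x u) $ Inl i = (block11 X *v x + block12 X *v u) $ i"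
  by (simp add: matrix_vector_mult_def block11_def block12_def sum_Plus_UNIV)

section \<open>Hamiltonian trajectories\<close>

lemma backward_recursion_exists:
  fixes f :: "nat \<Rightarrow> 'a \<Rightarrow> 'a"
  shows "\<exists>z. z N = a \<and> (\<forall>k<N. z k = f k (z (Suc k)))"
proof -
  define g where "g = rec_nat a (\<lambda>j. f (N - Suc j))"
  have "g (N - k) = f k (g (N - Suc k))" if "k < N" for k
  proof -
    have "N - k = Suc (N - Suc k)" "N - Suc (N - Suc k) = k" using that by auto
    then show ?thesis by (simp add: g_def)
  qed
  moreover have "g (N - N) = a" by (simp add: g_def)
  ultimately show ?thesis by (intro exI[of _ "\<lambda>k. g (N - k)"]) simp
qed

lemma matrix_sum_vector_mult:
  fixes M :: "'i \<Rightarrow> real^'c^'r"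
  shows "(\<Sum>i\<in>I. M i) *v x = (\<Sum>i\<in>I. M i *v x)"
  by (induction I rule: infinite_finite_induct) (simp_all add: matrix_vector_mult_add_rdistrib)

text \<open>
  A linear system with quadratic stage cost and no cross terms. In the intended application \<open>Ab\<close> and
  \<open>Qb\<close> are \<open>Abar\<close> and \<open>Qbar\<close>, which arise when the cross terms are absorbed by a shift of the
  input.
\<close>

locale lq_system =
  fixes N :: nat and Ab Qb :: "nat \<Rightarrow> real^'n^'n" and B :: "nat \<Rightarrow> real^'m^'n"
    and R :: "nat \<Rightarrow> real^'m^'m"
  assumes pdR: "\<And>k. k < N \<Longrightarrow> pd (R k)"
    and psdQ: "\<And>k. k < N \<Longrightarrow> psd (Qb k)"
    and invA: "\<And>k. k < N \<Longrightarrow> invertible (Ab k)"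
    and reachable: "invertible (gramian Ab B N 0)"
begin

definition "G k = B k ** matrix_inv (R k) ** transpose (B k)"

text \<open>
  The stationarity conditions of the quadratic cost, with costate \<open>l\<close>. Solved for the state at
  the next time they are the action of \<open>hamiltonian_matrix\<close>; in the present form no inverse of
  \<open>Ab k\<close> occurs.
\<close>

definition hamiltonian :: "(nat \<Rightarrow> real^'n) \<Rightarrow> (nat \<Rightarrow> real^'n) \<Rightarrow> bool" where
  "hamiltonian x l \<longleftrightarrow> (\<forall>k<N. x (Suc k) = Ab k *v x k - G k *v l (Suc k) \<and>
     l k = transpose (Ab k) *v l (Suc k) + Qb k *v x k)"

definition "\<Phi> = transition (hamiltonian_matrix Ab B Qb R) 0 N"
definition "\<phi>11 = block11 \<Phi>"
definition "\<phi>12 = block12 \<Phi>"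

definition controlled :: "(nat \<Rightarrow> real^'n) \<Rightarrow> (nat \<Rightarrow> real^'m) \<Rightarrow> bool" where
  "controlled d w \<longleftrightarrow> (\<forall>k<N. d (Suc k) = Ab k *v d k + B k *v w k)"

definition cost :: "(nat \<Rightarrow> real^'n) \<Rightarrow> (nat \<Rightarrow> real^'m) \<Rightarrow> real" where
  "cost d w = (\<Sum>k<N. d k \<bullet> (Qb k *v d k) + w k \<bullet> (R k *v w k))"

text \<open>
  The input that produces a Hamiltonian trajectory.
\<close>

definition ham_control :: "(nat \<Rightarrow> real^'n) \<Rightarrow> nat \<Rightarrow> real^'m" where
  "ham_control l k = - (matrix_inv (R k) *v (transpose (B k) *v l (Suc k)))"

lemma transpose_G: "k < N \<Longrightarrow> transpose (G k) = G k"
  by (simp add: G_def matrix_transpose_mul matrix_mul_assoc transpose_matrix_inv pd_invertible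
      pdR pd_symmetric)

lemma hamiltonian_matrix_step:
  assumes k: "k < N" and x: "x' = Ab k *v x - G k *v l'"
    and l: "l = transpose (Ab k) *v l' + Qb k *v x"
  shows "hamiltonian_matrix Ab B Qb R k *v block_vector x l = block_vector x' l'"
proof -
  define T where "T = transpose (matrix_inv (Ab k))"
  have T: "T *v (transpose (Ab k) *v v) = v" for v
    using matrix_inv_right[OF invA[OF k]]
    by (simp add: T_def matrix_vector_mul_assoc flip: matrix_transpose_mul)
  have Tl: "T *v (l - Qb k *v x) = l'" by (simp add: l T)
  have "(Ab k + G k ** T ** Qb k) *v x + (- (G k ** T)) *v l = Ab k *v x - G k *v (T *v (l - Qb k *v x))"
    by (simp add: matrix_vector_mult_add_rdistrib matrix_vector_mult_minus_left
        matrix_vector_mult_diff_distrib matrix_vector_mul_assoc matrix_mul_assoc)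
  moreover have "(- (T ** Qb k)) *v x + T *v l = T *v (l - Qb k *v x)"
    by (simp add: matrix_vector_mult_minus_left matrix_vector_mult_diff_distrib matrix_vector_mul_assoc)
  ultimately show ?thesis
    unfolding hamiltonian_matrix_def Let_def G_def[symmetric] T_def[symmetric]
    by (simp add: block_matrix_vector_mult Tl x)
qed

lemma hamiltonian_backward_step:
  assumes k: "k < N"
  shows "x' = Ab k *v (matrix_inv (Ab k) *v (x' + G k *v l')) - G k *v l'"
  by (simp add: matrix_inv_vector_right invA k)

lemma hamiltonian_matrix_inv_step:
  assumes k: "k < N" and x: "x' = Ab k *v x - G k *v l'"
    and l: "l = transpose (Ab k) *v l' + Qb k *v x"
  shows "matrix_inv (hamiltonian_matrix Ab B Qb R k) *v block_vector x' l' = block_vector x l"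
proof -
  let ?M = "hamiltonian_matrix Ab B Qb R k"
  have "\<exists>v. ?M *v v = y" for y
  proof -
    obtain y1 y2 where y: "y = block_vector y1 y2" by (rule block_vector_cases)
    show ?thesis unfolding y
      by (rule exI, rule hamiltonian_matrix_step[OF k hamiltonian_backward_step[OF k] refl])
  qed
  then have "surj ((*v) ?M)" by (metis surjI)
  then have "invertible ?M"
    by (metis invertible_right_inverse matrix_right_invertible_surjective)
  then show ?thesis
    by (metis hamiltonian_matrix_step[OF k x l] matrix_inv_vector_left)
qed

text \<open>
  \<open>\<Phi>\<close> is a product of inverses of Hamiltonian matrices, so it maps the final pair of state and
  costate to the initial one.
\<close>

lemma hamiltonian_boundary:
  assumes "hamiltonian x l"
  shows "x 0 = \<phi>11 *v x N + \<phi>12 *v l N"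
proof -
  let ?M = "hamiltonian_matrix Ab B Qb R"
  have "backward_prod ?M 0 d *v block_vector (x d) (l d) = block_vector (x 0) (l 0)" if "d \<le> N" for d
    using that
  proof (induction d)
    case (Suc d)
    then have d: "d < N" by simp
    have "matrix_inv (?M d) *v block_vector (x (Suc d)) (l (Suc d)) = block_vector (x d) (l d)"
      using assms d by (intro hamiltonian_matrix_inv_step) (auto simp: hamiltonian_def)
    with Suc show ?case by (simp flip: matrix_vector_mul_assoc)
  qed simp
  from this[of N] have "backward_prod ?M 0 N *v block_vector (x N) (l N) = block_vector (x 0) (l 0)"
    by simp
  moreover have "\<Phi> = backward_prod ?M 0 N"
    unfolding \<Phi>_def transition_def by (cases N) simp_all
  ultimately have "\<Phi> *v block_vector (x N) (l N) = block_vector (x 0) (l 0)" by simp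
  then show ?thesis
    unfolding \<phi>11_def \<phi>12_def vec_eq_iff by (metis block_row_vector_mult block_vector_simps(1))
qed

lemma hamiltonian_exists:
  obtains x l where "hamiltonian x l" "x N = a" "l N = b"
proof -
  define f where "f k z = (case z of (x', l') \<Rightarrow>
     let x = matrix_inv (Ab k) *v (x' + G k *v l')
     in (x, transpose (Ab k) *v l' + Qb k *v x))" for k z
  obtain z where z: "z N = (a, b)" "\<And>k. k < N \<Longrightarrow> z k = f k (z (Suc k))"
    using backward_recursion_exists[of N "(a, b)" f] by auto
  show ?thesis
  proof (rule that[of "fst \<circ> z" "snd \<circ> z"])
    show "hamiltonian (fst \<circ> z) (snd \<circ> z)"
      unfolding hamiltonian_def
    proof (intro allI impI)
      fix k assume k: "k < N"
      obtain x' l' where "z (Suc k) = (x', l')" by (cases "z (Suc k)")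
      with z(2)[OF k] hamiltonian_backward_step[OF k, of x' l']
      show "(fst \<circ> z) (Suc k) = Ab k *v (fst \<circ> z) k - G k *v (snd \<circ> z) (Suc k) \<and>
        (snd \<circ> z) k = transpose (Ab k) *v (snd \<circ> z) (Suc k) + Qb k *v (fst \<circ> z) k"
        by (simp add: f_def Let_def)
    qed
  qed (simp_all add: z)
qed

lemma ham_control_weighted:
  "k < N \<Longrightarrow> R k *v ham_control l k = - (transpose (B k) *v l (Suc k))"
  by (simp add: ham_control_def matrix_vector_mult_minus_right matrix_inv_vector_right pdR pd_invertible)

lemma hamiltonian_controlled: "hamiltonian x l \<Longrightarrow> controlled x (ham_control l)"
  by (simp add: hamiltonian_def controlled_def ham_control_def G_def matrix_vector_mult_minus_right
      flip: matrix_vector_mul_assoc)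

text \<open>
  Summation by parts: each summand equals \<open>d k \<bullet> l k - d (Suc k) \<bullet> l (Suc k)\<close>. The left-hand
  side is the polarised cost of the two trajectories.
\<close>

lemma hamiltonian_pairing:
  assumes "hamiltonian x l" "controlled d w"
  shows "(\<Sum>k<N. d k \<bullet> (Qb k *v x k) + w k \<bullet> (R k *v ham_control l k)) = d 0 \<bullet> l 0 - d N \<bullet> l N"
proof -
  have "d k \<bullet> (Qb k *v x k) + w k \<bullet> (R k *v ham_control l k) = d k \<bullet> l k - d (Suc k) \<bullet> l (Suc k)"
    if "k < N" for k
  proof -
    have "d k \<bullet> l k = d k \<bullet> (transpose (Ab k) *v l (Suc k)) + d k \<bullet> (Qb k *v x k)"
      using assms(1) that by (auto simp: hamiltonian_def inner_add_right)
    moreover have "d (Suc k) \<bullet> l (Suc k) = d k \<bullet> (transpose (Ab k) *v l (Suc k)) + w k \<bullet> (transpose (B k) *v l (Suc k))"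
      using assms(2) that
      by (simp add: controlled_def inner_add_left inner_matrix_vector_right[of _ "transpose _"])
    ultimately show ?thesis by (simp add: ham_control_weighted that)
  qed
  then show ?thesis using sum_lessThan_telescope'[of "\<lambda>k. d k \<bullet> l k" N] by simp
qed

lemma cost_nonneg: "0 \<le> cost d w"
  unfolding cost_def using psdQ pdR
  by (intro sum_nonneg add_nonneg_nonneg) (auto simp: psd_def pd_nonneg)

lemma cost_pos:
  assumes "k < N" "w k \<noteq> 0"
  shows "0 < cost d w"
  unfolding cost_def
proof (rule sum_pos2[of _ k])
  show "0 < d k \<bullet> (Qb k *v d k) + w k \<bullet> (R k *v w k)"
    using assms psdQ[of k] pdR[of k] by (intro add_nonneg_pos) (auto simp: psd_def pdD)
qed (use assms psdQ pdR in \<open>auto simp: psd_def pd_nonneg intro!: add_nonneg_nonneg\<close>)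

lemma hamiltonian_cost:
  "hamiltonian x l \<Longrightarrow> cost x (ham_control l) = x 0 \<bullet> l 0 - x N \<bullet> l N"
  unfolding cost_def by (rule hamiltonian_pairing) (simp_all add: hamiltonian_controlled)

lemma costate_free:
  assumes "\<And>k. k < N \<Longrightarrow> l k = transpose (Ab k) *v l (Suc k)"
  shows "i + d \<le> N \<Longrightarrow> transpose (forward_prod Ab i d) *v l (i + d) = l i"
proof (induction d)
  case (Suc d)
  then show ?case
    using assms[of "i + d"] by (simp add: matrix_transpose_mul flip: matrix_vector_mul_assoc)
qed simp

text \<open>
  A Hamiltonian trajectory with both end states zero has cost zero by \<open>hamiltonian_cost\<close>. Hence its
  input and its states vanish, so the costate obeys \<open>l k = Ab\<^sub>k\<^sup>T l (k+1)\<close> and is annihilated by every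
  \<open>B\<^sub>k\<^sup>T\<close>. The final costate then lies in the kernel of the reachability Gramian.
\<close>

lemma invertible_\<phi>12: "invertible \<phi>12"
proof (rule invertible_by_kernel)
  fix \<xi> assume \<xi>: "\<phi>12 *v \<xi> = 0"
  obtain x l where ham: "hamiltonian x l" and xN: "x N = 0" and lN: "l N = \<xi>"
    by (rule hamiltonian_exists)
  have x0: "x 0 = 0" using hamiltonian_boundary[OF ham] by (simp add: xN lN \<xi>)
  have "cost x (ham_control l) = 0" by (simp add: hamiltonian_cost[OF ham] x0 xN)
  then have u0: "ham_control l k = 0" if "k < N" for k
    using cost_pos[of k "ham_control l" x] that by force
  have Bl: "transpose (B k) *v l (Suc k) = 0" if "k < N" for k
    using ham_control_weighted[OF that, of l] by (simp add: u0 that)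
  have xk: "x k = 0" if "k \<le> N" for k
    using that
  proof (induction k)
    case (Suc k)
    then show ?case
      using hamiltonian_controlled[OF ham] by (simp add: controlled_def u0)
  qed (simp add: x0)
  have lk: "l k = transpose (Ab k) *v l (Suc k)" if "k < N" for k
    using ham that xk[of k] by (simp add: hamiltonian_def)
  have "gramian Ab B N 0 *v \<xi> = (\<Sum>k\<in>{0..<N}. (transition Ab N (k + 1) ** B k ** transpose (B k)
                       ** transpose (transition Ab N (k + 1))) *v \<xi>)"
    unfolding gramian_def by (rule matrix_sum_vector_mult)
  also have "\<dots> = 0"
  proof (intro sum.neutral ballI)
    fix k assume "k \<in> {0..<N}"
    then have k: "k < N" by simp
    then have "transpose (transition Ab N (k + 1)) *v \<xi> = l (Suc k)"
      using costate_free[OF lk, of "Suc k" "N - Suc k"] by (simp add: transition_def lN)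
    then show "(transition Ab N (k + 1) ** B k ** transpose (B k) ** transpose (transition Ab N (k + 1))) *v \<xi> = 0"
      using Bl[OF k] by (simp flip: matrix_vector_mul_assoc)
  qed
  finally show "\<xi> = 0" using reachable by (metis matrix_inv_vector_left matrix_vector_mult_0_right)
qed

text \<open>
  \<open>\<Lambda>\<close> maps the final state of a Hamiltonian trajectory that starts at the origin to its final
  costate.
\<close>

definition "\<Lambda> = - (matrix_inv \<phi>12 ** \<phi>11)"

lemma hamiltonian_from_origin:
  obtains x l where "hamiltonian x l" "x 0 = 0" "x N = y" "l N = \<Lambda> *v y"
proof -
  obtain x l where ham: "hamiltonian x l" and xN: "x N = y" and lN: "l N = \<Lambda> *v y"
    by (rule hamiltonian_exists)
  have "x 0 = 0"
    by (simp add: hamiltonian_boundary[OF ham] xN lN \<Lambda>_def matrix_vector_mult_minus_left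
        matrix_vector_mult_minus_right matrix_inv_vector_right invertible_\<phi>12 flip: matrix_vector_mul_assoc)
  then show ?thesis using that ham xN lN by blast
qed

lemma inner_symmetric_weights:
  assumes "k < N"
  shows "a \<bullet> (Qb k *v b) = b \<bullet> (Qb k *v a)" "c \<bullet> (R k *v d) = d \<bullet> (R k *v c)"
  using psdQ[OF assms] pdR[OF assms] inner_symmetric_matrix by (auto simp: psd_def pd_def)

text \<open>
  Two Hamiltonian trajectories from the origin can be paired in either order, and the polarised
  cost is symmetric.
\<close>

lemma transpose_\<Lambda>: "transpose \<Lambda> = \<Lambda>"
proof (rule symmetric_by_inner)
  fix a b
  obtain x l where x: "hamiltonian x l" "x 0 = 0" "x N = a" "l N = \<Lambda> *v a"
    by (rule hamiltonian_from_origin)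
  obtain x' l' where x': "hamiltonian x' l'" "x' 0 = 0" "x' N = b" "l' N = \<Lambda> *v b"
    by (rule hamiltonian_from_origin)
  have "- (b \<bullet> (\<Lambda> *v a)) = (\<Sum>k<N. x' k \<bullet> (Qb k *v x k) + ham_control l' k \<bullet> (R k *v ham_control l k))"
    using hamiltonian_pairing[OF x(1) hamiltonian_controlled[OF x'(1)]] by (simp add: x x')
  also have "\<dots> = (\<Sum>k<N. x k \<bullet> (Qb k *v x' k) + ham_control l k \<bullet> (R k *v ham_control l' k))"
    by (intro sum.cong refl arg_cong2[where f="(+)"]) (auto intro: inner_symmetric_weights)
  also have "\<dots> = - (a \<bullet> (\<Lambda> *v b))"
    using hamiltonian_pairing[OF x'(1) hamiltonian_controlled[OF x(1)]] by (simp add: x x')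
  finally show "a \<bullet> (\<Lambda> *v b) = b \<bullet> (\<Lambda> *v a)" by simp
qed

text \<open>
  The Hamiltonian trajectory \<open>x\<close> from the origin to \<open>d N\<close> is stationary: by \<open>hamiltonian_pairing\<close>
  the mixed terms of the cost vanish on the difference \<open>d - x\<close>, which is zero at both ends. So
  the cost of \<open>d\<close> is the cost of \<open>x\<close>, namely \<open>- d N \<bullet> \<Lambda> (d N)\<close>, plus a nonnegative one.
\<close>

lemma cost_from_origin_ge:
  assumes d: "controlled d w" and d0: "d 0 = 0"
  shows "cost d w + d N \<bullet> (\<Lambda> *v d N) \<ge> 0"
proof -
  obtain x l where x: "hamiltonian x l" "x 0 = 0" "x N = d N" "l N = \<Lambda> *v d N"
    by (rule hamiltonian_from_origin)
  define v where "v = ham_control l"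
  define e where "e k = d k - x k" for k
  define u where "u k = w k - v k" for k
  have xv: "controlled x v" unfolding v_def by (rule hamiltonian_controlled[OF x(1)])
  have eu: "controlled e u"
    using d xv by (simp add: controlled_def e_def u_def matrix_vector_mult_diff_distrib)
  have "cost d w = (\<Sum>k<N. (x k \<bullet> (Qb k *v x k) + v k \<bullet> (R k *v v k))
      + (2 * (e k \<bullet> (Qb k *v x k) + u k \<bullet> (R k *v v k)) + (e k \<bullet> (Qb k *v e k) + u k \<bullet> (R k *v u k))))"
    unfolding cost_def
  proof (intro sum.cong refl)
    fix k assume "k \<in> {..<N}"
    then have k: "k < N" by simp
    have "d k = e k + x k" "w k = u k + v k" by (simp_all add: e_def u_def)
    then show "d k \<bullet> (Qb k *v d k) + w k \<bullet> (R k *v w k) = (x k \<bullet> (Qb k *v x k) + v k \<bullet> (R k *v v k))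
      + (2 * (e k \<bullet> (Qb k *v x k) + u k \<bullet> (R k *v v k)) + (e k \<bullet> (Qb k *v e k) + u k \<bullet> (R k *v u k)))"
      using inner_symmetric_weights(1)[OF k, of "e k" "x k"] inner_symmetric_weights(2)[OF k, of "u k" "v k"]
      by (simp add: matrix_vector_right_distrib inner_add_left inner_add_right)
  qed
  also have "\<dots> = cost x v + (2 * (\<Sum>k<N. e k \<bullet> (Qb k *v x k) + u k \<bullet> (R k *v v k)) + cost e u)"
    by (simp add: sum.distrib sum_distrib_left distrib_left cost_def)
  also have "(\<Sum>k<N. e k \<bullet> (Qb k *v x k) + u k \<bullet> (R k *v v k)) = 0"
    using hamiltonian_pairing[OF x(1) eu] by (simp add: v_def e_def x d0)
  also have "cost x v = - (d N \<bullet> (\<Lambda> *v d N))"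
    using hamiltonian_cost[OF x(1)] by (simp add: v_def x)
  finally show ?thesis using cost_nonneg[of e u] by simp
qed

end

section \<open>The Riccati recursion\<close>

lemma riccati_complete_square:
  fixes Ab Qb P' :: "real^'n^'n" and B :: "real^'m^'n" and R :: "real^'m^'m"
  assumes P': "transpose P' = P'" and R: "transpose R = R"
  defines "S \<equiv> R + transpose B ** P' ** B"
  defines "K \<equiv> matrix_inv S ** transpose B ** P' ** Ab"
  assumes S: "invertible S"
    and P: "P = transpose Ab ** P' ** Ab - transpose Ab ** P' ** B ** matrix_inv S ** transpose B ** P' ** Ab + Qb"
  shows "d \<bullet> (Qb *v d) + u \<bullet> (R *v u) + (Ab *v d + B *v u) \<bullet> (P' *v (Ab *v d + B *v u))
    = d \<bullet> (P *v d) + (u + K *v d) \<bullet> (S *v (u + K *v d))"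
proof -
  define a where "a = Ab *v d"
  define g where "g = transpose B *v (P' *v a)"
  define h where "h = matrix_inv S *v g"
  have K: "K *v d = h" by (simp add: K_def h_def g_def a_def flip: matrix_vector_mul_assoc)
  have Sh: "S *v h = g" by (simp add: h_def matrix_inv_vector_right S)
  have symS: "transpose S = S"
    by (simp add: S_def transpose_add R matrix_transpose_mul P' matrix_mul_assoc)
  have "P *v d = transpose Ab *v (P' *v a) - transpose Ab *v (P' *v (B *v h)) + Qb *v d"
    by (simp add: P a_def h_def g_def matrix_vector_mult_add_rdistrib matrix_vector_mult_diff_rdistrib
        flip: matrix_vector_mul_assoc)
  moreover have "d \<bullet> (transpose Ab *v v) = a \<bullet> v" for v
    by (simp add: a_def inner_matrix_vector_right)
  moreover have "a \<bullet> (P' *v (B *v h)) = g \<bullet> h"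
  proof -
    have "a \<bullet> (P' *v (B *v h)) = (P' *v a) \<bullet> (B *v h)" by (simp add: inner_matrix_vector_right P')
    also have "\<dots> = g \<bullet> h" by (simp add: inner_matrix_vector_right[of _ B] g_def)
    finally show ?thesis .
  qed
  ultimately have dPd: "d \<bullet> (P *v d) = a \<bullet> (P' *v a) - g \<bullet> h + d \<bullet> (Qb *v d)"
    by (simp add: inner_add_right inner_diff_right)
  have Bu: "(B *v u) \<bullet> (P' *v a) = u \<bullet> g"
    by (simp add: g_def inner_matrix_vector_right[of u "transpose B"])
  have uSu: "u \<bullet> (S *v u) = u \<bullet> (R *v u) + (B *v u) \<bullet> (P' *v (B *v u))"
    by (simp add: S_def matrix_vector_mult_add_rdistrib inner_add_right
        inner_matrix_vector_right[of u "transpose B"] flip: matrix_vector_mul_assoc)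
  have "(u + h) \<bullet> (S *v (u + h)) = u \<bullet> (S *v u) + 2 * (u \<bullet> g) + g \<bullet> h"
    using inner_symmetric_matrix[OF symS, of h u]
    by (simp add: matrix_vector_right_distrib inner_add_left inner_add_right Sh inner_commute[of h g])
  moreover have "(a + B *v u) \<bullet> (P' *v (a + B *v u))
      = a \<bullet> (P' *v a) + 2 * (u \<bullet> g) + (B *v u) \<bullet> (P' *v (B *v u))"
    using inner_symmetric_matrix[OF P', of a "B *v u"]
    by (simp add: matrix_vector_right_distrib inner_add_left inner_add_right Bu)
  ultimately show ?thesis by (simp add: K dPd uSu flip: a_def)
qed

context lq_system
begin

definition riccati_step :: "nat \<Rightarrow> real^'n^'n \<Rightarrow> real^'n^'n" where
  "riccati_step k P = transpose (Ab k) ** P ** Ab k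
      - transpose (Ab k) ** P ** B k ** matrix_inv (R k + transpose (B k) ** P ** B k)
          ** transpose (B k) ** P ** Ab k + Qb k"

text \<open>
  Backward induction. Once the weights after time \<open>k\<close> are known to be positive, the trajectory
  that rests at the origin until time \<open>k\<close>, is driven by \<open>w\<close> at time \<open>k\<close> and by the optimal feedback
  afterwards has total cost \<open>w \<bullet> S w\<close>, where \<open>S\<close> is the weight at time \<open>k\<close> and the terminal
  penalty \<open>P N = \<Lambda> + Z\<close> is included. By \<open>cost_from_origin_ge\<close> and positivity of \<open>Z\<close> this is positive.
\<close>

lemma riccati_positive:
  assumes Z: "pd Z" and PN: "P N = \<Lambda> + Z" and rec: "\<And>k. k < N \<Longrightarrow> P k = riccati_step k (P (Suc k))"
  shows "k \<le> N \<Longrightarrow> (\<forall>j. k \<le> j \<longrightarrow> j \<le> N \<longrightarrow> transpose (P j) = P j) \<and>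
    (\<forall>j. k \<le> j \<longrightarrow> j < N \<longrightarrow> pd (R j + transpose (B j) ** P (Suc j) ** B j))"
proof (induction k rule: inc_induct)
  case base
  show ?case using Z by (auto simp: PN transpose_add transpose_\<Lambda> pd_symmetric)
next
  case (step k)
  define S where "S j = R j + transpose (B j) ** P (Suc j) ** B j" for j
  define K where "K j = matrix_inv (S j) ** transpose (B j) ** P (Suc j) ** Ab j" for j
  have k: "k < N" by fact
  have Psym: "transpose (P j) = P j" if "k < j" "j \<le> N" for j using step.IH that by simp
  have Spd: "pd (S j)" if "k < j" "j < N" for j using step.IH that by (simp add: S_def)
  have "0 < w \<bullet> (S k *v w)" if w: "w \<noteq> 0" for w
  proof -
    \<comment> \<open>at rest before time \<open>k\<close>, the input \<open>w\<close> at time \<open>k\<close>, optimal feedback afterwards\<close>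
    define fb where "fb j x = (if j < k then 0 else if j = k then w else - (K j *v x))" for j x
    define d where "d = rec_nat 0 (\<lambda>j x. Ab j *v x + B j *v fb j x)"
    define u where "u j = fb j (d j)" for j
    have d0: "d 0 = 0" and dS: "d (Suc j) = Ab j *v d j + B j *v u j" for j
      by (simp_all add: d_def u_def)
    have ctrl: "controlled d u" by (simp add: controlled_def dS)
    have early: "d j = 0" if "j \<le> k" for j
      using that by (induction j) (simp_all add: d0 dS u_def fb_def)
    have "(\<Sum>j<i. d j \<bullet> (Qb j *v d j) + u j \<bullet> (R j *v u j)) + d i \<bullet> (P i *v d i)
        = w \<bullet> (S k *v w)" if "Suc k \<le> i" "i \<le> N" for i
      using that
    proof (induction i rule: dec_induct)
      case base
      have "(\<Sum>j<k. d j \<bullet> (Qb j *v d j) + u j \<bullet> (R j *v u j)) = 0"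
        by (intro sum.neutral) (simp add: early u_def fb_def)
      moreover have "u k = w" "d (Suc k) = B k *v w" by (simp_all add: u_def fb_def dS early)
      ultimately show ?case
        by (simp add: early S_def matrix_vector_mult_add_rdistrib inner_add_right
            inner_matrix_vector_right[of w "transpose (B k)"] flip: matrix_vector_mul_assoc)
    next
      case (step i)
      then have i: "k < i" "i < N" by auto
      have "u i + K i *v d i = 0" using i by (simp add: u_def fb_def)
      moreover have "d i \<bullet> (Qb i *v d i) + u i \<bullet> (R i *v u i) + d (Suc i) \<bullet> (P (Suc i) *v d (Suc i))
          = d i \<bullet> (P i *v d i) + (u i + K i *v d i) \<bullet> (S i *v (u i + K i *v d i))"
        unfolding dS K_def S_def
        by (rule riccati_complete_square)
           (use i pd_invertible[OF Spd[of i]] Psym[of "Suc i"] rec[of i] pdR[of i]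
             in \<open>auto simp: S_def riccati_step_def pd_symmetric\<close>)
      ultimately show ?case using step by simp
    qed
    from this[of N] k have total: "cost d u + d N \<bullet> (P N *v d N) = w \<bullet> (S k *v w)"
      by (simp add: cost_def)
    show ?thesis
    proof (cases "d N = 0")
      case True
      have "u k \<noteq> 0" using w by (simp add: u_def fb_def)
      then show ?thesis using cost_pos[OF k, of u d] total True by simp
    next
      case False
      then show ?thesis using cost_from_origin_ge[OF ctrl d0] pdD[OF Z, of "d N"] total
        by (simp add: PN matrix_vector_mult_add_rdistrib inner_add_right)
    qed
  qed
  moreover have symS: "transpose (S k) = S k"
    using Psym[of "Suc k"] k
    by (simp add: S_def transpose_add pd_symmetric pdR matrix_transpose_mul matrix_mul_assoc)
  ultimately have pdS: "pd (S k)" by (simp add: pd_def)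
  have "transpose (P k) = P k"
    using Psym[of "Suc k"] k psdQ[OF k]
    by (simp add: rec riccati_step_def S_def[symmetric] transpose_add transpose_diff matrix_transpose_mul
        transpose_matrix_inv pd_invertible pdS symS matrix_mul_assoc psd_def)
  with pdS step.IH show ?case
    by (metis S_def Suc_leI le_neq_implies_less)
qed

end

section \<open>The closed loop steers the covariance\<close>

locale riccati_lq_system = lq_system N Ab Qb B R
  for N :: nat and Ab Qb :: "nat \<Rightarrow> real^'n^'n" and B :: "nat \<Rightarrow> real^'m^'n"
    and R :: "nat \<Rightarrow> real^'m^'m" +
  fixes P :: "nat \<Rightarrow> real^'n^'n" and Z :: "real^'n^'n"
  assumes pdZ: "pd Z" and PN: "P N = \<Lambda> + Z"
    and rec: "\<And>k. k < N \<Longrightarrow> P k = riccati_step k (P (Suc k))"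
begin

text \<open>\<open>Rh\<close> is the effective weight of the input, \<open>K\<close> the feedback gain and \<open>F\<close> the closed loop.\<close>

definition "Rh k = R k + transpose (B k) ** P (Suc k) ** B k"
definition "K k = matrix_inv (Rh k) ** transpose (B k) ** P (Suc k) ** Ab k"
definition "F k = Ab k - B k ** K k"

lemma P_symmetric: "k \<le> N \<Longrightarrow> transpose (P k) = P k"
  using riccati_positive[OF pdZ PN rec, of 0] by simp

lemma pd_Rh: "k < N \<Longrightarrow> pd (Rh k)"
  using riccati_positive[OF pdZ PN rec, of 0] by (simp add: Rh_def)

lemma complete_square:
  assumes "k < N"
  shows "d \<bullet> (Qb k *v d) + u \<bullet> (R k *v u)
      + (Ab k *v d + B k *v u) \<bullet> (P (Suc k) *v (Ab k *v d + B k *v u))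
    = d \<bullet> (P k *v d) + (u + K k *v d) \<bullet> (Rh k *v (u + K k *v d))"
  unfolding K_def Rh_def
  by (rule riccati_complete_square)
     (use assms pd_invertible[OF pd_Rh[of k]] P_symmetric[of "Suc k"] rec[of k] pdR[of k]
       in \<open>auto simp: Rh_def riccati_step_def pd_symmetric\<close>)

lemma input_weight_identity:
  assumes k: "k < N"
  shows "B k *v (matrix_inv (Rh k) *v (transpose (B k) *v (r + P (Suc k) *v (G k *v r)))) = G k *v r"
proof -
  define t where "t = matrix_inv (R k) *v (transpose (B k) *v r)"
  have Br: "transpose (B k) *v r = R k *v t"
    by (simp add: t_def matrix_inv_vector_right pd_invertible pdR k)
  have Gr: "G k *v r = B k *v t"
    by (simp add: G_def t_def flip: matrix_vector_mul_assoc)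
  have "transpose (B k) *v (r + P (Suc k) *v (G k *v r)) = Rh k *v t"
    by (simp add: Gr matrix_vector_right_distrib Br Rh_def matrix_vector_mult_add_rdistrib
        flip: matrix_vector_mul_assoc)
  then show ?thesis by (simp add: Gr matrix_inv_vector_left pd_invertible pd_Rh k)
qed

text \<open>
  Together with \<open>P_closed_loop\<close> this says that a closed-loop trajectory \<open>x (k+1) = F\<^sub>k x k\<close> with the
  costate \<open>P k x k\<close> is Hamiltonian.
\<close>

lemma closed_loop_identity:
  assumes k: "k < N"
  shows "Ab k *v v = F k *v v + G k *v (P (Suc k) *v (F k *v v))"
proof -
  define u where "u = - (K k *v v)"
  have Fv: "F k *v v = Ab k *v v + B k *v u"
    by (simp add: F_def u_def matrix_vector_mult_diff_rdistrib matrix_vector_mult_minus_right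
        flip: matrix_vector_mul_assoc)
  have "Rh k *v (K k *v v) = transpose (B k) *v (P (Suc k) *v (Ab k *v v))"
    by (simp add: K_def matrix_inv_vector_right pd_invertible pd_Rh k flip: matrix_vector_mul_assoc)
  then have "Rh k *v u = - (transpose (B k) *v (P (Suc k) *v (Ab k *v v)))"
    by (simp add: u_def matrix_vector_mult_minus_right)
  then have "R k *v u = - (transpose (B k) *v (P (Suc k) *v (Ab k *v v)))
      - transpose (B k) *v (P (Suc k) *v (B k *v u))"
    by (simp add: Rh_def matrix_vector_mult_add_rdistrib eq_diff_eq flip: matrix_vector_mul_assoc)
  then have "R k *v u = - (transpose (B k) *v (P (Suc k) *v (F k *v v)))"
    by (simp add: Fv matrix_vector_right_distrib)
  then have "u = - (matrix_inv (R k) *v (transpose (B k) *v (P (Suc k) *v (F k *v v))))"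
    by (metis k matrix_inv_vector_left matrix_vector_mult_minus_right pdR pd_invertible)
  then have "B k *v u = - (G k *v (P (Suc k) *v (F k *v v)))"
    by (simp add: G_def matrix_vector_mult_minus_right flip: matrix_vector_mul_assoc)
  moreover have "Ab k *v v = F k *v v - B k *v u" by (simp add: Fv)
  ultimately show ?thesis by simp
qed

lemma invertible_F: "k < N \<Longrightarrow> invertible (F k)"
proof (rule invertible_by_kernel)
  fix v assume k: "k < N" and "F k *v v = 0"
  then have "Ab k *v v = 0" using closed_loop_identity[OF k, of v] by simp
  then show "v = 0" by (metis invA k matrix_inv_vector_left matrix_vector_mult_0_right)
qed

lemma P_closed_loop:
  assumes "k < N"
  shows "P k *v v = transpose (Ab k) *v (P (Suc k) *v (F k *v v)) + Qb k *v v"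
  using rec[OF assms]
  by (simp add: riccati_step_def F_def K_def Rh_def matrix_vector_mult_diff_rdistrib
      matrix_vector_mult_diff_distrib matrix_vector_mult_add_rdistrib flip: matrix_vector_mul_assoc)

text \<open>
  The transpose of \<open>closed_loop_identity\<close>.
\<close>

lemma transpose_F:
  assumes k: "k < N"
  shows "transpose (F k) *v (r + P (Suc k) *v (G k *v r)) = transpose (Ab k) *v r"
proof -
  have "v \<bullet> (transpose (F k) *v (r + P (Suc k) *v (G k *v r))) = v \<bullet> (transpose (Ab k) *v r)" for v
  proof -
    have "v \<bullet> (transpose (F k) *v (r + P (Suc k) *v (G k *v r)))
      = (F k *v v) \<bullet> r + (F k *v v) \<bullet> (P (Suc k) *v (G k *v r))"
      by (simp add: inner_matrix_vector_right[of v] inner_add_right)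
    also have "(F k *v v) \<bullet> (P (Suc k) *v (G k *v r)) = (G k *v (P (Suc k) *v (F k *v v))) \<bullet> r"
      using k by (simp add: inner_matrix_vector_right P_symmetric transpose_G)
    also have "(F k *v v) \<bullet> r + (G k *v (P (Suc k) *v (F k *v v))) \<bullet> r = (Ab k *v v) \<bullet> r"
      by (simp add: inner_add_left[symmetric] closed_loop_identity[OF k, symmetric])
    also have "\<dots> = v \<bullet> (transpose (Ab k) *v r)"
      by (simp add: inner_matrix_vector_right[of v])
    finally show ?thesis .
  qed
  then show ?thesis by (metis vector_eq_ldot)
qed

lemma transpose_forward_prod_F:
  assumes "\<And>k. k < N \<Longrightarrow> p k = transpose (F k) *v p (Suc k)"
  shows "k \<le> N \<Longrightarrow> transpose (forward_prod F 0 k) *v p k = p 0"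
proof (induction k)
  case (Suc k)
  then show ?case
    using assms[of k] by (simp add: matrix_transpose_mul flip: matrix_vector_mul_assoc)
qed simp

text \<open>
  Apply \<open>hamiltonian_boundary\<close> to the closed-loop trajectory from \<open>x0\<close>: in
  \<open>\<phi>11 + \<phi>12 P N\<close> the part \<open>\<Lambda>\<close> of \<open>P N\<close> cancels \<open>\<phi>11\<close>.
\<close>

lemma \<phi>12_Z_closed_loop: "\<phi>12 *v (Z *v (forward_prod F 0 N *v x0)) = x0"
proof -
  define x where "x k = forward_prod F 0 k *v x0" for k
  define l where "l k = P k *v x k" for k
  have xS: "x (Suc k) = F k *v x k" for k by (simp add: x_def flip: matrix_vector_mul_assoc)
  have "hamiltonian x l"
    unfolding hamiltonian_def
    using closed_loop_identity P_closed_loop by (simp add: xS l_def)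
  then have "x 0 = \<phi>11 *v x N + \<phi>12 *v (P N *v x N)"
    using hamiltonian_boundary[of x l] by (simp add: l_def)
  then show ?thesis
    by (simp add: x_def PN \<Lambda>_def matrix_vector_mult_add_rdistrib matrix_vector_right_distrib
        matrix_vector_mult_minus_left matrix_vector_mult_minus_right matrix_inv_vector_right
        matrix_vector_mult_diff_rdistrib matrix_vector_mult_diff_distrib
        invertible_\<phi>12 flip: matrix_vector_mul_assoc)
qed

text \<open>
  Let \<open>(v, w)\<close> be the Hamiltonian trajectory that ends in state \<open>0\<close> with costate \<open>\<xi>\<close>, and let
  \<open>p = w - P v\<close> be the defect of its costate from that of the closed loop. Then \<open>p\<close> is carried
  backwards by the transposed closed loop, and \<open>v (k+1)\<close> falls short of \<open>F\<^sub>k v k\<close> by the noise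
  covariance, divided by \<open>\<epsilon>\<close>, applied to \<open>p (k+1)\<close>. Hence \<open>\<Sigma> k p k + \<epsilon> v k\<close> is carried forwards
  by the closed loop; at time \<open>N\<close> it is \<open>\<Sigma> N \<xi>\<close>.
\<close>

lemma terminal_covariance:
  assumes \<Sigma>: "\<And>k. k < N \<Longrightarrow> \<Sigma> (Suc k) = F k ** \<Sigma> k ** transpose (F k)
      + B k ** (\<epsilon> *\<^sub>R matrix_inv (Rh k)) ** transpose (B k)"
    and Z: "Z ** \<Sigma>N ** Z = \<epsilon> *\<^sub>R Z + matrix_inv \<phi>12 ** \<Sigma> 0 ** transpose (matrix_inv \<phi>12)"
  shows "\<Sigma> N = \<Sigma>N"
proof -
  define E where "E = forward_prod F 0 N"
  have \<phi>inv: "invertible \<phi>12" by (rule invertible_\<phi>12)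
  have Zinv: "invertible Z" by (rule pd_invertible[OF pdZ])
  have "\<phi>12 ** (Z ** E) = mat 1"
    using \<phi>12_Z_closed_loop by (simp add: matrix_eq E_def flip: matrix_vector_mul_assoc)
  then have ZE: "Z ** E = matrix_inv \<phi>12" using matrix_inv_unique by metis
  have \<Sigma>N\<xi>: "\<Sigma> N *v \<xi> = E *v (\<Sigma> 0 *v (transpose E *v \<xi>) + \<epsilon> *\<^sub>R (\<phi>12 *v \<xi>))" for \<xi>
  proof -
    obtain v w where ham: "hamiltonian v w" and vN: "v N = 0" and wN: "w N = \<xi>"
      by (rule hamiltonian_exists)
    define p where "p k = w k - P k *v v k" for k
    define r where "r k = w (Suc k) - P (Suc k) *v (F k *v v k)" for k
    have Fv: "F k *v v k - v (Suc k) = G k *v r k" if "k < N" for k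
      using ham closed_loop_identity[OF that, of "v k"] that
      by (simp add: hamiltonian_def r_def matrix_vector_mult_diff_distrib)
    have q: "p (Suc k) = r k + P (Suc k) *v (G k *v r k)" if "k < N" for k
      unfolding Fv[OF that, symmetric] unfolding p_def r_def by (simp add: matrix_vector_mult_diff_distrib)
    have p: "p k = transpose (F k) *v p (Suc k)" if "k < N" for k
      using ham that unfolding q[OF that] transpose_F[OF that]
      by (simp add: p_def r_def hamiltonian_def P_closed_loop matrix_vector_mult_diff_distrib)
    have "\<Sigma> k *v p k + \<epsilon> *\<^sub>R v k = forward_prod F 0 k *v (\<Sigma> 0 *v p 0 + \<epsilon> *\<^sub>R v 0)" if "k \<le> N" for k
      using that
    proof (induction k)
      case (Suc k)
      then have k: "k < N" by simp
      have "\<Sigma> (Suc k) *v p (Suc k) = F k *v (\<Sigma> k *v p k) + \<epsilon> *\<^sub>R (G k *v r k)"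
        using input_weight_identity[OF k, of "r k"] p[OF k]
        by (simp add: \<Sigma>[OF k] matrix_vector_mult_add_rdistrib scaleR_matrix_vector
            matrix_vector_mult_scaleR q[OF k, symmetric] flip: matrix_vector_mul_assoc)
      then have "\<Sigma> (Suc k) *v p (Suc k) + \<epsilon> *\<^sub>R v (Suc k) = F k *v (\<Sigma> k *v p k + \<epsilon> *\<^sub>R v k)"
        by (simp add: Fv[OF k, symmetric] matrix_vector_right_distrib matrix_vector_mult_scaleR
            scaleR_diff_right)
      with Suc show ?case by (simp flip: matrix_vector_mul_assoc)
    qed simp
    from this[of N] have "\<Sigma> N *v \<xi> = E *v (\<Sigma> 0 *v p 0 + \<epsilon> *\<^sub>R v 0)"
      by (simp add: p_def vN wN E_def)
    moreover have "p 0 = transpose E *v \<xi>"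
      using transpose_forward_prod_F[OF p, of N] by (simp add: E_def p_def vN wN)
    moreover have "v 0 = \<phi>12 *v \<xi>"
      using hamiltonian_boundary[OF ham] by (simp add: vN wN)
    ultimately show ?thesis by simp
  qed
  have "Z *v (\<Sigma> N *v (Z *v \<xi>)) = Z *v (\<Sigma>N *v (Z *v \<xi>))" for \<xi>
  proof -
    have ZEv: "Z *v (E *v x) = matrix_inv \<phi>12 *v x" for x
      by (simp add: matrix_vector_mul_assoc ZE)
    have "transpose E ** Z = transpose (matrix_inv \<phi>12)"
      using ZE pdZ by (metis matrix_transpose_mul pd_symmetric)
    then have EZv: "transpose E *v (Z *v x) = transpose (matrix_inv \<phi>12) *v x" for x
      by (simp add: matrix_vector_mul_assoc)
    have "Z *v (\<Sigma> N *v (Z *v \<xi>)) = matrix_inv \<phi>12 *v (\<Sigma> 0 *v (transpose (matrix_inv \<phi>12) *v \<xi>)) + \<epsilon> *\<^sub>R (Z *v \<xi>)"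
      by (simp add: \<Sigma>N\<xi> ZEv EZv matrix_vector_right_distrib matrix_vector_mult_scaleR
          matrix_inv_vector_left \<phi>inv)
    also have "\<dots> = (Z ** \<Sigma>N ** Z) *v \<xi>"
      by (simp add: Z matrix_vector_mult_add_rdistrib scaleR_matrix_vector flip: matrix_vector_mul_assoc)
    finally show ?thesis by (simp flip: matrix_vector_mul_assoc)
  qed
  then have "Z ** (\<Sigma> N ** Z) = Z ** (\<Sigma>N ** Z)" by (simp add: matrix_eq flip: matrix_vector_mul_assoc)
  then show ?thesis
    by (metis Zinv matrix_inv_left matrix_inv_right matrix_mul_assoc matrix_mul_lid matrix_mul_rid)
qed

end

text \<open>
  With \<open>T\<close> the inner square root, \<open>H Z H = \<epsilon>/2 + T\<close>. Squaring gives \<open>H Z \<Sigma>N Z H = \<epsilon>\<^sup>2/4 + \<epsilon> T + T\<^sup>2\<close>,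
  and \<open>T\<^sup>2 = \<epsilon>\<^sup>2/4 + H Y H\<close> turns this into \<open>\<epsilon> H Z H + H Y H\<close>.
\<close>

lemma terminal_equation:
  fixes \<Sigma>N Y :: "real^'n^'n"
  assumes \<epsilon>: "0 < \<epsilon>" and \<Sigma>N: "pd \<Sigma>N" and Y: "psd Y"
  defines "H \<equiv> psd_sqrt \<Sigma>N"
  defines "Z \<equiv> (\<epsilon> / 2) *\<^sub>R matrix_inv \<Sigma>N
     + matrix_inv H ** psd_sqrt ((\<epsilon>\<^sup>2 / 4) *\<^sub>R mat 1 + H ** Y ** H) ** matrix_inv H"
  shows "pd Z" and "Z ** \<Sigma>N ** Z = \<epsilon> *\<^sub>R Z + Y"
proof -
  define T where "T = psd_sqrt ((\<epsilon>\<^sup>2 / 4) *\<^sub>R mat 1 + H ** Y ** H)"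
  have pdH: "pd H" unfolding H_def by (rule pd_psd_sqrt[OF \<Sigma>N])
  have HH: "H ** H = \<Sigma>N" unfolding H_def by (rule psd_sqrt_square[OF pd_imp_psd[OF \<Sigma>N]])
  have Hi: "invertible H" by (rule pd_invertible[OF pdH])
  have symHi: "transpose (matrix_inv H) = matrix_inv H"
    using pd_matrix_inv[OF pdH] by (rule pd_symmetric)
  have "pd ((\<epsilon>\<^sup>2 / 4) *\<^sub>R (mat 1 :: real^'n^'n))"
    using \<epsilon> by (intro pd_scaleR) (auto simp: pd_def)
  moreover have "psd (H ** Y ** H)"
    using psd_congruence[OF Y, of H] pdH by (simp add: pd_symmetric)
  ultimately have arg: "psd ((\<epsilon>\<^sup>2 / 4) *\<^sub>R mat 1 + H ** Y ** H)"
    by (rule pd_imp_psd[OF pd_add_psd])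
  have psdT: "psd T" and TT: "T ** T = (\<epsilon>\<^sup>2 / 4) *\<^sub>R mat 1 + H ** Y ** H"
    unfolding T_def by (rule psd_psd_sqrt[OF arg], rule psd_sqrt_square[OF arg])
  have "psd (matrix_inv H ** T ** matrix_inv H)"
    using psd_congruence[OF psdT, of "matrix_inv H"] by (simp add: symHi)
  then show "pd Z" unfolding Z_def T_def[symmetric]
    using \<epsilon> by (intro pd_add_psd pd_scaleR pd_matrix_inv \<Sigma>N) auto
  have \<Sigma>inv: "matrix_inv \<Sigma>N = matrix_inv H ** matrix_inv H"
    by (rule matrix_inv_unique) (metis HH Hi matrix_inv_right matrix_mul_assoc matrix_mul_rid)
  have Hv: "H *v (matrix_inv H *v v) = v" "matrix_inv H *v (H *v v) = v" for v
    by (simp_all add: matrix_inv_vector_right matrix_inv_vector_left Hi)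
  have Zv: "Z *v v = matrix_inv H *v ((\<epsilon> / 2) *\<^sub>R (matrix_inv H *v v) + T *v (matrix_inv H *v v))" for v
    by (simp add: Z_def T_def[symmetric] \<Sigma>inv matrix_vector_mult_add_rdistrib scaleR_matrix_vector
        matrix_vector_right_distrib matrix_vector_mult_scaleR flip: matrix_vector_mul_assoc)
  have \<Sigma>v: "\<Sigma>N *v v = H *v (H *v v)" for v by (simp add: HH matrix_vector_mul_assoc)
  have TTv: "T *v (T *v v) = (\<epsilon>\<^sup>2 / 4) *\<^sub>R v + H *v (Y *v (H *v v))" for v
    by (simp add: matrix_vector_mul_assoc TT matrix_vector_mult_add_rdistrib scaleR_matrix_vector
        matrix_mul_assoc)
  have "Z *v (\<Sigma>N *v (Z *v v)) = \<epsilon> *\<^sub>R (Z *v v) + Y *v v" for v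
  proof -
    define y where "y = matrix_inv H *v v"
    have "Z *v (\<Sigma>N *v (Z *v v)) = matrix_inv H *v ((\<epsilon> / 2) *\<^sub>R ((\<epsilon> / 2) *\<^sub>R y + T *v y) + T *v ((\<epsilon> / 2) *\<^sub>R y + T *v y))"
      by (simp add: Zv \<Sigma>v Hv y_def)
    also have "(\<epsilon> / 2) *\<^sub>R ((\<epsilon> / 2) *\<^sub>R y + T *v y) + T *v ((\<epsilon> / 2) *\<^sub>R y + T *v y)
        = \<epsilon> *\<^sub>R ((\<epsilon> / 2) *\<^sub>R y + T *v y) + H *v (Y *v (H *v y))"
    proof -
      have "\<epsilon> *\<^sub>R a = (\<epsilon>/2) *\<^sub>R a + (\<epsilon>/2) *\<^sub>R a" for a :: "real^'n"
        by (simp flip: scaleR_add_left)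
      moreover have "(\<epsilon> * \<epsilon>) *\<^sub>R y = (\<epsilon> * \<epsilon> / 2) *\<^sub>R y + (\<epsilon> * \<epsilon> / 4) *\<^sub>R y + (\<epsilon> * \<epsilon> / 4) *\<^sub>R y"
        by (simp flip: scaleR_add_left)
      ultimately show ?thesis
        by (simp add: matrix_vector_right_distrib matrix_vector_mult_scaleR TTv scaleR_add_right
            power2_eq_square) (simp add: vec_eq_iff field_simps)
    qed
    also have "matrix_inv H *v (\<epsilon> *\<^sub>R ((\<epsilon> / 2) *\<^sub>R y + T *v y) + H *v (Y *v (H *v y)))
        = \<epsilon> *\<^sub>R (Z *v v) + Y *v v"
      by (simp add: Zv Hv y_def matrix_vector_right_distrib matrix_vector_mult_scaleR)
    finally show ?thesis .
  qed
  then show "Z ** \<Sigma>N ** Z = \<epsilon> *\<^sub>R Z + Y"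
    by (simp add: matrix_eq matrix_vector_mult_add_rdistrib scaleR_matrix_vector
        flip: matrix_vector_mul_assoc)
qed

section \<open>Gibbs' inequality\<close>

text \<open>
  This integrand differs from that of the relative entropy by \<open>r - p\<close>, which has integral zero for
  probability densities; the correction makes it nonnegative pointwise.
\<close>

lemma kl_integrand:
  fixes p r :: real
  assumes "0 \<le> p" "0 < r"
  shows "0 \<le> p * ln p - p * ln r - p + r"
    and "p * ln p - p * ln r - p + r = 0 \<Longrightarrow> p = r"
proof -
  have "0 \<le> p * ln p - p * ln r - p + r \<and> (p * ln p - p * ln r - p + r = 0 \<longrightarrow> p = r)"
  proof (cases "p = 0")
    case False
    then have p: "0 < p" using assms by simp
    have lnr: "ln r = ln p + ln (r / p)" using p assms by (simp add: ln_div)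
    have eq: "p * ln p - p * ln r - p + r = p * (r / p - 1 - ln (r / p))"
      using p unfolding lnr by (simp add: right_diff_distrib distrib_left)
    have "ln (r / p) \<le> r / p - 1" using p assms by (intro ln_le_minus_one) simp
    moreover have "ln (r / p) = r / p - 1 \<Longrightarrow> p = r"
      using p assms ln_eq_minus_one[of "r / p"] by simp
    ultimately show ?thesis unfolding eq using p by auto
  qed (use assms in auto)
  then show "0 \<le> p * ln p - p * ln r - p + r" "p * ln p - p * ln r - p + r = 0 \<Longrightarrow> p = r" by auto
qed

lemma gibbs_inequality:
  fixes p r :: "'a \<Rightarrow> real"
  assumes p: "integrable M p" "\<And>u. 0 \<le> p u" "(\<integral>u. p u \<partial>M) = 1"
    and r: "integrable M r" "\<And>u. 0 < r u" "(\<integral>u. r u \<partial>M) = 1"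
    and pp: "integrable M (\<lambda>u. p u * ln (p u))" and pr: "integrable M (\<lambda>u. p u * ln (r u))"
  shows "(\<integral>u. p u * ln (r u) \<partial>M) \<le> (\<integral>u. p u * ln (p u) \<partial>M)"
    and "(\<integral>u. p u * ln (r u) \<partial>M) = (\<integral>u. p u * ln (p u) \<partial>M) \<Longrightarrow> AE u in M. p u = r u"
proof -
  let ?f = "\<lambda>u. p u * ln (p u) - p u * ln (r u) - p u + r u"
  have int: "integrable M ?f" by (intro Bochner_Integration.integrable_add Bochner_Integration.integrable_diff p r pp pr)
  have val: "(\<integral>u. ?f u \<partial>M) = (\<integral>u. p u * ln (p u) \<partial>M) - (\<integral>u. p u * ln (r u) \<partial>M)"
    using p r pp pr by simp
  have nn: "0 \<le> ?f u" for u by (rule kl_integrand(1)) (use p r in auto)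
  then have "0 \<le> (\<integral>u. ?f u \<partial>M)" by (rule Bochner_Integration.integral_nonneg)
  then show "(\<integral>u. p u * ln (r u) \<partial>M) \<le> (\<integral>u. p u * ln (p u) \<partial>M)" by (simp add: val)
  assume "(\<integral>u. p u * ln (r u) \<partial>M) = (\<integral>u. p u * ln (p u) \<partial>M)"
  then have "(\<integral>u. ?f u \<partial>M) = 0" by (simp only: val)
  then have "AE u in M. ?f u = 0"
    using integral_nonneg_eq_0_iff_AE[OF int] nn by simp
  then show "AE u in M. p u = r u"
    by eventually_elim (rule kl_integrand(2), use p r in auto)
qed

section \<open>Averaging over one control\<close>

text \<open>
  The equation \<open>E (x + q) = x + E q\<close>, with negative parts moved to the other side so that it holds
  for extended reals whether or not \<open>E q\<close> is finite.
\<close>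

lemma nn_integral_positive_part:
  fixes p q :: "'v \<Rightarrow> real" and x :: real
  assumes [measurable]: "p \<in> borel_measurable L" "q \<in> borel_measurable L"
    and q: "\<And>v. 0 \<le> q v" and p1: "(\<integral>\<^sup>+v. ennreal (p v) \<partial>L) = 1"
  shows "(\<integral>\<^sup>+v. ennreal (p v) * ennreal (x + q v) \<partial>L) + ennreal (- x)
    = (\<integral>\<^sup>+v. ennreal (p v) * ennreal (q v) \<partial>L) + ennreal x
      + (\<integral>\<^sup>+v. ennreal (p v) * ennreal (- (x + q v)) \<partial>L)"
proof -
  have const: "c = (\<integral>\<^sup>+v. ennreal (p v) * c \<partial>L)" for c
    by (simp add: nn_integral_multc p1)
  have "(\<integral>\<^sup>+v. ennreal (p v) * ennreal (x + q v) \<partial>L) + ennreal (- x)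
      = (\<integral>\<^sup>+v. ennreal (p v) * ennreal (x + q v) + ennreal (p v) * ennreal (- x) \<partial>L)"
    by (subst const[of "ennreal (- x)"]) (simp add: nn_integral_add)
  also have "\<dots> = (\<integral>\<^sup>+v. (ennreal (p v) * ennreal (q v) + ennreal (p v) * ennreal x)
      + ennreal (p v) * ennreal (- (x + q v)) \<partial>L)"
  proof (rule nn_integral_cong)
    fix v
    have "ennreal (x + q v) + ennreal (- x) = ennreal (q v) + ennreal x + ennreal (- (x + q v))"
      using q[of v] by (cases "0 \<le> x"; cases "0 \<le> x + q v") (auto simp: ennreal_neg simp flip: ennreal_plus)
    then show "ennreal (p v) * ennreal (x + q v) + ennreal (p v) * ennreal (- x)
      = (ennreal (p v) * ennreal (q v) + ennreal (p v) * ennreal x) + ennreal (p v) * ennreal (- (x + q v))"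
      by (simp add: distrib_left[symmetric])
  qed
  also have "\<dots> = (\<integral>\<^sup>+v. ennreal (p v) * ennreal (q v) \<partial>L) + (\<integral>\<^sup>+v. ennreal (p v) * ennreal x \<partial>L)
      + (\<integral>\<^sup>+v. ennreal (p v) * ennreal (- (x + q v)) \<partial>L)"
    by (simp add: nn_integral_add)
  finally show ?thesis by (simp add: const[of "ennreal x", symmetric])
qed

text \<open>
  One step of a controlled process: \<open>M\<close> is the law of the history \<open>h\<close>, \<open>p h\<close> the density of the next
  input, and \<open>M'\<close> the law of the extended history. A quantity \<open>a\<close> of the history grows to
  \<open>c = a + b + q\<close>, where \<open>q \<ge> 0\<close> depends on the input and \<open>b\<close> does not. Where \<open>- b \<le> m\<close>, the
  conditional mean of \<open>q\<close>, the quantity is a submartingale. The point is to derive this without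
  knowing in advance that anything is integrable.
\<close>

locale controlled_step =
  fixes M :: "'h measure" and M' :: "'k measure" and p q :: "'h \<Rightarrow> 'v::euclidean_space \<Rightarrow> real"
    and ext :: "'h \<Rightarrow> 'v \<Rightarrow> 'k" and a b :: "'h \<Rightarrow> real" and c :: "'k \<Rightarrow> real"
  assumes disintegration: "\<And>f. f \<in> borel_measurable M' \<Longrightarrow>
      (\<integral>\<^sup>+\<omega>. f \<omega> \<partial>M') = (\<integral>\<^sup>+h. \<integral>\<^sup>+v. ennreal (p h v) * f (ext h v) \<partial>lborel \<partial>M)"
    and p_measurable: "(\<lambda>(h, v). p h v) \<in> borel_measurable (M \<Otimes>\<^sub>M lborel)"
    and q_measurable: "(\<lambda>(h, v). q h v) \<in> borel_measurable (M \<Otimes>\<^sub>M lborel)"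
    and a_measurable [measurable]: "a \<in> borel_measurable M"
    and b_measurable [measurable]: "b \<in> borel_measurable M"
    and c_measurable [measurable]: "c \<in> borel_measurable M'"
    and p_total: "\<And>h. h \<in> space M \<Longrightarrow> (\<integral>\<^sup>+v. ennreal (p h v) \<partial>lborel) = 1"
    and q_nonneg: "\<And>h v. 0 \<le> q h v"
    and c_ext: "\<And>h v. h \<in> space M \<Longrightarrow> c (ext h v) = a h + b h + q h v"
begin

definition m :: "'h \<Rightarrow> ennreal" where
  "m h = (\<integral>\<^sup>+v. ennreal (p h v) * ennreal (q h v) \<partial>lborel)"

definition gain :: "'h \<Rightarrow> real" where
  "gain h = enn2real (m h) + b h"

text \<open>The conditional means of the positive and the negative part of \<open>c\<close>.\<close>

definition "up h = (\<integral>\<^sup>+v. ennreal (p h v) * ennreal (c (ext h v)) \<partial>lborel)"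
definition "dn h = (\<integral>\<^sup>+v. ennreal (p h v) * ennreal (- c (ext h v)) \<partial>lborel)"

lemma p_section [measurable (raw)]:
  "f \<in> L \<rightarrow>\<^sub>M M \<Longrightarrow> g \<in> L \<rightarrow>\<^sub>M borel \<Longrightarrow> (\<lambda>y. p (f y) (g y)) \<in> borel_measurable L"
  using measurable_compose[OF _ p_measurable, of "\<lambda>y. (f y, g y)" L] by simp

lemma q_section [measurable (raw)]:
  "f \<in> L \<rightarrow>\<^sub>M M \<Longrightarrow> g \<in> L \<rightarrow>\<^sub>M borel \<Longrightarrow> (\<lambda>y. q (f y) (g y)) \<in> borel_measurable L"
  using measurable_compose[OF _ q_measurable, of "\<lambda>y. (f y, g y)" L] by simp

lemma m_measurable [measurable]: "m \<in> borel_measurable M"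
  unfolding m_def by measurable

lemma gain_measurable [measurable]: "gain \<in> borel_measurable M"
  unfolding gain_def by measurable

lemma up_eq: "h \<in> space M \<Longrightarrow> up h = (\<integral>\<^sup>+v. ennreal (p h v) * ennreal ((a h + b h) + q h v) \<partial>lborel)"
  unfolding up_def by (simp add: c_ext)

lemma dn_eq: "h \<in> space M \<Longrightarrow> dn h = (\<integral>\<^sup>+v. ennreal (p h v) * ennreal (- ((a h + b h) + q h v)) \<partial>lborel)"
  unfolding dn_def by (simp add: c_ext)

lemma up_measurable [measurable]: "up \<in> borel_measurable M"
  by (subst measurable_cong[OF up_eq]) measurable

lemma dn_measurable [measurable]: "dn \<in> borel_measurable M"
  by (subst measurable_cong[OF dn_eq]) measurable

lemma up_balance:
  assumes h: "h \<in> space M"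
  shows "up h + ennreal (- (a h + b h)) = m h + ennreal (a h + b h) + dn h"
proof -
  have [measurable]: "(\<lambda>v. p h v) \<in> borel_measurable lborel" "(\<lambda>v. q h v) \<in> borel_measurable lborel"
    using h by measurable
  show ?thesis
    unfolding up_eq[OF h] dn_eq[OF h] m_def
    by (rule nn_integral_positive_part) (use q_nonneg p_total h in auto)
qed

lemma dn_finite:
  assumes h: "h \<in> space M"
  shows "dn h < \<infinity>"
proof -
  have "dn h \<le> (\<integral>\<^sup>+v. ennreal (p h v) * ennreal \<bar>a h + b h\<bar> \<partial>lborel)"
    unfolding dn_eq[OF h]
  proof (rule nn_integral_mono)
    fix v show "ennreal (p h v) * ennreal (- (a h + b h + q h v)) \<le> ennreal (p h v) * ennreal \<bar>a h + b h\<bar>"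
      using q_nonneg[of h v] by (intro mult_left_mono ennreal_leI) auto
  qed
  also have "\<dots> = ennreal \<bar>a h + b h\<bar>"
    using h by (subst nn_integral_multc) (auto simp: p_total)
  finally show ?thesis by (rule le_less_trans) simp
qed

lemma nn_integral_up: "(\<integral>\<^sup>+\<omega>. ennreal (c \<omega>) \<partial>M') = (\<integral>\<^sup>+h. up h \<partial>M)"
  unfolding up_def by (rule disintegration) measurable

lemma nn_integral_dn: "(\<integral>\<^sup>+\<omega>. ennreal (- c \<omega>) \<partial>M') = (\<integral>\<^sup>+h. dn h \<partial>M)"
  unfolding dn_def by (rule disintegration) measurable

text \<open>
  The conditional mean of \<open>c\<close> is \<open>a + gain\<close>, again with negative parts on the other side.
\<close>

lemma gain_identity:
  assumes h: "h \<in> space M" and ge: "ennreal (- b h) \<le> m h" and fin: "m h < \<infinity>"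
  shows "0 \<le> gain h" "up h + ennreal (- a h) = ennreal (a h) + ennreal (gain h) + dn h"
proof -
  obtain mr where mr: "m h = ennreal mr" "0 \<le> mr" using fin by (cases "m h") auto
  obtain dr where dr: "dn h = ennreal dr" "0 \<le> dr" using dn_finite[OF h] by (cases "dn h") auto
  have "up h \<le> up h + ennreal (- (a h + b h))" by simp
  also have "\<dots> < \<infinity>" unfolding up_balance[OF h] by (simp add: mr dr)
  finally obtain ur where ur: "up h = ennreal ur" "0 \<le> ur" by (cases "up h") auto
  have gain: "gain h = mr + b h" using mr by (simp add: gain_def)
  show "0 \<le> gain h" using ge mr by (simp add: gain)
  have "ur + max 0 (- (a h + b h)) = mr + max 0 (a h + b h) + dr"
    using up_balance[OF h] ur mr dr
    by (simp add: ennreal_plus[symmetric] max_def split: if_splits del: ennreal_plus)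
      (auto simp: ennreal_neg simp flip: ennreal_plus)
  then have "ur = a h + gain h + dr" by (simp add: gain max_def split: if_splits)
  then show "up h + ennreal (- a h) = ennreal (a h) + ennreal (gain h) + dn h"
    using ur dr \<open>0 \<le> gain h\<close>
    by (cases "0 \<le> a h") (auto simp: ennreal_neg simp flip: ennreal_plus)
qed

text \<open>
  The conditional form of Jensen's inequality for the positive part: \<open>a \<le> up\<close>, where \<open>up\<close> is
  the conditional mean of the positive part of \<open>c\<close>.
\<close>

lemma positive_part_backward:
  assumes ge: "AE h in M. ennreal (- b h) \<le> m h" and fin: "(\<integral>\<^sup>+\<omega>. ennreal (c \<omega>) \<partial>M') < \<infinity>"
  shows "(\<integral>\<^sup>+h. ennreal (a h) \<partial>M) < \<infinity>"
    and "AE h in M. m h < \<infinity>"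
proof -
  have up: "(\<integral>\<^sup>+h. up h \<partial>M) < \<infinity>" using fin by (simp add: nn_integral_up)
  then have "AE h in M. up h \<noteq> \<infinity>"
    by (intro nn_integral_noteq_infinite) auto
  moreover have "AE h in M. h \<in> space M" by simp
  ultimately show m: "AE h in M. m h < \<infinity>"
  proof eventually_elim
    case (elim h)
    then have "m h \<le> up h + ennreal (- (a h + b h))" unfolding up_balance[OF elim(2)]
      by (simp add: add.assoc)
    also have "\<dots> < \<infinity>" using elim by (simp add: less_top)
    finally show ?case .
  qed
  have "AE h in M. h \<in> space M" by simp
  with m ge have "AE h in M. ennreal (a h) \<le> up h"
  proof eventually_elim
    case (elim h)
    show ?case
    proof (cases "0 \<le> a h")
      case True
      then have "up h = ennreal (a h) + ennreal (gain h) + dn h"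
        using gain_identity(2)[of h] elim by (simp add: ennreal_neg)
      then show ?thesis by (simp add: add.assoc)
    qed (simp add: ennreal_neg)
  qed
  then have "(\<integral>\<^sup>+h. ennreal (a h) \<partial>M) \<le> (\<integral>\<^sup>+h. up h \<partial>M)" by (rule nn_integral_mono_AE)
  then show "(\<integral>\<^sup>+h. ennreal (a h) \<partial>M) < \<infinity>" using up by (rule le_less_trans)
qed

text \<open>
  Integrate \<open>gain_identity\<close>. The two terms on its left are finite by assumption, so the three
  on its right are finite as well.
\<close>

lemma expectation_forward:
  assumes ge: "AE h in M. ennreal (- b h) \<le> m h" and fin: "(\<integral>\<^sup>+\<omega>. ennreal (c \<omega>) \<partial>M') < \<infinity>"
    and a: "integrable M a"
  shows "integrable M' c" "integrable M gain" "AE h in M. 0 \<le> gain h"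
    "(\<integral>\<omega>. c \<omega> \<partial>M') = (\<integral>h. a h \<partial>M) + (\<integral>h. gain h \<partial>M)"
proof -
  note m = positive_part_backward(2)[OF ge fin]
  have sp: "AE h in M. h \<in> space M" by simp
  from m ge sp show nn: "AE h in M. 0 \<le> gain h"
    by eventually_elim (rule gain_identity(1))
  from m ge sp have "AE h in M. up h + ennreal (- a h) = ennreal (a h) + ennreal (gain h) + dn h"
    by eventually_elim (rule gain_identity(2))
  then have "(\<integral>\<^sup>+h. up h + ennreal (- a h) \<partial>M) = (\<integral>\<^sup>+h. ennreal (a h) + ennreal (gain h) + dn h \<partial>M)"
    by (rule nn_integral_cong_AE)
  then have eq: "(\<integral>\<^sup>+h. up h \<partial>M) + (\<integral>\<^sup>+h. ennreal (- a h) \<partial>M)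
      = (\<integral>\<^sup>+h. ennreal (a h) \<partial>M) + (\<integral>\<^sup>+h. ennreal (gain h) \<partial>M) + (\<integral>\<^sup>+h. dn h \<partial>M)"
    by (simp add: nn_integral_add)
  have up: "(\<integral>\<^sup>+h. up h \<partial>M) < \<infinity>" using fin by (simp add: nn_integral_up)
  have afin: "(\<integral>\<^sup>+h. ennreal (a h) \<partial>M) < \<infinity>" "(\<integral>\<^sup>+h. ennreal (- a h) \<partial>M) < \<infinity>"
    using a by (auto simp: real_integrable_def less_top[symmetric])
  have lhs: "(\<integral>\<^sup>+h. up h \<partial>M) + (\<integral>\<^sup>+h. ennreal (- a h) \<partial>M) < \<infinity>"
    using up afin by (simp add: less_top)
  have gfin: "(\<integral>\<^sup>+h. ennreal (gain h) \<partial>M) < \<infinity>" and dfin: "(\<integral>\<^sup>+h. dn h \<partial>M) < \<infinity>"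
    using lhs unfolding eq by (simp_all add: less_top)
  show c: "integrable M' c"
    unfolding real_integrable_def nn_integral_up nn_integral_dn using up dfin by auto
  show g: "integrable M gain"
    by (rule integrableI_nonneg) (use nn gfin in auto)
  have geq: "(\<integral>h. gain h \<partial>M) = enn2real (\<integral>\<^sup>+h. ennreal (gain h) \<partial>M)"
    by (rule integral_eq_nn_integral) (use nn in auto)
  obtain u1 where u1: "(\<integral>\<^sup>+h. up h \<partial>M) = ennreal u1" "0 \<le> u1" using up by (cases "\<integral>\<^sup>+h. up h \<partial>M") auto
  obtain u2 where u2: "(\<integral>\<^sup>+h. dn h \<partial>M) = ennreal u2" "0 \<le> u2" using dfin by (cases "\<integral>\<^sup>+h. dn h \<partial>M") auto
  obtain u3 where u3: "(\<integral>\<^sup>+h. ennreal (gain h) \<partial>M) = ennreal u3" "0 \<le> u3"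
    using gfin by (cases "\<integral>\<^sup>+h. ennreal (gain h) \<partial>M") auto
  obtain u4 where u4: "(\<integral>\<^sup>+h. ennreal (a h) \<partial>M) = ennreal u4" "0 \<le> u4"
    using afin(1) by (cases "\<integral>\<^sup>+h. ennreal (a h) \<partial>M") auto
  obtain u5 where u5: "(\<integral>\<^sup>+h. ennreal (- a h) \<partial>M) = ennreal u5" "0 \<le> u5"
    using afin(2) by (cases "\<integral>\<^sup>+h. ennreal (- a h) \<partial>M") auto
  have "u1 + u5 = u4 + u3 + u2" using eq u1 u2 u3 u4 u5 by (simp flip: ennreal_plus)
  moreover have "(\<integral>\<omega>. c \<omega> \<partial>M') = u1 - u2"
    unfolding real_lebesgue_integral_def[OF c] nn_integral_up nn_integral_dn using u1 u2 by simp
  moreover have "(\<integral>h. a h \<partial>M) = u4 - u5"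
    unfolding real_lebesgue_integral_def[OF a] using u4 u5 by simp
  ultimately show "(\<integral>\<omega>. c \<omega> \<partial>M') = (\<integral>h. a h \<partial>M) + (\<integral>h. gain h \<partial>M)"
    using geq u3 by simp
qed

lemma positive_part_forward:
  assumes a: "integrable M a" and b: "integrable M b" and m: "(\<integral>\<^sup>+h. m h \<partial>M) < \<infinity>"
  shows "(\<integral>\<^sup>+\<omega>. ennreal (c \<omega>) \<partial>M') < \<infinity>"
proof -
  have "up h \<le> m h + ennreal \<bar>a h + b h\<bar>" if h: "h \<in> space M" for h
  proof -
    have [measurable]: "(\<lambda>v. p h v) \<in> borel_measurable lborel" "(\<lambda>v. q h v) \<in> borel_measurable lborel"
      using h by measurable
    have "up h \<le> (\<integral>\<^sup>+v. ennreal (p h v) * ennreal (q h v) + ennreal (p h v) * ennreal \<bar>a h + b h\<bar> \<partial>lborel)"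
      unfolding up_eq[OF h] using q_nonneg[of h]
      by (intro nn_integral_mono)
         (auto simp: distrib_left[symmetric] simp flip: ennreal_plus intro!: mult_left_mono ennreal_leI)
    also have "\<dots> = m h + ennreal \<bar>a h + b h\<bar>"
      using h by (simp add: nn_integral_add nn_integral_multc p_total m_def)
    finally show ?thesis .
  qed
  then have "(\<integral>\<^sup>+h. up h \<partial>M) \<le> (\<integral>\<^sup>+h. m h + ennreal \<bar>a h + b h\<bar> \<partial>M)" by (intro nn_integral_mono)
  also have "\<dots> = (\<integral>\<^sup>+h. m h \<partial>M) + (\<integral>\<^sup>+h. ennreal \<bar>a h + b h\<bar> \<partial>M)" by (simp add: nn_integral_add)
  also have "\<dots> < \<infinity>"
    using m Bochner_Integration.integrable_add[OF a b] by (auto simp: integrable_iff_bounded less_top)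
  finally show ?thesis by (simp add: nn_integral_up)
qed

end

section \<open>The law of the history\<close>

lemma sets_history_law [measurable_cong]: "sets (history_law A B \<Sigma>0 \<pi> k) = sets (history_space k)"
  by (cases k) simp_all

lemma space_history_law: "space (history_law A B \<Sigma>0 \<pi> k) = space (history_space k)"
  by (rule sets_eq_imp_space_eq[OF sets_history_law])

lemma measurable_history_state [measurable (raw)]:
  assumes f: "f \<in> L \<rightarrow>\<^sub>M history_space k" and j: "j \<le> k"
  shows "(\<lambda>y. fst (f y) j) \<in> borel_measurable L"
proof -
  have "j \<in> {..k}" using j by simp
  then show ?thesis
    using measurable_compose[OF measurable_compose[OF f[unfolded history_space_def] measurable_fst]
        measurable_component_singleton] by simp
qed

lemma measurable_history_input [measurable (raw)]:
  assumes f: "f \<in> L \<rightarrow>\<^sub>M history_space k" and j: "j < k"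
  shows "(\<lambda>y. snd (f y) j) \<in> borel_measurable L"
proof -
  have "j \<in> {..<k}" using j by simp
  then show ?thesis
    using measurable_compose[OF measurable_compose[OF f[unfolded history_space_def] measurable_snd]
        measurable_component_singleton] by simp
qed

text \<open>
  The transition in \<open>history_law\<close>, in a form that applies to a single history and input.
\<close>

definition extend :: "(nat \<Rightarrow> real^'n^'n) \<Rightarrow> (nat \<Rightarrow> real^'m^'n) \<Rightarrow> nat
    \<Rightarrow> ('n::finite, 'm::finite) history \<Rightarrow> real^'m \<Rightarrow> ('n, 'm) history" where
  "extend A B k h v = ((fst h)(Suc k := A k *v fst h k + B k *v v), (snd h)(k := v))"

lemma measurable_extend:
  "(\<lambda>(h, v). extend A B k h v) \<in> history_space k \<Otimes>\<^sub>M borel \<rightarrow>\<^sub>M history_space (Suc k)"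
proof -
  let ?L = "history_space k \<Otimes>\<^sub>M (borel :: (real^'b) measure)"
  have fst: "(\<lambda>y. fst (fst y)) \<in> ?L \<rightarrow>\<^sub>M PiM {..k} (\<lambda>_. borel)"
    and snd: "(\<lambda>y. snd (fst y)) \<in> ?L \<rightarrow>\<^sub>M PiM {..<k} (\<lambda>_. borel)"
    unfolding history_space_def by measurable
  have x: "(\<lambda>y. A k *v fst (fst y) k + B k *v snd y) \<in> borel_measurable ?L"
    by (intro borel_measurable_add borel_measurable_matrix_vector
        measurable_history_state[OF measurable_fst order.refl] measurable_snd)
  show ?thesis
    unfolding extend_def case_prod_beta history_space_def[of "Suc k"]
    by (intro measurable_Pair measurable_fun_upd[OF _ fst x] measurable_fun_upd[OF _ snd]) auto
qed

lemma history_law_Suc: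
  "history_law A B \<Sigma>0 \<pi> (Suc k) =
     distr (density (history_law A B \<Sigma>0 \<pi> k \<Otimes>\<^sub>M lborel) (\<lambda>(h, v). ennreal (\<pi> k h v)))
       (history_space (Suc k)) (\<lambda>(h, v). extend A B k h v)"
  by (simp add: extend_def case_prod_unfold)

lemma is_policyD:
  assumes "is_policy N \<pi>" "k < N"
  shows "(\<lambda>(h, u). \<pi> k h u) \<in> borel_measurable (history_space k \<Otimes>\<^sub>M borel)"
    and "\<And>h u. h \<in> space (history_space k) \<Longrightarrow> 0 \<le> \<pi> k h u"
    and "\<And>h. h \<in> space (history_space k) \<Longrightarrow> (\<integral>\<^sup>+u. ennreal (\<pi> k h u) \<partial>lborel) = 1"
  using assms by (auto simp: is_policy_def)

lemma policy_measurable: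
  assumes "is_policy N \<pi>" "k < N"
  shows "(\<lambda>(h, u). \<pi> k h u) \<in> borel_measurable (history_law A B \<Sigma>0 \<pi>' k \<Otimes>\<^sub>M lborel)"
proof -
  have "sets (history_law A B \<Sigma>0 \<pi>' k \<Otimes>\<^sub>M lborel) = sets (history_space k \<Otimes>\<^sub>M borel)"
    by (intro sets_pair_measure_cong sets_history_law) simp
  then show ?thesis using is_policyD(1)[OF assms] by (simp cong: measurable_cong_sets)
qed

lemma nn_integral_history_law_Suc:
  assumes \<pi>: "is_policy N \<pi>" and k: "k < N"
    and f [measurable]: "f \<in> borel_measurable (history_space (Suc k))"
  shows "(\<integral>\<^sup>+\<omega>. f \<omega> \<partial>history_law A B \<Sigma>0 \<pi> (Suc k))
    = (\<integral>\<^sup>+h. \<integral>\<^sup>+v. ennreal (\<pi> k h v) * f (extend A B k h v) \<partial>lborel \<partial>history_law A B \<Sigma>0 \<pi> k)"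
proof -
  let ?M = "history_law A B \<Sigma>0 \<pi> k"
  have sets: "sets (?M \<Otimes>\<^sub>M lborel) = sets (history_space k \<Otimes>\<^sub>M borel)"
    by (intro sets_pair_measure_cong sets_history_law) simp
  have e: "(\<lambda>(h, v). extend A B k h v) \<in> ?M \<Otimes>\<^sub>M lborel \<rightarrow>\<^sub>M history_space (Suc k)"
    using measurable_extend[of A B k] by (simp cong: measurable_cong_sets add: sets)
  note p = policy_measurable[OF \<pi> k, of A B \<Sigma>0 \<pi>]
  have fe: "(\<lambda>(h, v). f (extend A B k h v)) \<in> borel_measurable (?M \<Otimes>\<^sub>M lborel)"
    using measurable_compose[OF e f] by (simp add: case_prod_unfold)
  have pe: "(\<lambda>(h, v). ennreal (\<pi> k h v)) \<in> borel_measurable (?M \<Otimes>\<^sub>M lborel)"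
    using measurable_compose[OF p measurable_ennreal] by (simp add: case_prod_unfold)
  have "(\<integral>\<^sup>+\<omega>. f \<omega> \<partial>history_law A B \<Sigma>0 \<pi> (Suc k))
    = (\<integral>\<^sup>+y. f ((\<lambda>(h, v). extend A B k h v) y) \<partial>density (?M \<Otimes>\<^sub>M lborel) (\<lambda>(h, v). ennreal (\<pi> k h v)))"
    unfolding history_law_Suc by (rule nn_integral_distr) (use e in auto)
  also have "\<dots> = (\<integral>\<^sup>+y. (\<lambda>(h, v). ennreal (\<pi> k h v) * f (extend A B k h v)) y \<partial>(?M \<Otimes>\<^sub>M lborel))"
    by (subst nn_integral_density[OF pe]) (use fe in \<open>auto simp: case_prod_unfold\<close>)
  also have "\<dots> = (\<integral>\<^sup>+h. \<integral>\<^sup>+v. ennreal (\<pi> k h v) * f (extend A B k h v) \<partial>lborel \<partial>?M)"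
    by (subst lborel.nn_integral_fst[symmetric]) (use pe fe in \<open>auto simp: case_prod_unfold\<close>)
  finally show ?thesis .
qed

lemma nn_integral_history_law_0:
  assumes f [measurable]: "f \<in> borel_measurable (history_space 0)"
  shows "(\<integral>\<^sup>+\<omega>. f \<omega> \<partial>history_law A B \<Sigma>0 \<pi> 0)
    = (\<integral>\<^sup>+x0. f (\<lambda>i\<in>{..0}. x0, \<lambda>i\<in>{..<0}. 0) \<partial>gaussian 0 \<Sigma>0)"
proof -
  have "(\<lambda>x0. (\<lambda>i\<in>{..0}. x0, \<lambda>i\<in>{..<0}. 0)) \<in> gaussian 0 \<Sigma>0 \<rightarrow>\<^sub>M (history_space 0 :: ('a, 'b) history measure)"
    unfolding history_space_def
    by (intro measurable_Pair measurable_restrict) (auto simp: gaussian_def)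
  then show ?thesis using f by (simp add: nn_integral_distr)
qed

lemma measurable_history_upto:
  assumes "j \<le> k"
  shows "history_upto j \<in> history_space k \<rightarrow>\<^sub>M history_space j"
proof -
  have "(\<lambda>h. restrict (fst h) {..j}) \<in> history_space k \<rightarrow>\<^sub>M PiM {..j} (\<lambda>_. borel)"
    unfolding history_space_def using assms
    by (intro measurable_compose[OF measurable_fst measurable_restrict_subset]) auto
  moreover have "(\<lambda>h. restrict (snd h) {..<j}) \<in> history_space k \<rightarrow>\<^sub>M PiM {..<j} (\<lambda>_. borel)"
    unfolding history_space_def using assms
    by (intro measurable_compose[OF measurable_snd measurable_restrict_subset]) auto
  ultimately show ?thesis
    unfolding history_upto_def history_space_def[of j] case_prod_unfold by (rule measurable_Pair)
qed

lemma history_upto_extend: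
  assumes "j \<le> k"
  shows "history_upto j (extend A B k h v) = history_upto j h"
  using assms by (auto simp: history_upto_def extend_def case_prod_unfold restrict_def fun_eq_iff)

lemma history_upto_self:
  assumes "h \<in> space (history_space k)"
  shows "history_upto k h = h"
  using assms by (auto simp: history_upto_def history_space_def space_pair_measure space_PiM PiE_def
      extensional_restrict)

lemma extend_state: "j \<le> k \<Longrightarrow> fst (extend A B k h v) j = fst h j"
  "fst (extend A B k h v) (Suc k) = A k *v fst h k + B k *v v"
  "j < k \<Longrightarrow> snd (extend A B k h v) j = snd h j" "snd (extend A B k h v) k = v"
  by (auto simp: extend_def)

lemma prob_space_history_law:
  assumes pd: "pd \<Sigma>0" and \<pi>: "is_policy N \<pi>"
  shows "k \<le> N \<Longrightarrow> prob_space (history_law A B \<Sigma>0 \<pi> k)"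
proof (induction k)
  case 0
  have "(\<integral>\<^sup>+\<omega>. 1 \<partial>history_law A B \<Sigma>0 \<pi> 0) = 1"
    using prob_space.emeasure_space_1[OF prob_space_gaussian[OF pd, of 0]]
    by (subst nn_integral_history_law_0) auto
  then show ?case by (intro prob_spaceI) simp
next
  case (Suc k)
  then interpret prob_space "history_law A B \<Sigma>0 \<pi> k" by simp
  have "(\<integral>\<^sup>+\<omega>. 1 \<partial>history_law A B \<Sigma>0 \<pi> (Suc k))
      = (\<integral>\<^sup>+h. \<integral>\<^sup>+v. ennreal (\<pi> k h v) * 1 \<partial>lborel \<partial>history_law A B \<Sigma>0 \<pi> k)"
    by (rule nn_integral_history_law_Suc[OF \<pi>]) (use Suc in auto)
  also have "\<dots> = (\<integral>\<^sup>+h. 1 \<partial>history_law A B \<Sigma>0 \<pi> k)"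
    using is_policyD(3)[OF \<pi>, of k] Suc.prems by (intro nn_integral_cong) (simp add: space_history_law)
  also have "\<dots> = 1" by (simp add: emeasure_space_1)
  finally show ?case by (intro prob_spaceI) simp
qed

section \<open>The cost of a policy\<close>

lemma inner_block_quadratic:
  assumes "transpose S' = St"
  shows "block_vector x u \<bullet> (block_matrix Q S' St R *v block_vector x u)
    = x \<bullet> (Q *v x) + 2 * (u \<bullet> (St *v x)) + u \<bullet> (R *v u)"
proof -
  have "x \<bullet> (S' *v u) = u \<bullet> (St *v x)"
    using inner_matrix_vector_right[of x S' u] assms by (simp add: inner_commute)
  then show ?thesis
    by (simp add: block_matrix_vector_mult inner_block_vector inner_add_right)
qed

text \<open>
  The assumption \<open>terminal\<close> is the quadratic equation solved in \<open>terminal_equation\<close>; it makes the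
  terminal covariance of the closed loop equal to \<open>\<Sigma>N\<close>.
\<close>

locale maxent_control = riccati_lq_system N "Abar A B S R" "Qbar Q S R" B R P Z
  for N :: nat and A Q :: "nat \<Rightarrow> real^'n^'n" and B S :: "nat \<Rightarrow> real^'m^'n"
    and R :: "nat \<Rightarrow> real^'m^'m" and P :: "nat \<Rightarrow> real^'n^'n" and Z :: "real^'n^'n" +
  fixes \<epsilon> :: real and \<Sigma>0 \<Sigma>N :: "real^'n^'n"
  assumes eps: "0 < \<epsilon>" and pd\<Sigma>0: "pd \<Sigma>0" and pd\<Sigma>N: "pd \<Sigma>N"
    and terminal: "Z ** \<Sigma>N ** Z = \<epsilon> *\<^sub>R Z + matrix_inv \<phi>12 ** \<Sigma>0 ** transpose (matrix_inv \<phi>12)"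
begin

definition "Kt k = matrix_inv (Rh k) ** (transpose (B k) ** P (Suc k) ** A k + transpose (S k))"
definition "W k = \<epsilon> *\<^sub>R matrix_inv (Rh k)"
definition "\<kappa> k = gaussian_const (W k)"

definition opt :: "('n, 'm) policy" where
  "opt k h u = gaussian_density (- (Kt k *v fst h k)) (W k) u"

definition stage :: "nat \<Rightarrow> real^'n \<Rightarrow> real^'m \<Rightarrow> real" where
  "stage k x u = 1 / 2 * (block_vector x u
     \<bullet> (block_matrix (Q k) (S k) (transpose (S k)) (R k) *v block_vector x u))"

text \<open>
  Up to an additive constant, \<open>- \<epsilon>\<close> times the logarithm of the density \<open>opt\<close>; see \<open>ln_opt\<close>.
\<close>

definition excess :: "nat \<Rightarrow> ('n, 'm) history \<Rightarrow> real^'m \<Rightarrow> real" where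
  "excess k h v = 1 / 2 * ((v + Kt k *v fst h k) \<bullet> (Rh k *v (v + Kt k *v fst h k)))"

text \<open>
  The constant \<open>\<epsilon> ln (\<kappa> k)\<close> is subtracted so that adding the mean of \<open>excess\<close> gives exactly \<open>\<epsilon>\<close>
  times the relative entropy.
\<close>

definition entropy_term :: "('n, 'm) policy \<Rightarrow> nat \<Rightarrow> ('n, 'm) history \<Rightarrow> real" where
  "entropy_term \<pi> k h = - \<epsilon> * diff_entropy (\<pi> k h) - \<epsilon> * ln (\<kappa> k)"

text \<open>
  The cost accumulated before time \<open>k\<close>, normalised as in \<open>entropy_term\<close>, plus the quadratic
  function of the current state given by \<open>P k\<close>.
\<close>

definition val :: "('n, 'm) policy \<Rightarrow> nat \<Rightarrow> ('n, 'm) history \<Rightarrow> real" where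
  "val \<pi> k \<omega> = (\<Sum>j<k. stage j (fst \<omega> j) (snd \<omega> j) + entropy_term \<pi> j (history_upto j \<omega>))
     + 1 / 2 * (fst \<omega> k \<bullet> (P k *v fst \<omega> k))"

definition mean_excess :: "('n, 'm) policy \<Rightarrow> nat \<Rightarrow> ('n, 'm) history \<Rightarrow> ennreal" where
  "mean_excess \<pi> k h = (\<integral>\<^sup>+v. ennreal (\<pi> k h v) * ennreal (excess k h v) \<partial>lborel)"

text \<open>
  \<open>\<epsilon>\<close> times the relative entropy of \<open>\<pi> k h\<close> with respect to \<open>opt k h\<close>, when the
  entropy and the mean of \<open>excess\<close> are finite.
\<close>

definition kl :: "('n, 'm) policy \<Rightarrow> nat \<Rightarrow> ('n, 'm) history \<Rightarrow> real" where
  "kl \<pi> k h = enn2real (mean_excess \<pi> k h) + entropy_term \<pi> k h"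

abbreviation "law \<pi> k \<equiv> history_law A B \<Sigma>0 \<pi> k"

text \<open>
  The feedback for the original data is that for the transformed data preceded by the shift
  \<open>u \<mapsto> u + R\<^sup>-\<^sup>1 S\<^sup>T x\<close> that absorbs the cross terms.
\<close>

lemma Kt_eq:
  assumes k: "k < N"
  shows "Kt k *v x = matrix_inv (R k) *v (transpose (S k) *v x) + K k *v x"
proof -
  define g where "g = matrix_inv (R k) *v (transpose (S k) *v x)"
  define t where "t = transpose (B k) *v (P (Suc k) *v (B k *v g))"
  define y where "y = transpose (B k) *v (P (Suc k) *v (A k *v x))"
  have "R k *v g = transpose (S k) *v x"
    by (simp add: g_def matrix_inv_vector_right pd_invertible pdR k)
  then have "Rh k *v g = transpose (S k) *v x + t"
    by (simp add: Rh_def t_def matrix_vector_mult_add_rdistrib flip: matrix_vector_mul_assoc)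
  then have g: "g = matrix_inv (Rh k) *v (transpose (S k) *v x + t)"
    by (metis matrix_inv_vector_left pd_invertible pd_Rh k)
  have "Abar A B S R k *v x = A k *v x - B k *v g"
    by (simp add: Abar_def g_def matrix_vector_mult_diff_rdistrib flip: matrix_vector_mul_assoc)
  then have Kx: "K k *v x = matrix_inv (Rh k) *v (y - t)"
    by (simp add: K_def y_def t_def matrix_vector_mult_diff_distrib flip: matrix_vector_mul_assoc)
  have "g + K k *v x = matrix_inv (Rh k) *v ((transpose (S k) *v x + t) + (y - t))"
    unfolding Kx by (subst g) (simp only: matrix_vector_right_distrib)
  also have "\<dots> = Kt k *v x"
    by (simp add: Kt_def y_def matrix_vector_mult_add_rdistrib add.commute flip: matrix_vector_mul_assoc)
  finally show ?thesis by (simp add: g_def)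
qed

lemma closed_loop_drift:
  assumes "k < N"
  shows "A k *v x - B k *v (Kt k *v x) = F k *v x"
  by (simp add: Kt_eq assms F_def Abar_def matrix_vector_mult_diff_rdistrib matrix_vector_right_distrib
      algebra_simps flip: matrix_vector_mul_assoc)

lemma stage_complete_square:
  assumes k: "k < N"
  shows "stage k x u + 1 / 2 * ((A k *v x + B k *v u) \<bullet> (P (Suc k) *v (A k *v x + B k *v u)))
    = 1 / 2 * (x \<bullet> (P k *v x)) + 1 / 2 * ((u + Kt k *v x) \<bullet> (Rh k *v (u + Kt k *v x)))"
proof -
  define s where "s = transpose (S k) *v x"
  define g where "g = matrix_inv (R k) *v s"
  define v where "v = u + g"
  have Rg: "R k *v g = s" by (simp add: g_def matrix_inv_vector_right pd_invertible pdR k)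
  have "A k *v x + B k *v u = Abar A B S R k *v x + B k *v v"
    by (simp add: Abar_def v_def g_def s_def matrix_vector_mult_diff_rdistrib matrix_vector_right_distrib
        flip: matrix_vector_mul_assoc)
  moreover have "u + Kt k *v x = v + K k *v x"
    by (simp add: Kt_eq k v_def g_def s_def add.assoc)
  moreover have "stage k x u = 1 / 2 * (x \<bullet> (Qbar Q S R k *v x) + v \<bullet> (R k *v v))"
  proof -
    have "x \<bullet> (Qbar Q S R k *v x) = x \<bullet> (Q k *v x) - s \<bullet> g"
      by (simp add: Qbar_def matrix_vector_mult_diff_rdistrib inner_diff_right s_def g_def
          inner_matrix_vector_right[of x "S k"] flip: matrix_vector_mul_assoc)
    moreover have "v \<bullet> (R k *v v) = u \<bullet> (R k *v u) + 2 * (u \<bullet> s) + s \<bullet> g"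
      using inner_symmetric_weights(2)[OF k, of g u]
      by (simp add: v_def matrix_vector_right_distrib inner_add_left inner_add_right Rg inner_commute[of g s])
    ultimately show ?thesis
      by (simp add: stage_def inner_block_quadratic s_def)
  qed
  ultimately show ?thesis
    using complete_square[OF k, of x v] by (simp add: field_simps)
qed

lemma pd_W: "k < N \<Longrightarrow> pd (W k)"
  by (simp add: W_def pd_scaleR pd_matrix_inv pd_Rh eps)

lemma matrix_inv_W: "k < N \<Longrightarrow> matrix_inv (W k) = (1 / \<epsilon>) *\<^sub>R Rh k"
  using eps by (simp add: W_def matrix_inv_scaleR invertible_matrix_inv matrix_inv_matrix_inv
      pd_invertible pd_Rh)

lemma \<kappa>_pos: "k < N \<Longrightarrow> 0 < \<kappa> k"
  by (simp add: \<kappa>_def gaussian_const_pos pd_W)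

lemma excess_nonneg: "k < N \<Longrightarrow> 0 \<le> excess k h v"
  by (simp add: excess_def pd_nonneg pd_Rh)

lemma opt_pos: "k < N \<Longrightarrow> 0 < opt k h u"
  by (simp add: opt_def gaussian_density_pos pd_W)

lemma ln_opt:
  assumes "k < N"
  shows "ln (opt k h u) = ln (\<kappa> k) - excess k h u / \<epsilon>"
proof -
  have "opt k h u = \<kappa> k * exp (- excess k h u / \<epsilon>)"
    by (simp add: opt_def gaussian_density_eq matrix_inv_W assms excess_def scaleR_matrix_vector \<kappa>_def)
  then show ?thesis using \<kappa>_pos[OF assms] by (simp add: ln_mult)
qed

lemma integrable_opt: "k < N \<Longrightarrow> integrable lborel (opt k h)"
  and integral_opt: "k < N \<Longrightarrow> (\<integral>u. opt k h u \<partial>lborel) = 1"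
  by (auto simp: opt_def[abs_def] integrable_gaussian_density integral_gaussian_density pd_W)

lemma measurable_excess:
  assumes "f \<in> L \<rightarrow>\<^sub>M history_space k" "g \<in> borel_measurable L"
  shows "(\<lambda>y. excess k (f y) (g y)) \<in> borel_measurable L"
proof -
  note [measurable] = measurable_history_state[OF assms(1) order.refl] assms(2)
  show ?thesis unfolding excess_def by measurable
qed

lemma measurable_stage:
  assumes [measurable]: "f \<in> borel_measurable L" "g \<in> borel_measurable L"
  shows "(\<lambda>y. stage k (f y) (g y)) \<in> borel_measurable L"
  unfolding stage_def by (subst inner_block_quadratic[OF refl]) measurable

lemma measurable_entropy_term:
  assumes \<pi>: "is_policy N \<pi>" and k: "k < N"
  shows "entropy_term \<pi> k \<in> borel_measurable (history_space k)"
proof -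
  have "sets (history_space k \<Otimes>\<^sub>M lborel) = sets (history_space k \<Otimes>\<^sub>M borel)"
    by (intro sets_pair_measure_cong) auto
  then have [measurable]: "(\<lambda>(h, u). \<pi> k h u) \<in> borel_measurable (history_space k \<Otimes>\<^sub>M lborel)"
    using is_policyD(1)[OF \<pi> k] by (simp cong: measurable_cong_sets)
  have "(\<lambda>h. \<integral>u. \<pi> k h u * ln (\<pi> k h u) \<partial>lborel) \<in> borel_measurable (history_space k)"
    by measurable
  then show ?thesis unfolding entropy_term_def diff_entropy_def by measurable
qed

lemma measurable_val:
  assumes \<pi>: "is_policy N \<pi>" and k: "k \<le> N"
  shows "val \<pi> k \<in> borel_measurable (history_space k)"
  unfolding val_def
proof (intro borel_measurable_add borel_measurable_sum)
  fix j assume "j \<in> {..<k}"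
  then have j: "j < k" by simp
  show "(\<lambda>\<omega>. stage j (fst \<omega> j) (snd \<omega> j)) \<in> borel_measurable (history_space k)"
    by (intro measurable_stage measurable_history_state[OF measurable_ident_sets[OF refl]]
        measurable_history_input[OF measurable_ident_sets[OF refl]]) (use j in auto)
  show "(\<lambda>\<omega>. entropy_term \<pi> j (history_upto j \<omega>)) \<in> borel_measurable (history_space k)"
    by (rule measurable_compose[OF measurable_history_upto measurable_entropy_term[OF \<pi>]])
       (use j k in auto)
next
  note [measurable] = measurable_history_state[OF measurable_ident_sets[OF refl] order.refl, of k]
  show "(\<lambda>\<omega>. 1 / 2 * (fst \<omega> k \<bullet> (P k *v fst \<omega> k))) \<in> borel_measurable (history_space k)"
    by measurable
qed

lemma val_extend:
  assumes k: "k < N" and h: "h \<in> space (history_space k)"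
  shows "val \<pi> (Suc k) (extend A B k h v) = val \<pi> k h + entropy_term \<pi> k h + excess k h v"
proof -
  have "(\<Sum>j<k. stage j (fst (extend A B k h v) j) (snd (extend A B k h v) j)
        + entropy_term \<pi> j (history_upto j (extend A B k h v)))
      = (\<Sum>j<k. stage j (fst h j) (snd h j) + entropy_term \<pi> j (history_upto j h))"
    by (intro sum.cong refl) (simp add: extend_state history_upto_extend)
  moreover have "entropy_term \<pi> k (history_upto k (extend A B k h v)) = entropy_term \<pi> k h"
    by (simp add: history_upto_extend history_upto_self h)
  ultimately show ?thesis
    using stage_complete_square[OF k, of "fst h k" v]
    by (simp add: val_def extend_state excess_def)
qed

lemma controlled_step_history:
  assumes \<pi>: "is_policy N \<pi>" and k: "k < N"
  shows "controlled_step (law \<pi> k) (law \<pi> (Suc k)) (\<pi> k) (excess k) (extend A B k)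
    (val \<pi> k) (entropy_term \<pi> k) (val \<pi> (Suc k))"
proof
  note sets = measurable_cong_sets[OF sets_history_law refl]
  show "(\<integral>\<^sup>+\<omega>. f \<omega> \<partial>law \<pi> (Suc k))
      = (\<integral>\<^sup>+h. \<integral>\<^sup>+v. ennreal (\<pi> k h v) * f (extend A B k h v) \<partial>lborel \<partial>law \<pi> k)"
    if "f \<in> borel_measurable (law \<pi> (Suc k))" for f
    using nn_integral_history_law_Suc[OF \<pi> k, of f A B \<Sigma>0] that by (simp only: sets)
  show "(\<lambda>(h, v). \<pi> k h v) \<in> borel_measurable (law \<pi> k \<Otimes>\<^sub>M lborel)"
    by (rule policy_measurable[OF \<pi> k])
  have "(\<lambda>y. excess k (fst y) (snd y)) \<in> borel_measurable (law \<pi> k \<Otimes>\<^sub>M lborel)"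
  proof (rule measurable_excess)
    show "fst \<in> law \<pi> k \<Otimes>\<^sub>M lborel \<rightarrow>\<^sub>M history_space k"
      using measurable_fst[of "law \<pi> k" lborel] by (simp cong: measurable_cong_sets add: sets_history_law)
  qed measurable
  then show "(\<lambda>(h, v). excess k h v) \<in> borel_measurable (law \<pi> k \<Otimes>\<^sub>M lborel)"
    by (simp add: case_prod_unfold)
  show "val \<pi> k \<in> borel_measurable (law \<pi> k)" "val \<pi> (Suc k) \<in> borel_measurable (law \<pi> (Suc k))"
    "entropy_term \<pi> k \<in> borel_measurable (law \<pi> k)"
    unfolding sets using measurable_val[OF \<pi>] measurable_entropy_term[OF \<pi>] k by auto
  show "(\<integral>\<^sup>+v. ennreal (\<pi> k h v) \<partial>lborel) = 1" if "h \<in> space (law \<pi> k)" for h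
    using is_policyD(3)[OF \<pi> k] that by (simp add: space_history_law)
  show "0 \<le> excess k h v" for h v by (rule excess_nonneg[OF k])
  show "val \<pi> (Suc k) (extend A B k h v) = val \<pi> k h + entropy_term \<pi> k h + excess k h v"
    if "h \<in> space (law \<pi> k)" for h v
    using val_extend[OF k] that by (simp add: space_history_law)
qed

lemma policy_section:
  assumes \<pi>: "is_policy N \<pi>" and k: "k < N" and h: "h \<in> space (history_space k)"
  shows "\<pi> k h \<in> borel_measurable borel" "integrable lborel (\<pi> k h)" "(\<integral>u. \<pi> k h u \<partial>lborel) = 1"
proof -
  show m [measurable]: "\<pi> k h \<in> borel_measurable borel"
    using measurable_compose[OF measurable_Pair1'[OF h] is_policyD(1)[OF \<pi> k]] by simp
  note p = is_policyD(2,3)[OF \<pi> k h]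
  show "integrable lborel (\<pi> k h)"
    by (rule integrableI_nonneg) (use p in auto)
  show "(\<integral>u. \<pi> k h u \<partial>lborel) = 1"
    by (subst integral_eq_nn_integral) (use p in auto)
qed

lemma measurable_excess_section:
  assumes "h \<in> space (history_space k)"
  shows "excess k h \<in> borel_measurable borel"
  using assms by (intro measurable_excess) auto

text \<open>
  If the mean of \<open>excess\<close> is finite, then \<open>ln (opt k h)\<close> is integrable with respect to \<open>\<pi> k h\<close>, and
  both claims are the two parts of Gibbs' inequality; the first claim is trivial otherwise.
\<close>

lemma kl_is_relative_entropy:
  assumes \<pi>: "is_policy N \<pi>" and k: "k < N" and h: "h \<in> space (history_space k)"
    and ent: "integrable lborel (\<lambda>u. \<pi> k h u * ln (\<pi> k h u))"
  shows "ennreal (- entropy_term \<pi> k h) \<le> mean_excess \<pi> k h"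
    and "mean_excess \<pi> k h < \<infinity> \<Longrightarrow> kl \<pi> k h = 0 \<Longrightarrow> AE u in lborel. \<pi> k h u = opt k h u"
proof -
  note sec = policy_section[OF \<pi> k h]
  note [measurable] = sec(1) measurable_excess_section[OF h]
  note nn = is_policyD(2)[OF \<pi> k h]
  have fin: "entropy_term \<pi> k h + enn2real (mean_excess \<pi> k h) \<ge> 0 \<and>
    (entropy_term \<pi> k h + enn2real (mean_excess \<pi> k h) = 0 \<longrightarrow> (AE u in lborel. \<pi> k h u = opt k h u))"
    if "mean_excess \<pi> k h < \<infinity>"
  proof -
    have me: "mean_excess \<pi> k h = (\<integral>\<^sup>+v. ennreal (\<pi> k h v * excess k h v) \<partial>lborel)"
      unfolding mean_excess_def using nn excess_nonneg[OF k] by (intro nn_integral_cong) (simp add: ennreal_mult)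
    have ie: "integrable lborel (\<lambda>v. \<pi> k h v * excess k h v)"
      by (rule integrableI_nonneg) (use that nn excess_nonneg[OF k] in \<open>auto simp: me\<close>)
    have ve: "enn2real (mean_excess \<pi> k h) = (\<integral>v. \<pi> k h v * excess k h v \<partial>lborel)"
      unfolding me by (rule integral_eq_nn_integral[symmetric]) (use nn excess_nonneg[OF k] in auto)
    have lnopt: "\<pi> k h u * ln (opt k h u) = ln (\<kappa> k) * \<pi> k h u - (\<pi> k h u * excess k h u) / \<epsilon>" for u
      by (simp add: ln_opt[OF k] algebra_simps)
    have il: "integrable lborel (\<lambda>u. \<pi> k h u * ln (opt k h u))"
      unfolding lnopt using sec(2) ie by simp
    have vl: "(\<integral>u. \<pi> k h u * ln (opt k h u) \<partial>lborel) = ln (\<kappa> k) - enn2real (mean_excess \<pi> k h) / \<epsilon>"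
      unfolding lnopt ve using sec ie by simp
    have et: "entropy_term \<pi> k h = \<epsilon> * (\<integral>u. \<pi> k h u * ln (\<pi> k h u) \<partial>lborel) - \<epsilon> * ln (\<kappa> k)"
      by (simp add: entropy_term_def diff_entropy_def)
    have diff: "entropy_term \<pi> k h + enn2real (mean_excess \<pi> k h)
      = \<epsilon> * ((\<integral>u. \<pi> k h u * ln (\<pi> k h u) \<partial>lborel) - (\<integral>u. \<pi> k h u * ln (opt k h u) \<partial>lborel))"
      using eps by (simp add: et vl field_simps)
    note gibbs = gibbs_inequality[OF sec(2) nn sec(3) integrable_opt[OF k] opt_pos[OF k] integral_opt[OF k] ent il]
    show ?thesis unfolding diff using gibbs eps by auto
  qed
  show "ennreal (- entropy_term \<pi> k h) \<le> mean_excess \<pi> k h"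
  proof (cases "mean_excess \<pi> k h")
    case (real r)
    then show ?thesis using fin by (simp add: ennreal_leI)
  qed simp
  show "AE u in lborel. \<pi> k h u = opt k h u" if "mean_excess \<pi> k h < \<infinity>" "kl \<pi> k h = 0"
    using fin[OF that(1)] that(2) by (simp add: kl_def add.commute)
qed

definition "entropies_finite \<pi> \<longleftrightarrow>
  (\<forall>k<N. AE h in law \<pi> k. integrable lborel (\<lambda>u. \<pi> k h u * ln (\<pi> k h u)))"

definition "initial_value = (\<integral>x. 1 / 2 * (x \<bullet> (P 0 *v x)) \<partial>gaussian 0 \<Sigma>0)"
definition "terminal_value = (\<integral>x. 1 / 2 * (x \<bullet> (P N *v x)) \<partial>gaussian 0 \<Sigma>N)"
definition "optimal_cost = initial_value - terminal_value + (\<Sum>k<N. \<epsilon> * ln (\<kappa> k))"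

lemma entropy_excess_AE:
  assumes \<pi>: "is_policy N \<pi>" and fin: "entropies_finite \<pi>" and k: "k < N"
  shows "AE h in law \<pi> k. ennreal (- entropy_term \<pi> k h) \<le> mean_excess \<pi> k h"
proof -
  have "AE h in law \<pi> k. h \<in> space (law \<pi> k)" by simp
  moreover have "AE h in law \<pi> k. integrable lborel (\<lambda>u. \<pi> k h u * ln (\<pi> k h u))"
    using fin k by (simp add: entropies_finite_def)
  ultimately show ?thesis
    by eventually_elim (rule kl_is_relative_entropy(1)[OF \<pi> k], simp_all add: space_history_law)
qed

lemma val_0_integrable: "integrable (law \<pi> 0) (val \<pi> 0)"
  and val_0_integral: "(\<integral>\<omega>. val \<pi> 0 \<omega> \<partial>law \<pi> 0) = initial_value"
proof -
  have m: "(\<lambda>x0. (\<lambda>i\<in>{..0}. x0, \<lambda>i\<in>{..<0}. 0)) \<in> gaussian 0 \<Sigma>0 \<rightarrow>\<^sub>M (history_space 0 :: ('n, 'm) history measure)"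
    unfolding history_space_def
    by (intro measurable_Pair measurable_restrict) (auto simp: gaussian_def)
  have v: "val \<pi> 0 = (\<lambda>\<omega>. 1 / 2 * (fst \<omega> 0 \<bullet> (P 0 *v fst \<omega> 0)))" by (simp add: val_def fun_eq_iff)
  note [measurable] = measurable_history_state[OF measurable_ident_sets[OF refl] order.refl, of 0]
  have vm: "val \<pi> 0 \<in> borel_measurable (history_space 0)" unfolding v by measurable
  show "integrable (law \<pi> 0) (val \<pi> 0)"
    using integrable_gaussian_quadratic_form[OF pd\<Sigma>0, of "P 0"]
    unfolding history_law.simps(1) integrable_distr_eq[OF m vm] by (simp add: v)
  show "(\<integral>\<omega>. val \<pi> 0 \<omega> \<partial>law \<pi> 0) = initial_value"
    unfolding history_law.simps(1) integral_distr[OF m vm] by (simp add: v initial_value_def)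
qed

text \<open>
  Going backwards from time \<open>N\<close>, the positive parts of all \<open>val \<pi> k\<close> have finite mean. At time \<open>0\<close>
  the value is a quadratic function of a Gaussian vector, hence integrable; going forwards,
  each step then preserves integrability and adds the mean of \<open>kl\<close>.
\<close>

lemma val_expectation:
  assumes \<pi>: "is_policy N \<pi>" and ent: "entropies_finite \<pi>"
    and fin: "(\<integral>\<^sup>+\<omega>. ennreal (val \<pi> N \<omega>) \<partial>law \<pi> N) < \<infinity>"
  shows "k \<le> N \<Longrightarrow> integrable (law \<pi> k) (val \<pi> k) \<and>
      (\<integral>\<omega>. val \<pi> k \<omega> \<partial>law \<pi> k) = initial_value + (\<Sum>j<k. \<integral>h. kl \<pi> j h \<partial>law \<pi> j)" (is "_ \<Longrightarrow> ?T k")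
    and "k < N \<Longrightarrow> integrable (law \<pi> k) (kl \<pi> k) \<and> (AE h in law \<pi> k. 0 \<le> kl \<pi> k h) \<and>
      (AE h in law \<pi> k. mean_excess \<pi> k h < \<infinity>)" (is "_ \<Longrightarrow> ?G k")
proof -
  have pos: "(\<integral>\<^sup>+\<omega>. ennreal (val \<pi> k \<omega>) \<partial>law \<pi> k) < \<infinity>" if "k \<le> N" for k
    using that
  proof (induction k rule: inc_induct)
    case (step k)
    interpret st: controlled_step "law \<pi> k" "law \<pi> (Suc k)" "\<pi> k" "excess k" "extend A B k"
      "val \<pi> k" "entropy_term \<pi> k" "val \<pi> (Suc k)"
      by (rule controlled_step_history[OF \<pi> \<open>k < N\<close>])
    have "AE h in law \<pi> k. ennreal (- entropy_term \<pi> k h) \<le> st.m h"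
      using entropy_excess_AE[OF \<pi> ent \<open>k < N\<close>] by (simp add: mean_excess_def st.m_def)
    then show ?case using step.IH by (rule st.positive_part_backward(1))
  qed (rule fin)
  have step: "integrable (law \<pi> (Suc k)) (val \<pi> (Suc k)) \<and>
      (\<integral>\<omega>. val \<pi> (Suc k) \<omega> \<partial>law \<pi> (Suc k)) = (\<integral>\<omega>. val \<pi> k \<omega> \<partial>law \<pi> k) + (\<integral>h. kl \<pi> k h \<partial>law \<pi> k) \<and> ?G k"
    if k: "k < N" and a: "integrable (law \<pi> k) (val \<pi> k)" for k
  proof -
    interpret st: controlled_step "law \<pi> k" "law \<pi> (Suc k)" "\<pi> k" "excess k" "extend A B k"
      "val \<pi> k" "entropy_term \<pi> k" "val \<pi> (Suc k)"
      by (rule controlled_step_history[OF \<pi> \<open>k < N\<close>])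
    have m: "st.m = mean_excess \<pi> k" by (simp add: fun_eq_iff mean_excess_def st.m_def)
    have g: "st.gain = kl \<pi> k" by (simp add: fun_eq_iff kl_def st.gain_def m)
    have ge: "AE h in law \<pi> k. ennreal (- entropy_term \<pi> k h) \<le> st.m h"
      using entropy_excess_AE[OF \<pi> ent \<open>k < N\<close>] by (simp add: m)
    have p: "(\<integral>\<^sup>+\<omega>. ennreal (val \<pi> (Suc k) \<omega>) \<partial>law \<pi> (Suc k)) < \<infinity>" using pos[of "Suc k"] k by simp
    show ?thesis
      using st.expectation_forward[OF ge p a] st.positive_part_backward(2)[OF ge p]
      unfolding g m by blast
  qed
  have T: "?T k" if "k \<le> N" for k
    using that
  proof (induction k)
    case 0 show ?case using val_0_integrable val_0_integral by simp
  next
    case (Suc k)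
    then show ?case using step[of k] by simp
  qed
  then show "k \<le> N \<Longrightarrow> ?T k" .
  show "?G k" if "k < N" using step[OF that] T[of k] that by simp
qed

lemma running_cost_val:
  "running_cost \<epsilon> N Q S R \<pi> \<omega>
     = val \<pi> N \<omega> + (\<Sum>k<N. \<epsilon> * ln (\<kappa> k)) - 1 / 2 * (fst \<omega> N \<bullet> (P N *v fst \<omega> N))"
  by (cases \<omega>) (simp add: running_cost_def val_def stage_def entropy_term_def sum.distrib sum_subtractf sum_negf)

lemma terminal_integrable:
  assumes "feasible N A B \<Sigma>0 \<Sigma>N \<pi>"
  shows "integrable (law \<pi> N) (\<lambda>\<omega>. 1 / 2 * (fst \<omega> N \<bullet> (P N *v fst \<omega> N)))"
    and "(\<integral>\<omega>. 1 / 2 * (fst \<omega> N \<bullet> (P N *v fst \<omega> N)) \<partial>law \<pi> N) = terminal_value"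
proof -
  have law: "distr (law \<pi> N) borel (\<lambda>\<omega>. fst \<omega> N) = gaussian 0 \<Sigma>N"
    using assms by (simp add: feasible_def case_prod_unfold)
  have m: "(\<lambda>\<omega>. fst \<omega> N) \<in> borel_measurable (law \<pi> N)"
    by (rule measurable_history_state[OF _ order.refl]) (simp add: measurable_ident_sets sets_history_law)
  have f: "(\<lambda>x. 1 / 2 * (x \<bullet> (P N *v x))) \<in> borel_measurable borel" by measurable
  show "integrable (law \<pi> N) (\<lambda>\<omega>. 1 / 2 * (fst \<omega> N \<bullet> (P N *v fst \<omega> N)))"
    using integrable_gaussian_quadratic_form[OF pd\<Sigma>N, of "P N"]
      integrable_distr_eq[OF m f] unfolding law by simp
  show "(\<integral>\<omega>. 1 / 2 * (fst \<omega> N \<bullet> (P N *v fst \<omega> N)) \<partial>law \<pi> N) = terminal_value"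
    using integral_distr[OF m f] unfolding law terminal_value_def by simp
qed

lemma maxent_cost_finite:
  assumes feas: "feasible N A B \<Sigma>0 \<Sigma>N \<pi>" and ent: "entropies_finite \<pi>"
    and fin: "(\<integral>\<^sup>+\<omega>. ennreal (val \<pi> N \<omega>) \<partial>law \<pi> N) < \<infinity>"
  shows "maxent_cost \<epsilon> N A B Q S R \<Sigma>0 \<pi>
    = ereal (optimal_cost + (\<Sum>k<N. \<integral>h. kl \<pi> k h \<partial>law \<pi> k))"
proof -
  have \<pi>: "is_policy N \<pi>" using feas by (simp add: feasible_def)
  interpret prob_space "law \<pi> N" by (rule prob_space_history_law[OF pd\<Sigma>0 \<pi>]) simp
  note v = val_expectation(1)[OF \<pi> ent fin, of N, OF order.refl]
  note t = terminal_integrable[OF feas]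
  have rc: "running_cost \<epsilon> N Q S R \<pi> = (\<lambda>\<omega>. val \<pi> N \<omega> + (\<Sum>k<N. \<epsilon> * ln (\<kappa> k)) - 1 / 2 * (fst \<omega> N \<bullet> (P N *v fst \<omega> N)))"
    by (simp add: fun_eq_iff running_cost_val)
  have int: "integrable (law \<pi> N) (running_cost \<epsilon> N Q S R \<pi>)"
    unfolding rc using v t by simp
  have val: "(\<integral>\<omega>. running_cost \<epsilon> N Q S R \<pi> \<omega> \<partial>law \<pi> N) = optimal_cost + (\<Sum>k<N. \<integral>h. kl \<pi> k h \<partial>law \<pi> k)"
    unfolding rc using v t by (simp add: optimal_cost_def prob_space)
  obtain r1 where r1: "(\<integral>\<^sup>+\<omega>. ennreal (running_cost \<epsilon> N Q S R \<pi> \<omega>) \<partial>law \<pi> N) = ennreal r1" "0 \<le> r1"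
    using int by (cases "\<integral>\<^sup>+\<omega>. ennreal (running_cost \<epsilon> N Q S R \<pi> \<omega>) \<partial>law \<pi> N") (auto simp: real_integrable_def)
  obtain r2 where r2: "(\<integral>\<^sup>+\<omega>. ennreal (- running_cost \<epsilon> N Q S R \<pi> \<omega>) \<partial>law \<pi> N) = ennreal r2" "0 \<le> r2"
    using int by (cases "\<integral>\<^sup>+\<omega>. ennreal (- running_cost \<epsilon> N Q S R \<pi> \<omega>) \<partial>law \<pi> N") (auto simp: real_integrable_def)
  have "r1 - r2 = (\<integral>\<omega>. running_cost \<epsilon> N Q S R \<pi> \<omega> \<partial>law \<pi> N)"
    unfolding real_lebesgue_integral_def[OF int] using r1 r2 by simp
  then show ?thesis
    using ent r1 r2 unfolding maxent_cost_def entropies_finite_def by (simp add: val)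
qed

text \<open>
  When the entropies are finite, the running cost and \<open>val \<pi> N\<close> differ by an integrable
  function, so their positive parts have infinite mean together; the cost is then \<open>\<infinity>\<close> whatever the mean of the negative part.
\<close>

lemma maxent_cost_infinite:
  assumes feas: "feasible N A B \<Sigma>0 \<Sigma>N \<pi>"
    and inf: "\<not> (entropies_finite \<pi> \<and> (\<integral>\<^sup>+\<omega>. ennreal (val \<pi> N \<omega>) \<partial>law \<pi> N) < \<infinity>)"
  shows "maxent_cost \<epsilon> N A B Q S R \<Sigma>0 \<pi> = \<infinity>"
proof (cases "entropies_finite \<pi>")
  case False
  then show ?thesis by (auto simp: maxent_cost_def entropies_finite_def)
next
  case True
  with inf have top: "(\<integral>\<^sup>+\<omega>. ennreal (val \<pi> N \<omega>) \<partial>law \<pi> N) = \<infinity>" by (auto simp: less_top[symmetric])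
  have \<pi>: "is_policy N \<pi>" using feas by (simp add: feasible_def)
  interpret prob_space "law \<pi> N" by (rule prob_space_history_law[OF pd\<Sigma>0 \<pi>]) simp
  define g where "g \<omega> = 1 / 2 * (fst \<omega> N \<bullet> (P N *v fst \<omega> N)) - (\<Sum>k<N. \<epsilon> * ln (\<kappa> k))" for \<omega> :: "('n, 'm) history"
  have g: "integrable (law \<pi> N) g"
    unfolding g_def using terminal_integrable(1)[OF feas] by simp
  have [measurable]: "val \<pi> N \<in> borel_measurable (law \<pi> N)"
    using measurable_val[OF \<pi>, of N] by (simp cong: measurable_cong_sets add: sets_history_law)
  have rc: "running_cost \<epsilon> N Q S R \<pi> = (\<lambda>\<omega>. val \<pi> N \<omega> - g \<omega>)"
    by (simp add: fun_eq_iff running_cost_val g_def)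
  have [measurable]: "g \<in> borel_measurable (law \<pi> N)" using g by simp
  have "(\<integral>\<^sup>+\<omega>. ennreal (val \<pi> N \<omega>) \<partial>law \<pi> N)
      \<le> (\<integral>\<^sup>+\<omega>. ennreal (running_cost \<epsilon> N Q S R \<pi> \<omega>) + ennreal \<bar>g \<omega>\<bar> \<partial>law \<pi> N)"
  proof (rule nn_integral_mono)
    fix \<omega>
    show "ennreal (val \<pi> N \<omega>) \<le> ennreal (running_cost \<epsilon> N Q S R \<pi> \<omega>) + ennreal \<bar>g \<omega>\<bar>"
    proof (cases "0 \<le> val \<pi> N \<omega> - g \<omega>")
      case True
      then show ?thesis by (auto simp: rc intro!: ennreal_leI simp flip: ennreal_plus)
    next
      case False
      then have "ennreal (val \<pi> N \<omega>) \<le> ennreal \<bar>g \<omega>\<bar>" by (intro ennreal_leI) auto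
      also have "\<dots> \<le> ennreal (running_cost \<epsilon> N Q S R \<pi> \<omega>) + ennreal \<bar>g \<omega>\<bar>" by simp
      finally show ?thesis .
    qed
  qed
  also have "\<dots> = (\<integral>\<^sup>+\<omega>. ennreal (running_cost \<epsilon> N Q S R \<pi> \<omega>) \<partial>law \<pi> N) + (\<integral>\<^sup>+\<omega>. ennreal \<bar>g \<omega>\<bar> \<partial>law \<pi> N)"
    unfolding rc by (intro nn_integral_add) auto
  finally have "(\<integral>\<^sup>+\<omega>. ennreal (running_cost \<epsilon> N Q S R \<pi> \<omega>) \<partial>law \<pi> N) = \<infinity>"
    using g by (auto simp: top integrable_iff_bounded top_unique)
  then show ?thesis by (simp add: maxent_cost_def)
qed

section \<open>The Gaussian policy\<close>

lemma is_policy_opt: "is_policy N opt"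
  unfolding is_policy_def
proof (intro allI impI conjI ballI)
  fix k assume k: "k < N"
  have [measurable]: "(\<lambda>y. fst (fst y) k) \<in> borel_measurable (history_space k \<Otimes>\<^sub>M (borel :: (real^'m) measure))"
    by (rule measurable_history_state[OF measurable_fst order.refl])
  show "(\<lambda>(h, u). opt k h u) \<in> borel_measurable (history_space k \<Otimes>\<^sub>M borel)"
    unfolding opt_def case_prod_unfold by measurable
  show "0 \<le> opt k h u" for h u using opt_pos[OF k] by (rule less_imp_le)
  show "(\<integral>\<^sup>+u. ennreal (opt k h u) \<partial>lborel) = 1" for h
    unfolding opt_def by (rule nn_integral_gaussian_density[OF pd_W[OF k]])
qed

lemma opt_excess_integrable:
  assumes k: "k < N"
  shows "integrable lborel (\<lambda>u. opt k h u * excess k h u)"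
  using integrable_gaussian_quadratic[OF pd_W[OF k], of "- (Kt k *v fst h k)" "Rh k"]
  by (simp add: opt_def excess_def)

lemma opt_entropy_integrable:
  assumes k: "k < N"
  shows "integrable lborel (\<lambda>u. opt k h u * ln (opt k h u))"
    and "entropy_term opt k h = - (\<integral>u. opt k h u * excess k h u \<partial>lborel)"
proof -
  have eq: "opt k h u * ln (opt k h u) = ln (\<kappa> k) * opt k h u - (opt k h u * excess k h u) / \<epsilon>" for u
    by (simp add: ln_opt[OF k] algebra_simps)
  note i = opt_excess_integrable[OF k, of h] integrable_opt[OF k, of h]
  show "integrable lborel (\<lambda>u. opt k h u * ln (opt k h u))" unfolding eq using i by simp
  have "(\<integral>u. opt k h u * ln (opt k h u) \<partial>lborel) = ln (\<kappa> k) - (\<integral>u. opt k h u * excess k h u \<partial>lborel) / \<epsilon>"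
    unfolding eq using i by (simp add: integral_opt[OF k])
  then show "entropy_term opt k h = - (\<integral>u. opt k h u * excess k h u \<partial>lborel)"
    using eps by (simp add: entropy_term_def diff_entropy_def field_simps)
qed

text \<open>
  Shifted to its mean, the Gaussian policy does not depend on the history.
\<close>

lemma mean_excess_opt:
  assumes k: "k < N"
  shows "mean_excess opt k h = ennreal (\<integral>u. opt k h u * excess k h u \<partial>lborel)"
    and "(\<integral>u. opt k h u * excess k h u \<partial>lborel) = (\<integral>u. opt k h' u * excess k h' u \<partial>lborel)"
    and "0 \<le> (\<integral>u. opt k h u * excess k h u \<partial>lborel)"
proof -
  have nn: "0 \<le> opt k h u * excess k h u" for h u
    using opt_pos[OF k, of h u] excess_nonneg[OF k, of h u] by simp
  have "mean_excess opt k h = (\<integral>\<^sup>+u. ennreal (opt k h u * excess k h u) \<partial>lborel)"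
    unfolding mean_excess_def using opt_pos[OF k] excess_nonneg[OF k]
    by (intro nn_integral_cong) (simp add: ennreal_mult less_imp_le)
  also have "\<dots> = ennreal (\<integral>u. opt k h u * excess k h u \<partial>lborel)"
    by (rule nn_integral_eq_integral[OF opt_excess_integrable[OF k]]) (use nn in auto)
  finally show "mean_excess opt k h = ennreal (\<integral>u. opt k h u * excess k h u \<partial>lborel)" .
  show "0 \<le> (\<integral>u. opt k h u * excess k h u \<partial>lborel)"
    using nn by (rule Bochner_Integration.integral_nonneg)
  have std: "(\<integral>u. opt k h u * excess k h u \<partial>lborel)
      = (\<integral>w. gaussian_density 0 (W k) w * (1 / 2 * (w \<bullet> (Rh k *v w))) \<partial>lborel)" for h
  proof -
    let ?f = "\<lambda>w. gaussian_density 0 (W k) w * (1 / 2 * (w \<bullet> (Rh k *v w)))"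
    have "(\<integral>u. opt k h u * excess k h u \<partial>lborel) = (\<integral>u. ?f (Kt k *v fst h k + u) \<partial>lborel)"
      by (simp add: opt_def excess_def gaussian_density_eq add.commute)
    also have "\<dots> = (\<integral>w. ?f w \<partial>distr lborel borel ((+) (Kt k *v fst h k)))"
      by (rule integral_distr[symmetric]) measurable
    finally show ?thesis by (simp add: lborel_distr_plus)
  qed
  show "(\<integral>u. opt k h u * excess k h u \<partial>lborel) = (\<integral>u. opt k h' u * excess k h' u \<partial>lborel)"
    by (simp only: std)
qed

lemma kl_opt: "k < N \<Longrightarrow> kl opt k h = 0"
  by (simp add: kl_def mean_excess_opt opt_entropy_integrable)

lemma entropies_finite_opt: "entropies_finite opt"
  by (simp add: entropies_finite_def opt_entropy_integrable(1))

lemma val_opt_integrable: "k \<le> N \<Longrightarrow> integrable (law opt k) (val opt k)"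
proof (induction k)
  case 0 show ?case by (rule val_0_integrable)
next
  case (Suc k)
  then have k: "k < N" by simp
  interpret prob_space "law opt k" by (rule prob_space_history_law[OF pd\<Sigma>0 is_policy_opt]) (use k in simp)
  interpret st: controlled_step "law opt k" "law opt (Suc k)" "opt k" "excess k" "extend A B k"
    "val opt k" "entropy_term opt k" "val opt (Suc k)"
    by (rule controlled_step_history[OF is_policy_opt k])
  obtain c where c: "\<And>h. (\<integral>u. opt k h u * excess k h u \<partial>lborel) = c"
    using mean_excess_opt(2)[OF k] by blast
  have m: "st.m h = ennreal c" for h using mean_excess_opt(1)[OF k] by (simp add: st.m_def mean_excess_def c)
  have b: "entropy_term opt k h = - c" for h by (simp add: opt_entropy_integrable(2)[OF k] c)
  have p: "(\<integral>\<^sup>+\<omega>. ennreal (val opt (Suc k) \<omega>) \<partial>law opt (Suc k)) < \<infinity>"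
    by (rule st.positive_part_forward) (use Suc in \<open>simp_all add: m b[abs_def] emeasure_space_1 less_top\<close>)
  show ?case
    by (rule st.expectation_forward(1)[OF _ p]) (use Suc in \<open>simp_all add: m b\<close>)
qed

primrec state_cov :: "nat \<Rightarrow> real^'n^'n" where
  "state_cov 0 = \<Sigma>0"
| "state_cov (Suc k) = F k ** state_cov k ** transpose (F k) + B k ** W k ** transpose (B k)"

lemma pd_state_cov: "k \<le> N \<Longrightarrow> pd (state_cov k)"
proof (induction k)
  case (Suc k)
  then have "pd (F k ** state_cov k ** transpose (F k))" "psd (B k ** W k ** transpose (B k))"
    by (simp_all add: pd_congruence psd_congruence pd_imp_psd pd_W invertible_F)
  then show ?case by (simp add: pd_add_psd)
qed (simp add: pd\<Sigma>0)

lemma state_cov_N: "state_cov N = \<Sigma>N"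
  by (rule terminal_covariance[where \<epsilon> = \<epsilon>]) (simp_all add: W_def terminal)

text \<open>
  Given the state \<open>x\<close>, the next state is \<open>F\<^sub>k x + B\<^sub>k w\<close> with Gaussian noise \<open>w\<close> of covariance \<open>W k\<close>,
  so the state stays Gaussian by \<open>nn_integral_gaussian_mixture\<close>.
\<close>

lemma state_law_opt:
  assumes [measurable]: "f \<in> borel_measurable borel"
  shows "k \<le> N \<Longrightarrow> (\<integral>\<^sup>+\<omega>. f (fst \<omega> k) \<partial>law opt k) = (\<integral>\<^sup>+x. f x \<partial>gaussian 0 (state_cov k))"
  using assms
proof (induction k arbitrary: f)
  case 0
  note [measurable] = 0(2) measurable_history_state[OF measurable_ident_sets[OF refl] order.refl, of 0]
  show ?case by (subst nn_integral_history_law_0) auto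
next
  case (Suc k)
  then have k: "k < N" by simp
  note [measurable] = Suc.prems(2)
  note m = measurable_history_state[OF measurable_ident_sets[OF refl] order.refl, of "Suc k"]
  have f: "(\<lambda>\<omega>. f (fst \<omega> (Suc k))) \<in> borel_measurable (history_space (Suc k))"
    by (rule measurable_compose[OF m]) measurable
  define \<phi> where "\<phi> x = (\<integral>\<^sup>+w. f (F k *v x + B k *v w) \<partial>gaussian 0 (W k))" for x
  have \<phi>_eq: "\<phi> x = (\<integral>\<^sup>+w. ennreal (gaussian_density 0 (W k) w) * f (F k *v x + B k *v w) \<partial>lborel)" for x
    unfolding \<phi>_def by (rule nn_integral_gaussian) measurable
  have [measurable]: "\<phi> \<in> borel_measurable borel" unfolding \<phi>_eq by measurable
  have "(\<integral>\<^sup>+\<omega>. f (fst \<omega> (Suc k)) \<partial>law opt (Suc k))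
    = (\<integral>\<^sup>+h. \<integral>\<^sup>+v. ennreal (opt k h v) * f (fst (extend A B k h v) (Suc k)) \<partial>lborel \<partial>law opt k)"
    by (rule nn_integral_history_law_Suc[OF is_policy_opt k f])
  also have "\<dots> = (\<integral>\<^sup>+h. \<phi> (fst h k) \<partial>law opt k)"
  proof (rule nn_integral_cong)
    fix h :: "('n, 'm) history"
    let ?x = "fst h k"
    let ?g = "\<lambda>v. ennreal (gaussian_density (- (Kt k *v ?x)) (W k) v) * f (A k *v ?x + B k *v v)"
    have "(\<integral>\<^sup>+v. ennreal (opt k h v) * f (fst (extend A B k h v) (Suc k)) \<partial>lborel) = (\<integral>\<^sup>+v. ?g v \<partial>lborel)"
      by (simp add: extend_state opt_def)
    also have "\<dots> = (\<integral>\<^sup>+w. ?g (- (Kt k *v ?x) + w) \<partial>lborel)"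
      by (rule nn_integral_translation[symmetric]) measurable
    also have "\<dots> = \<phi> ?x"
      unfolding \<phi>_eq closed_loop_drift[OF k, symmetric]
      by (simp add: gaussian_density_eq matrix_vector_mult_diff_distrib algebra_simps)
    finally show "(\<integral>\<^sup>+v. ennreal (opt k h v) * f (fst (extend A B k h v) (Suc k)) \<partial>lborel) = \<phi> ?x" .
  qed
  also have "\<dots> = (\<integral>\<^sup>+x. \<phi> x \<partial>gaussian 0 (state_cov k))"
    using Suc by simp
  also have "\<dots> = (\<integral>\<^sup>+x. f x \<partial>gaussian 0 (state_cov (Suc k)))"
    unfolding \<phi>_def state_cov.simps
    by (rule nn_integral_gaussian_mixture) (use k in \<open>auto simp: pd_state_cov pd_W invertible_F\<close>)
  finally show ?case .
qed

lemma feasible_opt: "feasible N A B \<Sigma>0 \<Sigma>N opt"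
proof -
  have m: "(\<lambda>\<omega>. fst \<omega> N) \<in> borel_measurable (law opt N)"
    by (rule measurable_history_state[OF _ order.refl]) (simp add: measurable_ident_sets sets_history_law)
  have "distr (law opt N) borel (\<lambda>\<omega>. fst \<omega> N) = gaussian 0 \<Sigma>N"
  proof (rule measure_eqI)
    fix X :: "(real^'n) set" assume "X \<in> sets (distr (law opt N) borel (\<lambda>\<omega>. fst \<omega> N))"
    then have X: "X \<in> sets borel" by simp
    have "emeasure (distr (law opt N) borel (\<lambda>\<omega>. fst \<omega> N)) X
        = (\<integral>\<^sup>+x. indicator X x \<partial>distr (law opt N) borel (\<lambda>\<omega>. fst \<omega> N))"
      using X by simp
    also have "\<dots> = (\<integral>\<^sup>+\<omega>. indicator X (fst \<omega> N) \<partial>law opt N)"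
      using X by (intro nn_integral_distr[OF m]) simp
    also have "\<dots> = emeasure (gaussian 0 \<Sigma>N) X"
      using X state_law_opt[of "indicator X" N] by (simp add: state_cov_N sets_gaussian)
    finally show "emeasure (distr (law opt N) borel (\<lambda>\<omega>. fst \<omega> N)) X = emeasure (gaussian 0 \<Sigma>N) X" .
  qed (simp add: sets_gaussian)
  then show ?thesis by (simp add: feasible_def is_policy_opt case_prod_unfold)
qed

lemma maxent_cost_opt: "maxent_cost \<epsilon> N A B Q S R \<Sigma>0 opt = ereal optimal_cost"
proof -
  have "(\<integral>\<^sup>+\<omega>. ennreal (val opt N \<omega>) \<partial>law opt N) < \<infinity>"
    using val_opt_integrable[of N] by (auto simp: real_integrable_def less_top[symmetric])
  from maxent_cost_finite[OF feasible_opt entropies_finite_opt this] show ?thesis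
    by (simp add: kl_opt)
qed

lemma maxent_cost_ge:
  assumes feas: "feasible N A B \<Sigma>0 \<Sigma>N \<pi>"
  shows "ereal optimal_cost \<le> maxent_cost \<epsilon> N A B Q S R \<Sigma>0 \<pi>"
    and "maxent_cost \<epsilon> N A B Q S R \<Sigma>0 \<pi> = ereal optimal_cost \<Longrightarrow> k < N \<Longrightarrow>
      AE h in law \<pi> k. AE u in lborel. \<pi> k h u = opt k h u"
proof -
  have \<pi>: "is_policy N \<pi>" using feas by (simp add: feasible_def)
  let ?c = "entropies_finite \<pi> \<and> (\<integral>\<^sup>+\<omega>. ennreal (val \<pi> N \<omega>) \<partial>law \<pi> N) < \<infinity>"
  have fin: "maxent_cost \<epsilon> N A B Q S R \<Sigma>0 \<pi> = ereal (optimal_cost + (\<Sum>k<N. \<integral>h. kl \<pi> k h \<partial>law \<pi> k))"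
    if ?c using maxent_cost_finite[OF feas] that by blast
  have nn: "0 \<le> (\<integral>h. kl \<pi> k h \<partial>law \<pi> k)" if ?c "k < N" for k
    using val_expectation(2)[OF \<pi>, of k] that by (intro integral_nonneg_AE) auto
  show "ereal optimal_cost \<le> maxent_cost \<epsilon> N A B Q S R \<Sigma>0 \<pi>"
  proof (cases ?c)
    case True
    have "0 \<le> (\<Sum>k<N. \<integral>h. kl \<pi> k h \<partial>law \<pi> k)" by (rule sum_nonneg) (use nn[OF True] in auto)
    then show ?thesis by (simp add: fin[OF True])
  next
    case False
    then show ?thesis by (simp add: maxent_cost_infinite[OF feas])
  qed
  assume eq: "maxent_cost \<epsilon> N A B Q S R \<Sigma>0 \<pi> = ereal optimal_cost" and k: "k < N"
  have c: ?c
  proof (rule ccontr)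
    assume "\<not> ?c"
    then show False using maxent_cost_infinite[OF feas] eq by simp
  qed
  have "(\<Sum>k<N. \<integral>h. kl \<pi> k h \<partial>law \<pi> k) = 0" using eq fin[OF c] by simp
  then have z: "(\<integral>h. kl \<pi> k h \<partial>law \<pi> k) = 0"
    using nn[OF c] k by (subst (asm) sum_nonneg_eq_0_iff) auto
  have G: "integrable (law \<pi> k) (kl \<pi> k)" "AE h in law \<pi> k. 0 \<le> kl \<pi> k h"
    "AE h in law \<pi> k. mean_excess \<pi> k h < \<infinity>"
    using val_expectation(2)[OF \<pi> _ _ k] c by auto
  have "AE h in law \<pi> k. kl \<pi> k h = 0"
    using integral_nonneg_eq_0_iff_AE[OF G(1,2)] z by simp
  moreover have "AE h in law \<pi> k. integrable lborel (\<lambda>u. \<pi> k h u * ln (\<pi> k h u))"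
    using c k by (simp add: entropies_finite_def)
  moreover have "AE h in law \<pi> k. h \<in> space (law \<pi> k)" by simp
  ultimately show "AE h in law \<pi> k. AE u in lborel. \<pi> k h u = opt k h u"
    using G(3)
    by eventually_elim (rule kl_is_relative_entropy(2)[OF \<pi> k], simp_all add: space_history_law)
qed

lemma is_unique_optimal_opt: "is_unique_optimal \<epsilon> N A B Q S R \<Sigma>0 \<Sigma>N opt"
  unfolding is_unique_optimal_def is_optimal_def
proof (intro conjI allI impI)
  show "feasible N A B \<Sigma>0 \<Sigma>N opt" by (rule feasible_opt)
  show "\<bar>maxent_cost \<epsilon> N A B Q S R \<Sigma>0 opt\<bar> \<noteq> \<infinity>" by (simp add: maxent_cost_opt)
  show "maxent_cost \<epsilon> N A B Q S R \<Sigma>0 opt \<le> maxent_cost \<epsilon> N A B Q S R \<Sigma>0 \<pi>'"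
    if "feasible N A B \<Sigma>0 \<Sigma>N \<pi>'" for \<pi>'
    unfolding maxent_cost_opt by (rule maxent_cost_ge(1)[OF that])
  fix \<pi>' k
  assume o: "feasible N A B \<Sigma>0 \<Sigma>N \<pi>' \<and> \<bar>maxent_cost \<epsilon> N A B Q S R \<Sigma>0 \<pi>'\<bar> \<noteq> \<infinity> \<and>
      (\<forall>\<pi>''. feasible N A B \<Sigma>0 \<Sigma>N \<pi>'' \<longrightarrow>
        maxent_cost \<epsilon> N A B Q S R \<Sigma>0 \<pi>' \<le> maxent_cost \<epsilon> N A B Q S R \<Sigma>0 \<pi>'')" and k: "k < N"
  then have "maxent_cost \<epsilon> N A B Q S R \<Sigma>0 \<pi>' = ereal optimal_cost"
    using feasible_opt maxent_cost_opt maxent_cost_ge(1) by (metis order_antisym)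
  then show "AE h in law \<pi>' k. AE u in lborel. \<pi>' k h u = opt k h u"
    using maxent_cost_ge(2) o k by blast
qed

end

theorem corollary4:
  fixes \<epsilon> :: real and N :: nat
    and A Q :: "nat \<Rightarrow> real^'n^'n"
    and B S :: "nat \<Rightarrow> real^'m^'n"
    and R :: "nat \<Rightarrow> real^'m^'m"
    and \<Sigma>0 \<Sigma>N :: "real^'n^'n"
  assumes "\<epsilon> > 0"
    and "N \<ge> 1"
    and "\<And>k. k < N \<Longrightarrow> transpose (Q k) = Q k"
    and "\<And>k. k < N \<Longrightarrow> pd (R k)"
    and "\<And>k. k < N \<Longrightarrow> psd (Qbar Q S R k)"
    and "pd \<Sigma>0"
    and "pd \<Sigma>N"
    and A1: "\<And>k. k < N \<Longrightarrow> invertible (Abar A B S R k)"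
    and A2: "\<exists>kr\<in>{1..N}.
               (\<forall>k\<in>{kr..N}. invertible (gramian (Abar A B S R) B k 0)) \<and>
               (\<forall>k\<in>{0..kr}. invertible (gramian (Abar A B S R) B N k))"
  shows "(\<exists>P. riccati_solution \<epsilon> N (Abar A B S R) B (Qbar Q S R) R \<Sigma>0 \<Sigma>N P) \<and>
    (\<forall>P. riccati_solution \<epsilon> N (Abar A B S R) B (Qbar Q S R) R \<Sigma>0 \<Sigma>N P \<longrightarrow>
       is_unique_optimal \<epsilon> N A B Q S R \<Sigma>0 \<Sigma>N
         (\<lambda>k (x, _) u. gaussian_density
            (- (matrix_inv (R k + transpose (B k) ** P (Suc k) ** B k)
                ** (transpose (B k) ** P (Suc k) ** A k + transpose (S k)) *v x k))
            (\<epsilon> *\<^sub>R matrix_inv (R k + transpose (B k) ** P (Suc k) ** B k))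
            u))"
proof -
  define Ab where "Ab = Abar A B S R"
  define Qb where "Qb = Qbar Q S R"
  interpret lq: lq_system N Ab Qb B R
    using assms A2 by unfold_locales (auto simp: Ab_def Qb_def)
  define Y where "Y = matrix_inv lq.\<phi>12 ** \<Sigma>0 ** transpose (matrix_inv lq.\<phi>12)"
  define H where "H = psd_sqrt \<Sigma>N"
  define Z where "Z = (\<epsilon> / 2) *\<^sub>R matrix_inv \<Sigma>N
     + matrix_inv H ** psd_sqrt ((\<epsilon>\<^sup>2 / 4) *\<^sub>R mat 1 + H ** Y ** H) ** matrix_inv H"
  have psdY: "psd Y" unfolding Y_def by (intro psd_congruence pd_imp_psd \<open>pd \<Sigma>0\<close>)
  note Z = terminal_equation[OF \<open>\<epsilon> > 0\<close> \<open>pd \<Sigma>N\<close> psdY, folded H_def, folded Z_def]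
  have solution_iff: "riccati_solution \<epsilon> N Ab B Qb R \<Sigma>0 \<Sigma>N P \<longleftrightarrow>
      P N = lq.\<Lambda> + Z \<and> (\<forall>k<N. invertible (R k + transpose (B k) ** P (Suc k) ** B k) \<and>
        P k = lq.riccati_step k (P (Suc k)))" for P
    unfolding riccati_solution_def Let_def lq.\<Phi>_def[symmetric] lq.\<phi>11_def[symmetric] lq.\<phi>12_def[symmetric]
      H_def[symmetric] lq.riccati_step_def
    using lq.invertible_\<phi>12
    by (simp add: lq.\<Lambda>_def Z_def Y_def matrix_mul_assoc diff_add_eq)
  have "\<exists>P. P N = lq.\<Lambda> + Z \<and> (\<forall>k<N. P k = lq.riccati_step k (P (Suc k)))"
    by (rule backward_recursion_exists)
  then obtain P where PN: "P N = lq.\<Lambda> + Z" and rec: "\<And>k. k < N \<Longrightarrow> P k = lq.riccati_step k (P (Suc k))"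
    by blast
  have "riccati_solution \<epsilon> N Ab B Qb R \<Sigma>0 \<Sigma>N P"
    unfolding solution_iff using PN rec lq.riccati_positive[OF Z(1) PN rec, of 0]
    by (auto intro: pd_invertible)
  moreover have "is_unique_optimal \<epsilon> N A B Q S R \<Sigma>0 \<Sigma>N
         (\<lambda>k (x, _) u. gaussian_density
            (- (matrix_inv (R k + transpose (B k) ** P (Suc k) ** B k)
                ** (transpose (B k) ** P (Suc k) ** A k + transpose (S k)) *v x k))
            (\<epsilon> *\<^sub>R matrix_inv (R k + transpose (B k) ** P (Suc k) ** B k))
            u)"
    if P: "riccati_solution \<epsilon> N Ab B Qb R \<Sigma>0 \<Sigma>N P" for P
  proof -
    interpret mc: maxent_control N A Q B S R P Z \<epsilon> \<Sigma>0 \<Sigma>N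
    proof -
      have "riccati_lq_system N Ab Qb B R P Z"
        using P[unfolded solution_iff] Z(1) by unfold_locales auto
      then interpret rs: riccati_lq_system N "Abar A B S R" "Qbar Q S R" B R P Z
        by (simp only: Ab_def Qb_def)
      show "maxent_control N A Q B S R P Z \<epsilon> \<Sigma>0 \<Sigma>N"
        using Z(2) \<open>\<epsilon> > 0\<close> \<open>pd \<Sigma>0\<close> \<open>pd \<Sigma>N\<close>
        by unfold_locales (simp_all add: Y_def Ab_def Qb_def)
    qed
    show ?thesis
      using mc.is_unique_optimal_opt
      unfolding mc.opt_def[abs_def] mc.Kt_def mc.W_def mc.Rh_def
      by (simp add: case_prod_unfold)
  qed
  ultimately show ?thesis unfolding Ab_def Qb_def by blast
qed

end
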